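(* For every $q\in\mathbb R_{>0}$, let $\mathrm{ev}_q:\mathbb A\to\mathbb C$ be the evaluation at $q$. For each such $q$, the specialization of $U_{\mathbb A}(\mathfrak g)$ at $q$, that is $\mathbb C\otimes_{\mathrm{ev}_q}U_{\mathbb A}(\mathfrak g)$, is isomorphic to $U(\mathfrak{sl}_2(\mathbb C))$ if $q=1$, and if $q\neq1$ it identifies with $U_q(\mathfrak g)$ (defined over $\mathbb C$ with parameter $q$) via the equalities $$x=\frac{X-1}{q-q^{-1}},\quad y=\frac{Y-1}{q-q^{-1}},\quad z=\frac{Z}{q-q^{-1}},$$ and the identification of $\theta$ with $\theta$.
   Context: An involutive extension of $\mathbb C$ is an extension field $\mathbb K$ of $\mathbb C$ with an involutive automorphism restricting to complex conjugation on $\mathbb C$. For an involutive extension $\mathbb K$ of $\mathbb C$ and $q\in\mathbb K^\times$ not a root of unity and having self-adjoint (i.e. fixed by the involution) square roots, $U_q(\mathfrak g)$ is the unital associative $\mathbb K$-algebra generated by $X,Y,Z,\theta$ subject to $XZ=q^2ZX$, $ZY=q^2YZ$, $XY+q^2Z^2=1$, $YX+q^{-2}Z^2=1$, $qX\theta-q^{-1}\theta X=q\theta Y-q^{-1}Y\theta=[2]_qZ$, $\theta Z-Z\theta=Y-X$, where $[2]_q=q+q^{-1}$. $\mathbb A$ is the ring of complex-valued real analytic functions on $\mathbb R_{>0}$, $\mathbb F$ is its field of fractions (an involutive extension of $\mathbb C$ via pointwise complex conjugation), and $\boldsymbol q\in\mathbb A^\times$ is the identity function. $U_{\mathbb F}(\mathfrak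 g)$ denotes $U_{\boldsymbol q}(\mathfrak g)$ over $\mathbb K=\mathbb F$. $U_{\mathbb A}(\mathfrak g)$ is the unital $\mathbb A$-subalgebra of $U_{\mathbb F}(\mathfrak g)$ generated by $\theta$, $x=\frac{X-1}{\boldsymbol q-\boldsymbol q^{-1}}$, $y=\frac{Y-1}{\boldsymbol q-\boldsymbol q^{-1}}$, $z=\frac{Z}{\boldsymbol q-\boldsymbol q^{-1}}$. *)

theory Defs
  imports
    "HOL-Complex_Analysis.Complex_Analysis"
    "HOL-Computational_Algebra.Fraction_Field"
    "HOL-Library.Poly_Mapping"
    "HOL-Algebra.QuotRing"
    "HOL-Algebra.Subrings"
    "HOL-Algebra.Module"
begin

hide_const (open) Poly_Mapping.range Poly_Mapping.map Poly_Mapping.lookup Poly_Mapping.keys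
  Poly_Mapping.single

section \<open>Complex-valued real analytic functions on the positive half-line\<close>

definition real_analytic_at :: "(real \<Rightarrow> complex) \<Rightarrow> real \<Rightarrow> bool" where
  "real_analytic_at f x \<longleftrightarrow>
     (\<exists>r>0. \<exists>a :: nat \<Rightarrow> complex. \<forall>t. \<bar>t - x\<bar> < r \<longrightarrow>
        (\<lambda>n. a n * complex_of_real (t - x) ^ n) sums f t)"

lemma real_analytic_at_iff_holomorphic:
  "real_analytic_at f x \<longleftrightarrow>
     (\<exists>r>0. \<exists>g. g holomorphic_on ball (complex_of_real x) r \<and>
        (\<forall>t. \<bar>t - x\<bar> < r \<longrightarrow> g (complex_of_real t) = f t))" (is "?L \<longleftrightarrow> ?R")
proof
  assume ?L
  then obtain r a where r: "r > 0"
    and a: "\<And>t. \<bar>t - x\<bar> < r \<Longrightarrow> (\<lambda>n. a n * complex_of_real (t - x) ^ n) sums f t"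
    unfolding real_analytic_at_def by blast
  define g where "g w = suminf (\<lambda>n. a n * (w - complex_of_real x) ^ n)" for w
  have "(\<lambda>n. a n * (w - complex_of_real x) ^ n) sums g w"
    if w: "w \<in> ball (complex_of_real x) r" for w
  proof -
    obtain s where s: "norm (w - complex_of_real x) < s" "s < r"
      using w dense[of "norm (w - complex_of_real x)" r] by (auto simp: dist_norm norm_minus_commute)
    then have "s > 0" by (meson le_less_trans norm_ge_zero)
    with s a[of "x + s"] have "summable (\<lambda>n. a n * complex_of_real s ^ n)"
      by (auto simp: sums_iff)
    then have "summable (\<lambda>n. a n * (w - complex_of_real x) ^ n)"
      by (rule powser_inside) (use s in auto)
    then show ?thesis unfolding g_def by (rule summable_sums)
  qed
  then have hol: "g holomorphic_on ball (complex_of_real x) r"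
    by (rule power_series_holomorphic)
  have "g (complex_of_real t) = f t" if "\<bar>t - x\<bar> < r" for t
    using a[OF that] unfolding g_def by (simp add: sums_iff)
  with r hol show ?R by blast
next
  assume ?R
  then obtain r g where r: "r > 0" and g: "g holomorphic_on ball (complex_of_real x) r"
    and eq: "\<And>t. \<bar>t - x\<bar> < r \<Longrightarrow> g (complex_of_real t) = f t" by blast
  define a where "a n = (deriv ^^ n) g (complex_of_real x) / fact n" for n
  have "(\<lambda>n. a n * complex_of_real (t - x) ^ n) sums f t" if "\<bar>t - x\<bar> < r" for t
  proof -
    have "norm (complex_of_real x - complex_of_real t) < r"
      using that by (metis abs_minus_commute norm_of_real of_real_diff)
    then have "complex_of_real t \<in> ball (complex_of_real x) r" by (simp add: dist_norm)
    from holomorphic_power_series[OF g this] eq[OF that] show ?thesis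
      by (simp add: a_def)
  qed
  with r show ?L unfolding real_analytic_at_def by blast
qed

lemma real_analytic_at_combine:
  assumes "real_analytic_at f x" "real_analytic_at g x"
    and hol: "\<And>r F G. F holomorphic_on ball (complex_of_real x) r \<Longrightarrow>
        G holomorphic_on ball (complex_of_real x) r \<Longrightarrow>
        (\<lambda>z. H (F z) (G z)) holomorphic_on ball (complex_of_real x) r"
  shows "real_analytic_at (\<lambda>t. H (f t) (g t)) x"
proof -
  obtain r F where F: "r > 0" "F holomorphic_on ball (complex_of_real x) r"
    "\<And>t. \<bar>t - x\<bar> < r \<Longrightarrow> F (complex_of_real t) = f t"
    using assms(1) unfolding real_analytic_at_iff_holomorphic by blast
  obtain s G where G: "s > 0" "G holomorphic_on ball (complex_of_real x) s"
    "\<And>t. \<bar>t - x\<bar> < s \<Longrightarrow> G (complex_of_real t) = g t"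
    using assms(2) unfolding real_analytic_at_iff_holomorphic by blast
  have "(\<lambda>z. H (F z) (G z)) holomorphic_on ball (complex_of_real x) (min r s)"
    by (rule hol) (use F(2) G(2) in \<open>auto elim!: holomorphic_on_subset\<close>)
  then show ?thesis unfolding real_analytic_at_iff_holomorphic
    by (intro exI[of _ "min r s"] conjI exI[of _ "\<lambda>z. H (F z) (G z)"])
      (use F G in auto)
qed

lemma real_analytic_at_of_holomorphic:
  assumes "g holomorphic_on UNIV"
  shows "real_analytic_at (\<lambda>t. g (complex_of_real t)) x"
  unfolding real_analytic_at_iff_holomorphic
  by (intro exI[of _ 1] conjI exI[of _ g]) (use assms in \<open>auto elim: holomorphic_on_subset\<close>)

lemma real_analytic_at_local:
  assumes "real_analytic_at f x" "x > 0" "\<And>t. t > 0 \<Longrightarrow> g t = f t"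
  shows "real_analytic_at g x"
proof -
  obtain r F where F: "r > 0" "F holomorphic_on ball (complex_of_real x) r"
    "\<And>t. \<bar>t - x\<bar> < r \<Longrightarrow> F (complex_of_real t) = f t"
    using assms(1) unfolding real_analytic_at_iff_holomorphic by blast
  show ?thesis unfolding real_analytic_at_iff_holomorphic
    by (intro exI[of _ "min r x"] conjI exI[of _ F])
      (use F assms(2,3) in \<open>auto elim!: holomorphic_on_subset\<close>)
qed

text \<open>A function on the positive half-line is represented by its extension by \<open>0\<close> to the
  non-positive reals; analyticity is only required at positive points.\<close>

typedef analytic_fun = "{f :: real \<Rightarrow> complex. (\<forall>x>0. real_analytic_at f x) \<and> (\<forall>x\<le>0. f x = 0)}"
  morphisms afun Abs_afun
proof (rule exI[of _ "\<lambda>_. 0"])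
  show "(\<lambda>_. 0) \<in> {f. (\<forall>x>0. real_analytic_at f x) \<and> (\<forall>x\<le>0. f x = 0)}"
    using real_analytic_at_of_holomorphic[of "\<lambda>_. 0"] by auto
qed

setup_lifting type_definition_analytic_fun

lemma afun_eqI: "(\<And>x. x > 0 \<Longrightarrow> afun f x = afun g x) \<Longrightarrow> f = g"
proof -
  assume eq: "\<And>x. x > 0 \<Longrightarrow> afun f x = afun g x"
  have "afun f x = afun g x" for x
    using eq[of x] afun[of f] afun[of g] by (cases "x > 0") auto
  then show ?thesis by (simp add: afun_inject[symmetric] fun_eq_iff)
qed

instantiation analytic_fun :: comm_ring_1
begin

lift_definition zero_analytic_fun :: analytic_fun is "\<lambda>_. 0"
  using real_analytic_at_of_holomorphic[of "\<lambda>_. 0"] by auto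

lift_definition one_analytic_fun :: analytic_fun is "\<lambda>x. if x > 0 then 1 else 0"
  by (auto intro!: real_analytic_at_local[OF real_analytic_at_of_holomorphic[of "\<lambda>_. 1"]])

lift_definition plus_analytic_fun :: "analytic_fun \<Rightarrow> analytic_fun \<Rightarrow> analytic_fun"
  is "\<lambda>f g x. f x + g x"
  by (auto intro!: real_analytic_at_combine[where H = "(+)"] holomorphic_intros)

lift_definition minus_analytic_fun :: "analytic_fun \<Rightarrow> analytic_fun \<Rightarrow> analytic_fun"
  is "\<lambda>f g x. f x - g x"
  by (auto intro!: real_analytic_at_combine[where H = "(-)"] holomorphic_intros)

lift_definition uminus_analytic_fun :: "analytic_fun \<Rightarrow> analytic_fun" is "\<lambda>f x. - f x"
  by (auto intro!: real_analytic_at_combine[where H = "\<lambda>u _. - u"] holomorphic_intros)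

lift_definition times_analytic_fun :: "analytic_fun \<Rightarrow> analytic_fun \<Rightarrow> analytic_fun"
  is "\<lambda>f g x. f x * g x"
  by (auto intro!: real_analytic_at_combine[where H = "(*)"] holomorphic_intros)

instance
proof
  show "(0::analytic_fun) \<noteq> 1"
    by transfer (auto simp: fun_eq_iff intro!: exI[of _ 1])
qed (transfer; force simp: algebra_simps fun_eq_iff)+

end

lemma real_analytic_vanish_clopen:
  assumes "\<And>x. x > 0 \<Longrightarrow> real_analytic_at g x"
    and t0: "t0 > 0" and zero: "eventually (\<lambda>t. g t = 0) (nhds t0)"
    and x: "x > 0"
  shows "g x = 0"
proof -
  define Z where "Z = {t. t > 0 \<and> eventually (\<lambda>t. g t = 0) (nhds t)}"
  have opZ: "open Z"
  proof -
    have "Z = {0<..} \<inter> {t. eventually (\<lambda>t. g t = 0) (nhds t)}" by (auto simp: Z_def)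
    moreover have "open {t::real. eventually (\<lambda>t. g t = 0) (nhds t)}"
      unfolding eventually_nhds by (subst open_subopen) blast
    ultimately show ?thesis by (auto intro: open_Int)
  qed
  have "openin (top_of_set {0<..}) Z"
    using opZ by (auto simp: Z_def openin_open)
  moreover have "closedin (top_of_set {0<..}) Z"
    unfolding closedin_limpt
  proof (intro conjI allI impI)
    show "Z \<subseteq> {0<..}" by (auto simp: Z_def)
    fix y assume "y islimpt Z \<and> y \<in> {0<..}"
    then have lim: "y islimpt Z" and y: "y \<in> {0<..}" by auto
    obtain r F where F: "r > 0" "F holomorphic_on ball (complex_of_real y) r"
      "\<And>t. \<bar>t - y\<bar> < r \<Longrightarrow> F (complex_of_real t) = g t"
      using assms(1)[of y] y unfolding real_analytic_at_iff_holomorphic by auto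
    have limC: "complex_of_real y islimpt (complex_of_real ` (Z \<inter> ball y r))"
    proof -
      have "\<exists>t\<in>Z \<inter> ball y r. t \<noteq> y \<and> dist t y < e" if "e > 0" for e
      proof -
        have "min e r > 0" using that F(1) by simp
        then obtain t where "t \<in> Z" "t \<noteq> y" "dist t y < min e r"
          using lim unfolding islimpt_approachable by blast
        then show ?thesis by (auto simp: dist_commute)
      qed
      then show ?thesis
        unfolding islimpt_approachable by (force simp: dist_of_real)
    qed
    have "F z = 0" if "z \<in> ball (complex_of_real y) r" for z
    proof (rule analytic_continuation[OF F(2) _ _ _ _ limC _ that])
      show "complex_of_real ` (Z \<inter> ball y r) \<subseteq> ball (complex_of_real y) r"
        by (auto simp: dist_of_real)
      show "F z = 0" if "z \<in> complex_of_real ` (Z \<inter> ball y r)" for z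
        using that F(3) by (auto simp: Z_def dist_real_def abs_minus_commute dest: eventually_nhds_x_imp_x)
    qed (use F(1) in auto)
    then have "g t = 0" if "\<bar>t - y\<bar> < r" for t
      using F(3)[OF that] that by (auto simp: dist_of_real dist_real_def abs_minus_commute)
    then have "eventually (\<lambda>t. g t = 0) (nhds y)"
      using F(1) unfolding eventually_nhds_metric by (auto simp: dist_real_def)
    then show "y \<in> Z" using y by (auto simp: Z_def)
  qed
  moreover have "connected {0::real<..}" by simp
  moreover have "t0 \<in> Z" using t0 zero by (simp add: Z_def)
  ultimately have "Z = {0<..}" unfolding connected_clopen by blast
  with x have "x \<in> Z" by simp
  then show ?thesis by (auto simp: Z_def dest: eventually_nhds_x_imp_x)
qed

instance analytic_fun :: idom
proof
  fix f g :: analytic_fun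
  assume "f \<noteq> 0" "g \<noteq> 0"
  then obtain t0 where t0: "t0 > 0" "afun f t0 \<noteq> 0"
    by (metis afun_eqI zero_analytic_fun.rep_eq)
  have fa: "\<And>x. x > 0 \<Longrightarrow> real_analytic_at (afun f) x"
    and ga: "\<And>x. x > 0 \<Longrightarrow> real_analytic_at (afun g) x"
    using afun by auto
  show "f * g \<noteq> 0"
  proof
    assume 0: "f * g = 0"
    obtain r F where F: "r > 0" "F holomorphic_on ball (complex_of_real t0) r"
      "\<And>t. \<bar>t - t0\<bar> < r \<Longrightarrow> F (complex_of_real t) = afun f t"
      using fa[OF t0(1)] unfolding real_analytic_at_iff_holomorphic by auto
    have "isCont F (complex_of_real t0)"
      using F(1,2) by (meson centre_in_ball continuous_on_eq_continuous_at holomorphic_on_imp_continuous_on open_ball)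
    then have "isCont (\<lambda>t. F (complex_of_real t)) t0"
      by (intro isCont_o2[of t0 complex_of_real F]) auto
    moreover have "F (complex_of_real t0) \<noteq> 0" using F t0 by auto
    ultimately have "eventually (\<lambda>t. F (complex_of_real t) \<noteq> 0) (nhds t0)"
      by (simp add: continuous_within tendsto_imp_eventually_ne eventually_nhds_conv_at)
    moreover have "eventually (\<lambda>t. \<bar>t - t0\<bar> < r) (nhds t0)"
      using F(1) unfolding eventually_nhds_metric by (auto simp: dist_real_def)
    ultimately have "eventually (\<lambda>t. afun g t = 0) (nhds t0)"
    proof eventually_elim
      case (elim t)
      have "afun f t * afun g t = 0"
        using 0 by (metis times_analytic_fun.rep_eq zero_analytic_fun.rep_eq)
      with elim F(3) show ?case by auto
    qed
    then have "afun g x = 0" if "x > 0" for x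
      using real_analytic_vanish_clopen[OF ga t0(1) _ that] by blast
    with \<open>g \<noteq> 0\<close> show False by (metis afun_eqI zero_analytic_fun.rep_eq)
  qed
qed

text \<open>The field \<open>\<bbbF>\<close> is \<^typ>\<open>analytic_fun fract\<close>.\<close>

definition ev :: "real \<Rightarrow> analytic_fun \<Rightarrow> complex" where
  "ev q f = afun f q"

lift_definition id_afun :: analytic_fun is "\<lambda>x. if x > 0 then complex_of_real x else 0"
  by (auto intro!: real_analytic_at_local[OF real_analytic_at_of_holomorphic[of "\<lambda>z. z"]])

definition to_F :: "analytic_fun \<Rightarrow> analytic_fun fract" where
  "to_F a = Fract a 1"

definition qF :: "analytic_fun fract" where
  "qF = to_F id_afun"


section \<open>Associative algebras\<close>

text \<open>Associative unital algebras over (the type of) a commutative ring \<open>'k\<close> are given by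
  records of type \<^typ>\<open>('k, 'a) module\<close>, the scalars ranging over all of \<open>'k\<close>.\<close>

definition algebra_iso :: "('k, 'a) module \<Rightarrow> ('k, 'b) module \<Rightarrow> ('a \<Rightarrow> 'b) set" where
  "algebra_iso A B =
     {h \<in> ring_iso A B. \<forall>c. \<forall>a\<in>carrier A. h (c \<odot>\<^bsub>A\<^esub> a) = c \<odot>\<^bsub>B\<^esub> h a}"

definition quotient_algebra :: "('k, 'a) module \<Rightarrow> 'a set \<Rightarrow> ('k, 'a set) module" where
  "quotient_algebra A I =
     \<lparr>carrier = carrier (A Quot I), mult = mult (A Quot I), one = one (A Quot I),
      zero = zero (A Quot I), add = add (A Quot I),
      smult = (\<lambda>c P. \<Union>p\<in>P. I +>\<^bsub>A\<^esub> (c \<odot>\<^bsub>A\<^esub> p))\<rparr>"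

definition restrict_scalars :: "('a \<Rightarrow> 'k) \<Rightarrow> ('k, 'u) module \<Rightarrow> ('a, 'u) module" where
  "restrict_scalars \<phi> U =
     \<lparr>carrier = carrier U, mult = mult U, one = one U, zero = zero U, add = add U,
      smult = (\<lambda>a u. \<phi> a \<odot>\<^bsub>U\<^esub> u)\<rparr>"

definition generated_subalgebra :: "('k, 'a) module \<Rightarrow> 'a set \<Rightarrow> 'a set" where
  "generated_subalgebra A S =
     \<Inter>{V. subring V A \<and> (\<forall>c. \<forall>v\<in>V. c \<odot>\<^bsub>A\<^esub> v \<in> V) \<and> S \<subseteq> V}"

subsection \<open>Monoid algebras\<close>

definition monoid_algebra ::
    "('m, 'e) monoid_scheme \<Rightarrow> ('k::comm_ring_1, 'm \<Rightarrow>\<^sub>0 'k) module" where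
  "monoid_algebra M =
     \<lparr>carrier = {p. Poly_Mapping.keys p \<subseteq> carrier M},
      mult = (\<lambda>p r. \<Sum>a\<in>Poly_Mapping.keys p. \<Sum>b\<in>Poly_Mapping.keys r.
        Poly_Mapping.single (a \<otimes>\<^bsub>M\<^esub> b) (Poly_Mapping.lookup p a * Poly_Mapping.lookup r b)),
      one = Poly_Mapping.single \<one>\<^bsub>M\<^esub> 1,
      zero = 0,
      add = (+),
      smult = (\<lambda>c p. Poly_Mapping.map ((*) c) p)\<rparr>"

lemma monoid_algebra_mult_superset:
  assumes "finite A" "finite B" "Poly_Mapping.keys p \<subseteq> A" "Poly_Mapping.keys r \<subseteq> B"
  shows "p \<otimes>\<^bsub>monoid_algebra M\<^esub> r = (\<Sum>a\<in>A. \<Sum>b\<in>B.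
     Poly_Mapping.single (a \<otimes>\<^bsub>M\<^esub> b) (Poly_Mapping.lookup p a * Poly_Mapping.lookup r b))"
proof -
  have "p \<otimes>\<^bsub>monoid_algebra M\<^esub> r = (\<Sum>a\<in>Poly_Mapping.keys p. \<Sum>b\<in>B.
     Poly_Mapping.single (a \<otimes>\<^bsub>M\<^esub> b) (Poly_Mapping.lookup p a * Poly_Mapping.lookup r b))"
    unfolding monoid_algebra_def partial_object.simps monoid.simps
    by (intro sum.cong refl sum.mono_neutral_left)
      (use assms in \<open>auto simp: not_in_keys_iff_lookup_eq_zero\<close>)
  also have "\<dots> = (\<Sum>a\<in>A. \<Sum>b\<in>B.
     Poly_Mapping.single (a \<otimes>\<^bsub>M\<^esub> b) (Poly_Mapping.lookup p a * Poly_Mapping.lookup r b))"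
    using assms by (intro sum.mono_neutral_left) (auto simp: not_in_keys_iff_lookup_eq_zero)
  finally show ?thesis .
qed

lemma monoid_algebra_distrib:
  "(p + p') \<otimes>\<^bsub>monoid_algebra M\<^esub> r = p \<otimes>\<^bsub>monoid_algebra M\<^esub> r + p' \<otimes>\<^bsub>monoid_algebra M\<^esub> r" (is ?A)
  "r \<otimes>\<^bsub>monoid_algebra M\<^esub> (p + p') = r \<otimes>\<^bsub>monoid_algebra M\<^esub> p + r \<otimes>\<^bsub>monoid_algebra M\<^esub> p'" (is ?B)
proof -
  let ?K = "Poly_Mapping.keys p \<union> Poly_Mapping.keys p'"
  have K: "finite ?K" "Poly_Mapping.keys (p + p') \<subseteq> ?K"
    by (auto simp: keys_add)
  note L = monoid_algebra_mult_superset[where A = ?K and B = "Poly_Mapping.keys r" and M = M and r = r]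
  note R = monoid_algebra_mult_superset[where B = ?K and A = "Poly_Mapping.keys r" and M = M and p = r]
  show ?A using K(2) by (simp add: L lookup_add algebra_simps single_add sum.distrib)
  show ?B using K(2) by (simp add: R lookup_add algebra_simps single_add sum.distrib)
qed

lemma monoid_algebra_mult_zero [simp]:
  "0 \<otimes>\<^bsub>monoid_algebra M\<^esub> r = 0" "r \<otimes>\<^bsub>monoid_algebra M\<^esub> 0 = 0"
  by (auto simp: monoid_algebra_def)

lemma monoid_algebra_mult_sum:
  "(\<Sum>i\<in>I. f i) \<otimes>\<^bsub>monoid_algebra M\<^esub> r = (\<Sum>i\<in>I. f i \<otimes>\<^bsub>monoid_algebra M\<^esub> r)"
  "r \<otimes>\<^bsub>monoid_algebra M\<^esub> (\<Sum>i\<in>I. f i) = (\<Sum>i\<in>I. r \<otimes>\<^bsub>monoid_algebra M\<^esub> f i)"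
  by (induction I rule: infinite_finite_induct) (auto simp: monoid_algebra_distrib)

lemma monoid_algebra_mult_single:
  "Poly_Mapping.single a c \<otimes>\<^bsub>monoid_algebra M\<^esub> Poly_Mapping.single b d =
     Poly_Mapping.single (a \<otimes>\<^bsub>M\<^esub> b) (c * d)"
  by (subst monoid_algebra_mult_superset[where A = "{a}" and B = "{b}"]) auto

lemma poly_mapping_sum_singles:
  "p = (\<Sum>k\<in>Poly_Mapping.keys p. Poly_Mapping.single k (Poly_Mapping.lookup p k))"
  by (rule poly_mapping_eqI)
    (auto simp: lookup_sum lookup_single when_def not_in_keys_iff_lookup_eq_zero)

lemma monoid_algebra_induct [consumes 1, case_names zero single add]:
  assumes p: "p \<in> carrier (monoid_algebra M :: ('k::comm_ring_1, 'm \<Rightarrow>\<^sub>0 'k) module)"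
    and zero: "P 0"
    and single: "\<And>a c. a \<in> carrier M \<Longrightarrow> P (Poly_Mapping.single a c)"
    and add: "\<And>r s. P r \<Longrightarrow> P s \<Longrightarrow> P (r + s)"
  shows "P p"
proof -
  have "P (\<Sum>k\<in>I. Poly_Mapping.single k (Poly_Mapping.lookup p k))" if "I \<subseteq> carrier M" for I
    using that
  proof (induction I rule: infinite_finite_induct)
    case (insert x F)
    then show ?case by (simp add: add single)
  qed (auto simp: zero)
  with p show ?thesis
    by (subst poly_mapping_sum_singles) (simp add: monoid_algebra_def)
qed

lemma monoid_algebra_ring:
  assumes "monoid M"
  shows "ring (monoid_algebra M :: ('k::comm_ring_1, 'm \<Rightarrow>\<^sub>0 'k) module)"
proof -
  interpret monoid M by fact
  let ?R = "monoid_algebra M :: ('k, 'm \<Rightarrow>\<^sub>0 'k) module"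
  have plus: "p + r \<in> carrier ?R" if "p \<in> carrier ?R" "r \<in> carrier ?R" for p r
    using that keys_add[of p r] by (auto simp: monoid_algebra_def)
  have single: "Poly_Mapping.single a c \<in> carrier ?R" if "a \<in> carrier M" for a c
    using that by (auto simp: monoid_algebra_def)
  have zero: "0 \<in> carrier ?R"
    by (auto simp: monoid_algebra_def)
  have cl: "p \<otimes>\<^bsub>?R\<^esub> r \<in> carrier ?R" if p: "p \<in> carrier ?R" and r: "r \<in> carrier ?R" for p r
    using p
  proof (induction p rule: monoid_algebra_induct)
    case (single a c)
    note a = single
    show ?case using r
    proof (induction r rule: monoid_algebra_induct)
      case (single b d)
      with a show ?case using \<open>\<And>c a. a \<in> carrier M \<Longrightarrow> Poly_Mapping.single a c \<in> carrier ?R\<close>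
        by (simp add: monoid_algebra_mult_single)
    qed (simp_all add: monoid_algebra_distrib plus zero)
  qed (simp_all add: monoid_algebra_distrib plus zero)
  have one: "Poly_Mapping.single \<one>\<^bsub>M\<^esub> 1 \<otimes>\<^bsub>?R\<^esub> p = p" "p \<otimes>\<^bsub>?R\<^esub> Poly_Mapping.single \<one>\<^bsub>M\<^esub> 1 = p"
    if p: "p \<in> carrier ?R" for p
    using p by (induction p rule: monoid_algebra_induct)
      (simp_all add: monoid_algebra_distrib monoid_algebra_mult_single)
  have assoc: "(p \<otimes>\<^bsub>?R\<^esub> r) \<otimes>\<^bsub>?R\<^esub> s = p \<otimes>\<^bsub>?R\<^esub> (r \<otimes>\<^bsub>?R\<^esub> s)"
    if p: "p \<in> carrier ?R" and r: "r \<in> carrier ?R" and s: "s \<in> carrier ?R" for p r s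
    using p
  proof (induction p rule: monoid_algebra_induct)
    case (single a c)
    note a = single
    show ?case using r
    proof (induction r rule: monoid_algebra_induct)
      case (single b d)
      note b = single
      show ?case using s
        by (induction s rule: monoid_algebra_induct)
          (simp_all add: a b monoid_algebra_distrib monoid_algebra_mult_single m_assoc mult.assoc)
    qed (simp_all add: monoid_algebra_distrib)
  qed (simp_all add: monoid_algebra_distrib)
  have eqs: "p \<oplus>\<^bsub>?R\<^esub> r = p + r" "\<zero>\<^bsub>?R\<^esub> = 0" "\<one>\<^bsub>?R\<^esub> = Poly_Mapping.single \<one>\<^bsub>M\<^esub> 1" for p r
    by (simp_all add: monoid_algebra_def)
  have neg: "\<exists>r\<in>carrier ?R. p + r = 0" if "p \<in> carrier ?R" for p
    using that by (intro bexI[of _ "- p"]) (auto simp: monoid_algebra_def in_keys_iff)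
  show ?thesis
  proof (rule ringI)
    show "abelian_group ?R"
      by (rule abelian_groupI) (simp_all only: eqs plus zero neg ac_simps add_0_left add_0_right)
    show "Group.monoid ?R"
      by (rule monoidI) (simp_all only: eqs single[OF one_closed] cl one assoc)
  qed (simp_all only: eqs monoid_algebra_distrib)
qed

subsection \<open>Algebras given by generators and relations\<close>

definition free_monoid :: "'s set \<Rightarrow> 's list monoid" where
  "free_monoid S = \<lparr>carrier = lists S, mult = (@), one = []\<rparr>"

definition free_algebra :: "'s set \<Rightarrow> ('k::comm_ring_1, 's list \<Rightarrow>\<^sub>0 'k) module" where
  "free_algebra S = monoid_algebra (free_monoid S)"

definition letter :: "'s \<Rightarrow> ('s list \<Rightarrow>\<^sub>0 'k::comm_ring_1)" where
  "letter s = Poly_Mapping.single [s] 1"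

text \<open>A relation \<open>l = r\<close> is given as the pair \<open>(l, r)\<close>. Note that ideals in HOL-Algebra are
  two-sided.\<close>

definition relation_ideal ::
    "'s set \<Rightarrow> (('s list \<Rightarrow>\<^sub>0 'k) \<times> ('s list \<Rightarrow>\<^sub>0 'k)) set \<Rightarrow> ('s list \<Rightarrow>\<^sub>0 'k::comm_ring_1) set" where
  "relation_ideal S Rel =
     Idl\<^bsub>free_algebra S\<^esub> {l \<ominus>\<^bsub>free_algebra S\<^esub> r | l r. (l, r) \<in> Rel}"

definition presented_algebra ::
    "'s set \<Rightarrow> (('s list \<Rightarrow>\<^sub>0 'k) \<times> ('s list \<Rightarrow>\<^sub>0 'k)) set \<Rightarrow>
     ('k::comm_ring_1, ('s list \<Rightarrow>\<^sub>0 'k) set) module" where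
  "presented_algebra S Rel = quotient_algebra (free_algebra S) (relation_ideal S Rel)"

definition presented_gen ::
    "'s set \<Rightarrow> (('s list \<Rightarrow>\<^sub>0 'k) \<times> ('s list \<Rightarrow>\<^sub>0 'k)) set \<Rightarrow> 's \<Rightarrow> ('s list \<Rightarrow>\<^sub>0 'k::comm_ring_1) set" where
  "presented_gen S Rel s = relation_ideal S Rel +>\<^bsub>free_algebra S\<^esub> letter s"

lemma free_algebra_ring: "ring (free_algebra S :: ('k::comm_ring_1, 's list \<Rightarrow>\<^sub>0 'k) module)"
  unfolding free_algebra_def
  by (intro monoid_algebra_ring monoidI) (auto simp: free_monoid_def)

subsection \<open>Extension of scalars\<close>

text \<open>For a homomorphism \<open>\<phi>\<close> from a commutative ring \<open>'a\<close> to a commutative ring \<open>'b\<close> and an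
  algebra \<open>U\<close> over \<open>'a\<close>, the algebra \<open>'b \<otimes>\<^sub>\<phi> U\<close> over \<open>'b\<close> is the free abelian group on the
  symbols \<open>(b, u)\<close> modulo the subgroup generated by the usual relations, with multiplication
  induced by \<open>(b, u) (b', u') = (b b', u u')\<close> and with \<open>c\<close> acting by \<open>(b, u) \<mapsto> (c b, u)\<close>. The free
  abelian group with this multiplication is the integral monoid ring of the product of the
  multiplicative monoids of \<open>'b\<close> and \<open>U\<close>.\<close>

definition tensor_pre ::
    "('a, 'u) module \<Rightarrow> (int, ('b::comm_ring_1 \<times> 'u) \<Rightarrow>\<^sub>0 int) module" where
  "tensor_pre U = monoid_algebra (\<lparr>carrier = UNIV, mult = (*), one = 1\<rparr> \<times>\<times> U)"

definition tensor_relations ::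
    "('a \<Rightarrow> 'b) \<Rightarrow> ('a, 'u) module \<Rightarrow>
     ((('b::comm_ring_1 \<times> 'u) \<Rightarrow>\<^sub>0 int) \<times> (('b \<times> 'u) \<Rightarrow>\<^sub>0 int)) set" where
  "tensor_relations \<phi> U = (let e = (\<lambda>b u. Poly_Mapping.single (b, u) 1) in
     {(e (b + b') u, e b u + e b' u) | b b' u. u \<in> carrier U} \<union>
     {(e b (u \<oplus>\<^bsub>U\<^esub> u'), e b u + e b u') | b u u'. u \<in> carrier U \<and> u' \<in> carrier U} \<union>
     {(e (b * \<phi> a) u, e b (a \<odot>\<^bsub>U\<^esub> u)) | b a u. u \<in> carrier U})"

definition tensor_subgroup ::
    "('a \<Rightarrow> 'b) \<Rightarrow> ('a, 'u) module \<Rightarrow> (('b::comm_ring_1 \<times> 'u) \<Rightarrow>\<^sub>0 int) set" where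
  "tensor_subgroup \<phi> U =
     generate (add_monoid (tensor_pre U)) {l - r | l r. (l, r) \<in> tensor_relations \<phi> U}"

definition base_change ::
    "('a \<Rightarrow> 'b) \<Rightarrow> ('a, 'u) module \<Rightarrow> ('b::comm_ring_1, (('b \<times> 'u) \<Rightarrow>\<^sub>0 int) set) module" where
  "base_change \<phi> U = (let T = tensor_pre U; N = tensor_subgroup \<phi> U in
     \<lparr>carrier = carrier (T Quot N), mult = mult (T Quot N), one = one (T Quot N),
      zero = zero (T Quot N), add = add (T Quot N),
      smult = (\<lambda>c P. \<Union>p\<in>P. N +>\<^bsub>T\<^esub> (Poly_Mapping.single (c, \<one>\<^bsub>U\<^esub>) 1 \<otimes>\<^bsub>T\<^esub> p))\<rparr>)"

definition pure_tensor ::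
    "('a \<Rightarrow> 'b) \<Rightarrow> ('a, 'u) module \<Rightarrow> 'b::comm_ring_1 \<Rightarrow> 'u \<Rightarrow> (('b \<times> 'u) \<Rightarrow>\<^sub>0 int) set" where
  "pure_tensor \<phi> U b u = tensor_subgroup \<phi> U +>\<^bsub>tensor_pre U\<^esub> Poly_Mapping.single (b, u) 1"


section \<open>The quantized enveloping algebra and its integral form\<close>

datatype gen = gX | gY | gZ | gTheta

definition Uq_relations ::
    "'k::field \<Rightarrow> ((gen list \<Rightarrow>\<^sub>0 'k) \<times> (gen list \<Rightarrow>\<^sub>0 'k)) set" where
  "Uq_relations q =
    (let F = free_algebra UNIV :: ('k, gen list \<Rightarrow>\<^sub>0 'k) module;
         X = letter gX; Y = letter gY; Z = letter gZ; \<theta> = letter gTheta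
     in {(X \<otimes>\<^bsub>F\<^esub> Z, q^2 \<odot>\<^bsub>F\<^esub> (Z \<otimes>\<^bsub>F\<^esub> X)),
         (Z \<otimes>\<^bsub>F\<^esub> Y, q^2 \<odot>\<^bsub>F\<^esub> (Y \<otimes>\<^bsub>F\<^esub> Z)),
         (X \<otimes>\<^bsub>F\<^esub> Y \<oplus>\<^bsub>F\<^esub> q^2 \<odot>\<^bsub>F\<^esub> (Z \<otimes>\<^bsub>F\<^esub> Z), \<one>\<^bsub>F\<^esub>),
         (Y \<otimes>\<^bsub>F\<^esub> X \<oplus>\<^bsub>F\<^esub> (inverse q)^2 \<odot>\<^bsub>F\<^esub> (Z \<otimes>\<^bsub>F\<^esub> Z), \<one>\<^bsub>F\<^esub>),
         (q \<odot>\<^bsub>F\<^esub> (X \<otimes>\<^bsub>F\<^esub> \<theta>) \<ominus>\<^bsub>F\<^esub> inverse q \<odot>\<^bsub>F\<^esub> (\<theta> \<otimes>\<^bsub>F\<^esub> X), (q + inverse q) \<odot>\<^bsub>F\<^esub> Z),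
         (q \<odot>\<^bsub>F\<^esub> (\<theta> \<otimes>\<^bsub>F\<^esub> Y) \<ominus>\<^bsub>F\<^esub> inverse q \<odot>\<^bsub>F\<^esub> (Y \<otimes>\<^bsub>F\<^esub> \<theta>), (q + inverse q) \<odot>\<^bsub>F\<^esub> Z),
         (\<theta> \<otimes>\<^bsub>F\<^esub> Z \<ominus>\<^bsub>F\<^esub> Z \<otimes>\<^bsub>F\<^esub> \<theta>, Y \<ominus>\<^bsub>F\<^esub> X)})"

text \<open>The presentation makes sense for every \<open>q \<noteq> 0\<close> in a field. It is only used for the generic
  parameter over \<open>\<bbbF>\<close> and for positive reals \<open>q \<noteq> 1\<close> over \<open>\<complex>\<close>; neither is a root of unity, and both
  have square roots that are fixed by complex conjugation.\<close>

definition Uq :: "'k::field \<Rightarrow> ('k, (gen list \<Rightarrow>\<^sub>0 'k) set) module" where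
  "Uq q = presented_algebra UNIV (Uq_relations q)"

definition Uq_gen :: "'k::field \<Rightarrow> gen \<Rightarrow> (gen list \<Rightarrow>\<^sub>0 'k) set" where
  "Uq_gen q = presented_gen UNIV (Uq_relations q)"

definition Uq_theta :: "'k::field \<Rightarrow> (gen list \<Rightarrow>\<^sub>0 'k) set" where
  "Uq_theta q = Uq_gen q gTheta"

definition Uq_x :: "'k::field \<Rightarrow> (gen list \<Rightarrow>\<^sub>0 'k) set" where
  "Uq_x q = inverse (q - inverse q) \<odot>\<^bsub>Uq q\<^esub> (Uq_gen q gX \<ominus>\<^bsub>Uq q\<^esub> \<one>\<^bsub>Uq q\<^esub>)"

definition Uq_y :: "'k::field \<Rightarrow> (gen list \<Rightarrow>\<^sub>0 'k) set" where
  "Uq_y q = inverse (q - inverse q) \<odot>\<^bsub>Uq q\<^esub> (Uq_gen q gY \<ominus>\<^bsub>Uq q\<^esub> \<one>\<^bsub>Uq q\<^esub>)"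

definition Uq_z :: "'k::field \<Rightarrow> (gen list \<Rightarrow>\<^sub>0 'k) set" where
  "Uq_z q = inverse (q - inverse q) \<odot>\<^bsub>Uq q\<^esub> Uq_gen q gZ"

type_synonym UF_elem = "(gen list \<Rightarrow>\<^sub>0 analytic_fun fract) set"

definition UA :: "(analytic_fun, UF_elem) module" where
  "UA = (let U = restrict_scalars to_F (Uq qF) in
     U\<lparr>carrier := generated_subalgebra U {Uq_theta qF, Uq_x qF, Uq_y qF, Uq_z qF}\<rparr>)"

definition UA_specialization ::
    "real \<Rightarrow> (complex, ((complex \<times> UF_elem) \<Rightarrow>\<^sub>0 int) set) module" where
  "UA_specialization q = base_change (ev q) UA"


section \<open>The enveloping algebra of \<open>sl\<^sub>2\<close>\<close>

text \<open>The universal enveloping algebra of a Lie algebra with underlying set \<open>L\<close>, scalar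
  multiplication \<open>s\<close> and bracket \<open>br\<close>. The additive and homogeneous relations turn the free algebra
  on the set \<open>L\<close> into the tensor algebra of the vector space \<open>L\<close>.\<close>

definition enveloping_algebra ::
    "'g::ab_group_add set \<Rightarrow> ('k \<Rightarrow> 'g \<Rightarrow> 'g) \<Rightarrow> ('g \<Rightarrow> 'g \<Rightarrow> 'g) \<Rightarrow>
     ('k::field, ('g list \<Rightarrow>\<^sub>0 'k) set) module" where
  "enveloping_algebra L s br =
    (let F = free_algebra L :: ('k, 'g list \<Rightarrow>\<^sub>0 'k) module in
     presented_algebra L
      ({(letter (u + v), letter u \<oplus>\<^bsub>F\<^esub> letter v) | u v. u \<in> L \<and> v \<in> L} \<union>
       {(letter (s c u), c \<odot>\<^bsub>F\<^esub> letter u) | c u. u \<in> L} \<union>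
       {(letter u \<otimes>\<^bsub>F\<^esub> letter v \<ominus>\<^bsub>F\<^esub> letter v \<otimes>\<^bsub>F\<^esub> letter u, letter (br u v)) | u v. u \<in> L \<and> v \<in> L}))"

definition sl2 :: "(complex^2^2) set" where
  "sl2 = {M. trace M = 0}"

definition U_sl2 :: "(complex, ((complex^2^2) list \<Rightarrow>\<^sub>0 complex) set) module" where
  "U_sl2 = enveloping_algebra sl2 (\<lambda>c M. \<chi> i j. c * vec_nth (vec_nth M i) j) (\<lambda>M N. M ** N - N ** M)"

end

theory Submission
  imports Defs
begin

text \<open>Since the constants lie in \<open>\<bbbA>\<close>, a pure tensor \<open>b \<otimes> u\<close> equals \<open>1 \<otimes> b u\<close>, so the specialization at \<open>q\<close> is
  a quotient of \<open>U\<^sub>\<bbbA>\<close>. Sending the generators of the expected algebra over \<open>\<complex>\<close> to suitable elements of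
  \<open>U\<^sub>\<bbbA>\<close> gives a homomorphism into this quotient. That the defining relations hold there, and that the
  images generate, is read off from the relations between \<open>x\<close>, \<open>y\<close>, \<open>z\<close>, \<open>\<theta>\<close> in \<open>U\<^sub>\<bbbA>\<close>, once a coefficient
  from \<open>\<bbbA>\<close> is replaced by its value at \<open>q\<close>. The point is injectivity, that is: the presented algebra over
  \<open>\<complex>\<close> does not collapse any further when it is seen as a specialization.

  For this one representation of all the algebras at once is enough. Inverting \<open>z\<close> embeds \<open>U\<^sub>q(\<gg>)\<close> into a
  quantum torus with one central parameter, the Casimir element \<open>\<lambda>\<close>. On the vectors \<open>z\<^sup>m\<close>, \<open>m \<in> \<int>\<close>, this reads
  \<open>z z\<^sup>m = z\<^sup>m\<^sup>+\<^sup>1\<close>, \<open>x z\<^sup>m = q\<^sup>m [m] z\<^sup>m\<close> and \<open>\<theta> z\<^sup>m = (\<lambda> - [m][m-1]) z\<^sup>m\<^sup>-\<^sup>1 + q\<^sup>-\<^sup>2\<^sup>m\<^sup>-\<^sup>1 z\<^sup>m\<^sup>+\<^sup>1\<close>, with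
  quantum integers \<open>[m]\<close>. All matrix coefficients are analytic in \<open>q\<close>, also at \<open>1\<close>, where \<open>2x\<close>, \<open>z\<close>, \<open>\<theta> - z\<close>
  act as the standard generators \<open>H\<close>, \<open>E\<close>, \<open>F\<close> of \<open>\<ss>\<ll>\<^sub>2\<close> on its universal weight module. A matrix coefficient
  of \<open>U\<^sub>\<bbbA>\<close> followed by evaluation at \<open>q\<close> is therefore a well-defined functional on the specialization
  (\<open>kills_imp_zero\<close>), and it agrees with the matrix coefficient of the algebra over \<open>\<complex>\<close>.

  Injectivity now follows from a Poincare-Birkhoff-Witt argument over \<open>\<complex>\<close>. Modulo the relations every
  element is a combination of normal words (\<open>ore_spanning\<close>): \<open>X\<^sup>a Z\<^sup>i \<theta>\<^sup>k\<close> and \<open>Y\<^sup>a Z\<^sup>i \<theta>\<^sup>k\<close> if \<open>q \<noteq> 1\<close>, and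
  \<open>H\<^sup>j E\<^sup>i F\<^sup>k\<close> if \<open>q = 1\<close>. The normal words act by linearly independent operators (locale \<open>normal_words\<close>):
  the degree in \<open>\<lambda>\<close> detects \<open>k\<close>, the lowest weight that is reached detects \<open>i\<close>, and the remaining exponent
  is detected by the functions \<open>m \<mapsto> q\<^sup>2\<^sup>a\<^sup>m\<close> or \<open>m \<mapsto> (2m)\<^sup>j\<close>. These ingredients are put together in
  \<open>specialization_iso\<close>.\<close>

section \<open>Constants and inverses in the analytic coefficient ring\<close>

lift_definition const_afun :: "complex \<Rightarrow> analytic_fun" is "\<lambda>c x. if x > 0 then c else 0"
  by (auto intro!: real_analytic_at_local[OF real_analytic_at_of_holomorphic[of "\<lambda>_. c" for c]])

lift_definition inv_afun :: analytic_fun is "\<lambda>x. if x > 0 then inverse (complex_of_real x) else 0"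
proof safe
  fix x :: real assume x: "x > 0"
  have "(\<lambda>z. inverse z) holomorphic_on ball (complex_of_real x) x"
    by (intro holomorphic_intros) (auto simp: dist_norm)
  then have "real_analytic_at (\<lambda>t. inverse (complex_of_real t)) x"
    unfolding real_analytic_at_iff_holomorphic
    by (intro exI[of _ x] conjI exI[of _ inverse]) (use x in auto)
  then show "real_analytic_at (\<lambda>x. if 0 < x then inverse (complex_of_real x) else 0) x"
    using x by (rule real_analytic_at_local) auto
qed auto

lemma ev_simps:
  assumes "q > 0"
  shows "ev q 0 = 0" "ev q 1 = 1" "ev q (a + b) = ev q a + ev q b" "ev q (a - b) = ev q a - ev q b"
    "ev q (- a) = - ev q a" "ev q (a * b) = ev q a * ev q b"
    "ev q (const_afun c) = c" "ev q id_afun = complex_of_real q"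
    "ev q inv_afun = inverse (complex_of_real q)"
  using assms unfolding ev_def by (transfer; simp)+

lemma const_afun_hom:
  "const_afun 0 = 0" "const_afun 1 = 1" "const_afun (a + b) = const_afun a + const_afun b"
  "const_afun (a - b) = const_afun a - const_afun b" "const_afun (- a) = - const_afun a"
  "const_afun (a * b) = const_afun a * const_afun b"
  by (transfer; force simp: fun_eq_iff)+

lemma id_inv_afun: "id_afun * inv_afun = 1"
  by transfer (auto simp: fun_eq_iff)

lemma to_F_hom:
  "to_F 0 = 0" "to_F 1 = 1" "to_F (a + b) = to_F a + to_F b" "to_F (a - b) = to_F a - to_F b"
  "to_F (- a) = - to_F a" "to_F (a * b) = to_F a * to_F b"
  by (simp_all add: to_F_def Zero_fract_def One_fract_def)

lemma to_F_inject [simp]: "to_F a = to_F b \<longleftrightarrow> a = b"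
  by (simp add: to_F_def eq_fract)

lemma inverse_qF: "inverse qF = to_F inv_afun"
proof -
  have "qF * to_F inv_afun = 1"
    by (simp add: qF_def to_F_hom(6)[symmetric] id_inv_afun to_F_hom)
  then show ?thesis by (metis inverse_unique)
qed

lemma qF_nonzero: "qF \<noteq> 0"
  using inverse_qF id_inv_afun to_F_hom(6)[of id_afun inv_afun]
  by (auto simp: qF_def to_F_hom)

lemma qF_generic: "qF - inverse qF \<noteq> 0"
proof
  assume "qF - inverse qF = 0"
  then have "qF = to_F inv_afun" by (simp add: inverse_qF)
  then have "id_afun = inv_afun" by (simp add: qF_def)
  then have "ev 2 id_afun = ev 2 inv_afun" by simp
  then show False by (simp add: ev_simps)
qed

definition const_F :: "complex \<Rightarrow> analytic_fun fract" where
  "const_F c = to_F (const_afun c)"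

lemma const_F_hom:
  "const_F 0 = 0" "const_F 1 = 1" "const_F (a + b) = const_F a + const_F b"
  "const_F (a - b) = const_F a - const_F b" "const_F (- a) = - const_F a"
  "const_F (a * b) = const_F a * const_F b"
  by (simp_all add: const_F_def const_afun_hom to_F_hom)

section \<open>Free algebras\<close>

text \<open>With concatenation as addition of exponents, finitely supported functions on words form a ring under
  convolution, and this ring is the free algebra. Calculations with representatives of classes can then use
  the simplification rules for rings.\<close>

instantiation list :: (type) monoid_add
begin
definition zero_list :: "'a list" where "zero_list = []"
definition plus_list :: "'a list \<Rightarrow> 'a list \<Rightarrow> 'a list" where "plus_list = (@)"
instance by standard (auto simp: zero_list_def plus_list_def)
end

definition scal :: "'k::comm_ring_1 \<Rightarrow> ('s list \<Rightarrow>\<^sub>0 'k)" where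
  "scal c = Poly_Mapping.single [] c"

lemma scal_hom:
  "scal 0 = 0" "scal 1 = 1" "scal (a + b) = scal a + scal b"
  "scal (a - b) = scal a - scal b" "scal (- a) = - scal a" "scal (a * b) = scal a * scal b"
  by (simp_all add: scal_def single_add single_diff single_uminus mult_single zero_list_def
      plus_list_def flip: single_one)

lemma scal_comm: "scal c * p = p * (scal c :: 's list \<Rightarrow>\<^sub>0 'k::comm_ring_1)"
proof -
  have "scal c * (\<Sum>k\<in>Poly_Mapping.keys p. Poly_Mapping.single k (Poly_Mapping.lookup p k))
     = (\<Sum>k\<in>Poly_Mapping.keys p. Poly_Mapping.single k (Poly_Mapping.lookup p k)) * scal c"
    by (simp add: sum_distrib_left sum_distrib_right scal_def mult_single plus_list_def mult.commute)
  then show ?thesis using poly_mapping_sum_singles[of p] by simp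
qed

lemma free_algebra_mult:
  fixes p r :: "'s list \<Rightarrow>\<^sub>0 'k::comm_ring_1"
  shows "p \<otimes>\<^bsub>free_algebra S\<^esub> r = p * r"
proof -
  have "p \<otimes>\<^bsub>free_algebra S\<^esub> r = (\<Sum>a\<in>Poly_Mapping.keys p. \<Sum>b\<in>Poly_Mapping.keys r.
     Poly_Mapping.single a (Poly_Mapping.lookup p a) * Poly_Mapping.single b (Poly_Mapping.lookup r b))"
    by (simp add: free_algebra_def monoid_algebra_def free_monoid_def mult_single plus_list_def)
  also have "\<dots> = (\<Sum>a\<in>Poly_Mapping.keys p. Poly_Mapping.single a (Poly_Mapping.lookup p a)) *
      (\<Sum>b\<in>Poly_Mapping.keys r. Poly_Mapping.single b (Poly_Mapping.lookup r b))"
    by (simp add: sum_product)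
  also have "\<dots> = p * r" by (simp flip: poly_mapping_sum_singles)
  finally show ?thesis .
qed

lemma free_algebra_simps:
  fixes p r :: "'s list \<Rightarrow>\<^sub>0 'k::comm_ring_1"
  shows "carrier (free_algebra S) = {p :: 's list \<Rightarrow>\<^sub>0 'k. Poly_Mapping.keys p \<subseteq> lists S}"
    "p \<oplus>\<^bsub>free_algebra S\<^esub> r = p + r" "\<zero>\<^bsub>free_algebra S\<^esub> = (0 :: 's list \<Rightarrow>\<^sub>0 'k)"
    "\<one>\<^bsub>free_algebra S\<^esub> = (1 :: 's list \<Rightarrow>\<^sub>0 'k)" "c \<odot>\<^bsub>free_algebra S\<^esub> p = scal c * p"
proof -
  have "Poly_Mapping.map ((*) c) p = scal c * p"
    using mult_map_scale_conv_mult[of c p] by (simp add: scal_def zero_list_def)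
  then show "c \<odot>\<^bsub>free_algebra S\<^esub> p = scal c * p"
    by (simp add: free_algebra_def monoid_algebra_def)
  show "\<one>\<^bsub>free_algebra S\<^esub> = (1 :: 's list \<Rightarrow>\<^sub>0 'k)"
    by (simp add: free_algebra_def monoid_algebra_def free_monoid_def zero_list_def flip: single_one)
qed (simp_all add: free_algebra_def monoid_algebra_def free_monoid_def)

lemma free_algebra_carrier:
  fixes p r :: "'s list \<Rightarrow>\<^sub>0 'k::comm_ring_1"
  assumes "p \<in> carrier (free_algebra S)" "r \<in> carrier (free_algebra S)"
  shows "p + r \<in> carrier (free_algebra S)" "p * r \<in> carrier (free_algebra S)"
    "- p \<in> carrier (free_algebra S)" "p - r \<in> carrier (free_algebra S)"
proof -
  interpret R: ring "free_algebra S :: ('k, 's list \<Rightarrow>\<^sub>0 'k) module" by (rule free_algebra_ring)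
  show "p + r \<in> carrier (free_algebra S)" "p * r \<in> carrier (free_algebra S)"
    using R.a_closed[OF assms] R.m_closed[OF assms] by (simp_all add: free_algebra_simps(2) free_algebra_mult)
  show neg: "- p \<in> carrier (free_algebra S)"
    using assms by (auto simp: free_algebra_simps in_keys_iff)
  have "- r \<in> carrier (free_algebra S)"
    using assms by (auto simp: free_algebra_simps in_keys_iff)
  from R.a_closed[OF assms(1) this] show "p - r \<in> carrier (free_algebra S)"
    by (simp add: free_algebra_simps(2))
qed

lemma free_algebra_consts:
  "scal c \<in> carrier (free_algebra S)" "1 \<in> carrier (free_algebra S)"
  "0 \<in> carrier (free_algebra S)"
  by (auto simp: free_algebra_simps(1) scal_def simp flip: single_one) (auto simp: zero_list_def)

lemma letter_carrier: "s \<in> S \<Longrightarrow> letter s \<in> carrier (free_algebra S)"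
  by (auto simp: free_algebra_simps letter_def)

lemma free_algebra_minus:
  fixes p r :: "'s list \<Rightarrow>\<^sub>0 'k::comm_ring_1"
  assumes "r \<in> carrier (free_algebra S)"
  shows "p \<ominus>\<^bsub>free_algebra S\<^esub> r = p - r"
proof -
  interpret R: ring "free_algebra S :: ('k, 's list \<Rightarrow>\<^sub>0 'k) module" by (rule free_algebra_ring)
  have "\<ominus>\<^bsub>free_algebra S\<^esub> r = - r"
    by (rule R.minus_equality)
      (use assms free_algebra_carrier(3)[OF assms assms] in \<open>auto simp: free_algebra_simps\<close>)
  then show ?thesis by (simp add: a_minus_def free_algebra_simps)
qed

section \<open>Homomorphisms out of free algebras\<close>

definition subst_hom ::
    "('k::comm_ring_1 \<Rightarrow> 'r::ring_1) \<Rightarrow> ('s \<Rightarrow> 'r) \<Rightarrow> ('s list \<Rightarrow>\<^sub>0 'k) \<Rightarrow> 'r" where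
  "subst_hom \<kappa> v p =
     (\<Sum>w\<in>Poly_Mapping.keys p. \<kappa> (Poly_Mapping.lookup p w) * prod_list (map v w))"

text \<open>A homomorphism out of the free algebra over \<open>'k\<close> into a ring is determined by a ring homomorphism \<open>\<kappa>\<close> on the
  coefficients and the images \<open>v\<close> of the letters; multiplicativity needs the coefficients to act centrally.\<close>

locale substitution =
  fixes \<kappa> :: "'k::comm_ring_1 \<Rightarrow> 'r::ring_1" and v :: "'s \<Rightarrow> 'r"
  assumes scalar_add: "\<kappa> (a + b) = \<kappa> a + \<kappa> b"
    and scalar_mult: "\<kappa> (a * b) = \<kappa> a * \<kappa> b"
    and scalar_one: "\<kappa> 1 = 1"
    and scalar_comm: "\<kappa> a * v s = v s * \<kappa> a"
begin

lemma scalar_zero: "\<kappa> 0 = 0"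
  using scalar_add[of 0 0] by simp

lemma subst_superset:
  assumes "finite W" "Poly_Mapping.keys p \<subseteq> W"
  shows "subst_hom \<kappa> v p = (\<Sum>w\<in>W. \<kappa> (Poly_Mapping.lookup p w) * prod_list (map v w))"
  unfolding subst_hom_def using assms
  by (intro sum.mono_neutral_left) (auto simp: not_in_keys_iff_lookup_eq_zero scalar_zero)

lemma subst_add: "subst_hom \<kappa> v (p + r) = subst_hom \<kappa> v p + subst_hom \<kappa> v r"
proof -
  let ?W = "Poly_Mapping.keys p \<union> Poly_Mapping.keys r"
  have "finite ?W" "Poly_Mapping.keys (p + r) \<subseteq> ?W" by (auto simp: keys_add)
  then show ?thesis
    by (simp add: subst_superset[of ?W] lookup_add scalar_add distrib_right sum.distrib)
qed

lemma subst_single: "subst_hom \<kappa> v (Poly_Mapping.single w c) = \<kappa> c * prod_list (map v w)"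
  by (subst subst_superset[of "{w}"]) auto

lemma subst_zero: "subst_hom \<kappa> v 0 = 0"
  by (simp add: subst_hom_def)

lemma subst_scal: "subst_hom \<kappa> v (scal c) = \<kappa> c"
  by (simp add: scal_def subst_single)

lemma subst_one: "subst_hom \<kappa> v 1 = 1"
  using subst_scal[of 1] by (simp add: scal_hom scalar_one)

lemma subst_letter: "subst_hom \<kappa> v (letter s) = v s"
  by (simp add: letter_def subst_single scalar_one)

lemma subst_sum: "subst_hom \<kappa> v (\<Sum>i\<in>A. f i) = (\<Sum>i\<in>A. subst_hom \<kappa> v (f i))"
  by (induction A rule: infinite_finite_induct) (simp_all add: subst_zero subst_add)

lemma subst_uminus: "subst_hom \<kappa> v (- p) = - subst_hom \<kappa> v p"
  using subst_add[of p "- p"] by (simp add: subst_zero eq_neg_iff_add_eq_0 add.commute)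

lemma subst_diff: "subst_hom \<kappa> v (p - r) = subst_hom \<kappa> v p - subst_hom \<kappa> v r"
  using subst_add[of p "- r"] by (simp add: subst_uminus)

lemma scalar_comm_prod: "\<kappa> a * prod_list (map v w) = prod_list (map v w) * \<kappa> a"
proof (induction w)
  case (Cons s w)
  then show ?case using scalar_comm[of a s]
    by (simp add: mult.assoc[symmetric]) (simp add: mult.assoc)
qed simp

lemma subst_mult: "subst_hom \<kappa> v (p * r) = subst_hom \<kappa> v p * subst_hom \<kappa> v r"
proof -
  have single: "subst_hom \<kappa> v (Poly_Mapping.single w c * Poly_Mapping.single w' c') =
     subst_hom \<kappa> v (Poly_Mapping.single w c) * subst_hom \<kappa> v (Poly_Mapping.single w' c')" for w w' c c'
    using scalar_comm_prod[of c' w]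
    by (simp add: mult_single plus_list_def subst_single scalar_mult mult.assoc)
       (simp add: mult.assoc[symmetric])
  let ?s = "\<lambda>p. \<Sum>k\<in>Poly_Mapping.keys p. Poly_Mapping.single k (Poly_Mapping.lookup p k)"
  have "subst_hom \<kappa> v (?s p * ?s r) = subst_hom \<kappa> v (?s p) * subst_hom \<kappa> v (?s r)"
    by (simp only: sum_product subst_sum single)
  then show ?thesis by (simp flip: poly_mapping_sum_singles)
qed

lemmas subst_simps = subst_add subst_diff subst_uminus subst_mult subst_zero subst_one
  subst_scal subst_letter

end

section \<open>Algebras given by generators and relations\<close>

locale presentation =
  fixes S :: "'s set" and Rel :: "(('s list \<Rightarrow>\<^sub>0 'k::comm_ring_1) \<times> ('s list \<Rightarrow>\<^sub>0 'k)) set"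
  assumes Rel_carrier: "(l, r) \<in> Rel \<Longrightarrow> l \<in> carrier (free_algebra S) \<and> r \<in> carrier (free_algebra S)"
begin

abbreviation "free \<equiv> free_algebra S :: ('k, 's list \<Rightarrow>\<^sub>0 'k) module"
abbreviation "rels \<equiv> relation_ideal S Rel"
definition "cls p = rels +>\<^bsub>free\<^esub> p"

lemma rels_ideal: "ideal rels free"
  unfolding relation_ideal_def
  by (rule ring.genideal_ideal[OF free_algebra_ring])
     (auto simp: free_algebra_minus Rel_carrier free_algebra_carrier)

lemma rels_sub: "p \<in> rels \<Longrightarrow> p \<in> carrier free"
  using ideal.Icarr[OF rels_ideal] .

lemma rels_zero: "0 \<in> rels"
  using additive_subgroup.zero_closed[OF ideal.axioms(1)[OF rels_ideal]]
  by (simp add: free_algebra_simps)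

lemma rels_add: "p \<in> rels \<Longrightarrow> r \<in> rels \<Longrightarrow> p + r \<in> rels"
  using additive_subgroup.a_closed[OF ideal.axioms(1)[OF rels_ideal]]
  by (simp add: free_algebra_simps)

lemma rels_mult:
  assumes "p \<in> rels" "r \<in> carrier free"
  shows "p * r \<in> rels" "r * p \<in> rels"
  using ideal.I_l_closed[OF rels_ideal assms] ideal.I_r_closed[OF rels_ideal assms]
  by (simp_all add: free_algebra_mult)

lemma rels_uminus: "p \<in> rels \<Longrightarrow> - p \<in> rels"
  using rels_mult(1)[OF _ free_algebra_carrier(3)[OF free_algebra_consts(2,2)], of p] by simp

lemma rels_incl:
  assumes "(l, r) \<in> Rel" shows "l - r \<in> rels"
proof -
  have "l - r \<in> {l \<ominus>\<^bsub>free\<^esub> r | l r. (l, r) \<in> Rel}"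
    using assms Rel_carrier[OF assms] by (force simp: free_algebra_minus)
  moreover have "{l \<ominus>\<^bsub>free\<^esub> r | l r. (l, r) \<in> Rel} \<subseteq> carrier free"
    by (auto simp: free_algebra_minus Rel_carrier free_algebra_carrier)
  ultimately show ?thesis
    unfolding relation_ideal_def using ring.genideal_self[OF free_algebra_ring] by blast
qed

lemma rels_least:
  assumes "ideal J free" "\<And>l r. (l, r) \<in> Rel \<Longrightarrow> l - r \<in> J"
  shows "rels \<subseteq> J"
  unfolding relation_ideal_def
  by (rule ring.genideal_minimal[OF free_algebra_ring assms(1)])
     (auto simp: free_algebra_minus Rel_carrier assms(2))

abbreviation "PA \<equiv> presented_algebra S Rel"

lemma PA_fields:
  "carrier PA = carrier (free Quot rels)" "mult PA = mult (free Quot rels)"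
  "one PA = one (free Quot rels)" "zero PA = zero (free Quot rels)" "add PA = add (free Quot rels)"
  by (simp_all add: presented_algebra_def quotient_algebra_def)

lemma carrier_PA: "carrier PA = cls ` carrier free"
  by (auto simp: PA_fields FactRing_simps cls_def)

lemma cls_eq_iff:
  assumes "p \<in> carrier free" "r \<in> carrier free"
  shows "cls p = cls r \<longleftrightarrow> p - r \<in> rels"
  using ring.quotient_eq_iff_same_a_r_cos[OF free_algebra_ring rels_ideal assms]
  by (simp add: cls_def free_algebra_minus assms)

lemma rels_subgroup: "abelian_subgroup rels free"
  by (rule abelian_subgroupI3)
    (auto intro: ideal.axioms(1)[OF rels_ideal] ring.is_abelian_group[OF free_algebra_ring])

lemma cls_self: "p \<in> carrier free \<Longrightarrow> p \<in> cls p"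
  unfolding cls_def by (rule abelian_subgroup.a_rcos_self[OF rels_subgroup])

lemma in_cls: "p \<in> carrier free \<Longrightarrow> r \<in> cls p \<longleftrightarrow> r \<in> carrier free \<and> r - p \<in> rels"
  using abelian_subgroup.a_elemrcos_carrier[OF rels_subgroup, of p r]
    abelian_subgroup.a_rcos_module_minus[OF rels_subgroup free_algebra_ring, of p r]
  by (auto simp: cls_def free_algebra_minus)

lemma cls_mult:
  assumes "p \<in> carrier free" "r \<in> carrier free"
  shows "cls p \<otimes>\<^bsub>PA\<^esub> cls r = cls (p * r)"
  using ideal.rcoset_mult_add[OF rels_ideal assms]
  by (simp add: PA_fields FactRing_def cls_def free_algebra_mult)

lemma cls_add:
  assumes "p \<in> carrier free" "r \<in> carrier free"
  shows "cls p \<oplus>\<^bsub>PA\<^esub> cls r = cls (p + r)"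
  using ring_hom_add[OF ideal.rcos_ring_hom[OF rels_ideal] assms]
  by (simp add: PA_fields cls_def free_algebra_simps)

lemma cls_one: "\<one>\<^bsub>PA\<^esub> = cls 1"
  by (simp add: PA_fields FactRing_def cls_def free_algebra_simps)

lemma cls_zero: "\<zero>\<^bsub>PA\<^esub> = cls 0"
  using ring.a_rcos_zero[OF free_algebra_ring rels_ideal rels_zero]
  by (simp add: PA_fields FactRing_def cls_def)

text \<open>In a quotient algebra, scalar multiplication is a union over all representatives of the class; it is a single class
  because multiplying a relation by a scalar gives a relation.\<close>

lemma cls_smult:
  assumes "p \<in> carrier free"
  shows "c \<odot>\<^bsub>PA\<^esub> cls p = cls (scal c * p)"
proof -
  have "cls (scal c * r) = cls (scal c * p)" if "r \<in> cls p" for r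
  proof -
    have r: "r \<in> carrier free" "r - p \<in> rels" using that in_cls[OF assms] by auto
    have "scal c * r - scal c * p \<in> rels"
      using rels_mult(2)[OF r(2) free_algebra_consts(1), of c]
      by (simp add: right_diff_distrib)
    then show ?thesis using r(1) assms by (subst cls_eq_iff) (auto intro!: free_algebra_carrier free_algebra_consts)
  qed
  moreover have "c \<odot>\<^bsub>PA\<^esub> cls p = (\<Union>r\<in>cls p. cls (scal c * r))"
    unfolding presented_algebra_def quotient_algebra_def cls_def
    by (simp only: module.simps free_algebra_simps(5))
  ultimately have "c \<odot>\<^bsub>PA\<^esub> cls p = (\<Union>r\<in>cls p. cls (scal c * p))"
    by (metis (no_types, lifting) SUP_cong)
  also have "\<dots> = cls (scal c * p)" using cls_self[OF assms] by (metis SUP_const empty_iff)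
  finally show ?thesis .
qed

text \<open>As a ring, the presented algebra is the quotient of the free algebra; the two differ only in the type of
  the record.\<close>

lemma PA_ring: "ring PA"
proof -
  have R: "ring (free Quot rels)" by (rule ideal.quotient_is_ring[OF rels_ideal])
  have "(\<lambda>x. x) \<in> ring_hom (free Quot rels) PA"
    by (rule ring_hom_memI) (simp_all add: PA_fields)
  moreover have "(\<lambda>x. x) ` carrier (free Quot rels) = carrier PA"
    by (simp add: PA_fields)
  ultimately have "(\<lambda>x. x) \<in> ring_iso (free Quot rels) PA"
    by (simp add: ring_iso_def bij_betw_def)
  from ring.ring_iso_imp_img_ring[OF R this]
  show ?thesis unfolding PA_fields(4)[symmetric] by simp
qed

lemma cls_uminus:
  assumes "p \<in> carrier free"
  shows "\<ominus>\<^bsub>PA\<^esub> cls p = cls (- p)"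
proof -
  interpret ring PA by (rule PA_ring)
  note c = free_algebra_carrier(3)[OF assms assms]
  show ?thesis
    by (rule minus_equality) (use assms c in \<open>auto simp: carrier_PA cls_add cls_zero\<close>)
qed

lemma cls_diff:
  assumes "p \<in> carrier free" "r \<in> carrier free"
  shows "cls p \<ominus>\<^bsub>PA\<^esub> cls r = cls (p - r)"
  using assms free_algebra_carrier(3)[OF assms(2) assms(2)]
  by (simp add: a_minus_def cls_uminus cls_add)

lemma presented_gen_cls: "presented_gen S Rel s = cls (letter s)"
  by (simp add: presented_gen_def cls_def)

end

section \<open>Extension of scalars\<close>

text \<open>The hypotheses are what makes the subgroup of tensor relations an ideal of the monoid ring on the symbols
  \<open>(b, u)\<close>: multiplication of \<open>U\<close> is balanced over the scalars on both sides.\<close>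

locale scalar_extension = U: ring U
  for \<phi> :: "'a::comm_ring_1 \<Rightarrow> 'b::comm_ring_1" and U :: "('a, 'u) module" +
  assumes U_smult_closed: "u \<in> carrier U \<Longrightarrow> a \<odot>\<^bsub>U\<^esub> u \<in> carrier U"
    and U_smult_left: "u \<in> carrier U \<Longrightarrow> w \<in> carrier U \<Longrightarrow> (a \<odot>\<^bsub>U\<^esub> u) \<otimes>\<^bsub>U\<^esub> w = a \<odot>\<^bsub>U\<^esub> (u \<otimes>\<^bsub>U\<^esub> w)"
    and U_smult_right: "u \<in> carrier U \<Longrightarrow> w \<in> carrier U \<Longrightarrow> u \<otimes>\<^bsub>U\<^esub> (a \<odot>\<^bsub>U\<^esub> w) = a \<odot>\<^bsub>U\<^esub> (u \<otimes>\<^bsub>U\<^esub> w)"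
begin

abbreviation "T \<equiv> tensor_pre U :: (int, ('b \<times> 'u) \<Rightarrow>\<^sub>0 int) module"
abbreviation "N \<equiv> tensor_subgroup \<phi> U"
abbreviation "BC \<equiv> base_change \<phi> U"
abbreviation "elt b u \<equiv> Poly_Mapping.single (b, u) (1::int)"
abbreviation "pt \<equiv> pure_tensor \<phi> U"

lemma pair_monoid: "monoid (\<lparr>carrier = UNIV :: 'b set, mult = (*), one = 1\<rparr> \<times>\<times> U)"
  by (rule DirProd_monoid) (auto intro!: monoidI simp: U.monoid_axioms mult.assoc)

lemma T_ring: "ring T"
  unfolding tensor_pre_def by (rule monoid_algebra_ring[OF pair_monoid])

lemma T_simps:
  "carrier T = {p. Poly_Mapping.keys p \<subseteq> UNIV \<times> carrier U}"
  "p \<oplus>\<^bsub>T\<^esub> r = p + r" "\<zero>\<^bsub>T\<^esub> = 0" "\<one>\<^bsub>T\<^esub> = elt 1 \<one>\<^bsub>U\<^esub>"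
  by (auto simp: tensor_pre_def monoid_algebra_def DirProd_def)

lemma T_mult_single:
  "Poly_Mapping.single (b, u) c \<otimes>\<^bsub>T\<^esub> Poly_Mapping.single (b', u') c' =
    Poly_Mapping.single (b * b', u \<otimes>\<^bsub>U\<^esub> u') (c * c')"
  by (simp add: tensor_pre_def monoid_algebra_mult_single DirProd_def)

lemma sym_carrier: "u \<in> carrier U \<Longrightarrow> Poly_Mapping.single (b, u) c \<in> carrier T"
  by (auto simp: T_simps)

lemma T_uminus_carrier: "p \<in> carrier T \<Longrightarrow> - p \<in> carrier T"
  by (auto simp: T_simps in_keys_iff)

lemma T_carrier:
  assumes "p \<in> carrier T" "r \<in> carrier T"
  shows "p + r \<in> carrier T" "p - r \<in> carrier T" "p \<otimes>\<^bsub>T\<^esub> r \<in> carrier T"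
proof -
  interpret T: ring T by (rule T_ring)
  show "p + r \<in> carrier T" using T.a_closed[OF assms] by (simp add: T_simps(2))
  show "p - r \<in> carrier T" using T.a_closed[OF assms(1) T_uminus_carrier[OF assms(2)]]
    by (simp add: T_simps(2))
  show "p \<otimes>\<^bsub>T\<^esub> r \<in> carrier T" using T.m_closed[OF assms] .
qed

lemma T_uminus:
  assumes "p \<in> carrier T" shows "\<ominus>\<^bsub>T\<^esub> p = - p"
proof -
  interpret T: ring T by (rule T_ring)
  show ?thesis
    by (rule T.minus_equality) (use assms T_uminus_carrier[OF assms] in \<open>auto simp: T_simps(2,3)\<close>)
qed

lemma T_mult_add:
  "(p + p') \<otimes>\<^bsub>T\<^esub> r = p \<otimes>\<^bsub>T\<^esub> r + p' \<otimes>\<^bsub>T\<^esub> r" "r \<otimes>\<^bsub>T\<^esub> (p + p') = r \<otimes>\<^bsub>T\<^esub> p + r \<otimes>\<^bsub>T\<^esub> p'"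
  "0 \<otimes>\<^bsub>T\<^esub> r = 0" "r \<otimes>\<^bsub>T\<^esub> 0 = 0"
  by (simp_all add: tensor_pre_def monoid_algebra_distrib)

lemma T_mult_minus:
  "(- p) \<otimes>\<^bsub>T\<^esub> r = - (p \<otimes>\<^bsub>T\<^esub> r)" "p \<otimes>\<^bsub>T\<^esub> (- r) = - (p \<otimes>\<^bsub>T\<^esub> r)"
proof -
  show "(- p) \<otimes>\<^bsub>T\<^esub> r = - (p \<otimes>\<^bsub>T\<^esub> r)"
    using T_mult_add(1)[of p "- p" r] by (simp add: T_mult_add(3) eq_neg_iff_add_eq_0 add.commute)
  show "p \<otimes>\<^bsub>T\<^esub> (- r) = - (p \<otimes>\<^bsub>T\<^esub> r)"
    using T_mult_add(2)[of p r "- r"] by (simp add: T_mult_add(4) eq_neg_iff_add_eq_0 add.commute)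
qed

lemma T_mult_diff:
  "(p - p') \<otimes>\<^bsub>T\<^esub> r = p \<otimes>\<^bsub>T\<^esub> r - p' \<otimes>\<^bsub>T\<^esub> r" "r \<otimes>\<^bsub>T\<^esub> (p - p') = r \<otimes>\<^bsub>T\<^esub> p - r \<otimes>\<^bsub>T\<^esub> p'"
  using T_mult_add(1)[of p "- p'" r] T_mult_add(2)[of r p "- p'"] by (simp_all add: T_mult_minus)

lemma T_induct [consumes 1, case_names zero single add]:
  assumes "p \<in> carrier T" "P 0" "\<And>b u c. u \<in> carrier U \<Longrightarrow> P (Poly_Mapping.single (b, u) c)"
    "\<And>r s. P r \<Longrightarrow> P s \<Longrightarrow> P (r + s)"
  shows "P p"
proof (rule monoid_algebra_induct[OF assms(1)[unfolded tensor_pre_def]])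
  show "P (Poly_Mapping.single a c)" if "a \<in> carrier (\<lparr>carrier = UNIV :: 'b set, mult = (*), one = 1\<rparr> \<times>\<times> U)" for a c
    using that assms(3)[of "snd a" "fst a" c] by (auto simp: DirProd_def)
qed (use assms in auto)

definition tensor_relators :: "(('b \<times> 'u) \<Rightarrow>\<^sub>0 int) set" where
  "tensor_relators = {l - r | l r. (l, r) \<in> tensor_relations \<phi> U}"

lemma tensor_relatorsE [consumes 1, case_names add_left add_right scalar]:
  assumes "h \<in> tensor_relators"
    and "\<And>b b' u. u \<in> carrier U \<Longrightarrow> h = elt (b + b') u - (elt b u + elt b' u) \<Longrightarrow> P"
    and "\<And>b u u'. u \<in> carrier U \<Longrightarrow> u' \<in> carrier U \<Longrightarrow>
      h = elt b (u \<oplus>\<^bsub>U\<^esub> u') - (elt b u + elt b u') \<Longrightarrow> P"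
    and "\<And>b a u. u \<in> carrier U \<Longrightarrow> h = elt (b * \<phi> a) u - elt b (a \<odot>\<^bsub>U\<^esub> u) \<Longrightarrow> P"
  shows P
  using assms by (auto simp: tensor_relators_def tensor_relations_def Let_def)

lemma tensor_relatorsI:
  "u \<in> carrier U \<Longrightarrow> elt (b + b') u - (elt b u + elt b' u) \<in> tensor_relators"
  "u \<in> carrier U \<Longrightarrow> u' \<in> carrier U \<Longrightarrow>
    elt b (u \<oplus>\<^bsub>U\<^esub> u') - (elt b u + elt b u') \<in> tensor_relators"
  "u \<in> carrier U \<Longrightarrow> elt (b * \<phi> a) u - elt b (a \<odot>\<^bsub>U\<^esub> u) \<in> tensor_relators"
  unfolding tensor_relators_def tensor_relations_def Let_def by blast+

lemma relators_carrier: "h \<in> tensor_relators \<Longrightarrow> h \<in> carrier T"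
  by (erule tensor_relatorsE) (auto intro!: T_carrier sym_carrier U_smult_closed)

lemma N_group: "subgroup N (add_monoid T)"
proof -
  interpret T: ring T by (rule T_ring)
  show ?thesis unfolding tensor_subgroup_def
    by (rule T.add.generate_is_subgroup)
      (use relators_carrier in \<open>auto simp: tensor_relators_def\<close>)
qed

lemma N_incl: "h \<in> tensor_relators \<Longrightarrow> h \<in> N"
  unfolding tensor_subgroup_def tensor_relators_def by (rule generate.incl)

lemma N_closed: "0 \<in> N" "h \<in> N \<Longrightarrow> k \<in> N \<Longrightarrow> h + k \<in> N" "h \<in> N \<Longrightarrow> - h \<in> N" "h \<in> N \<Longrightarrow> h \<in> carrier T"
proof -
  show c: "h \<in> carrier T" if "h \<in> N" for h
    using subgroup.mem_carrier[OF N_group that] by simp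
  show "0 \<in> N" using subgroup.one_closed[OF N_group] by (simp add: T_simps)
  show "h \<in> N \<Longrightarrow> k \<in> N \<Longrightarrow> h + k \<in> N" using subgroup.m_closed[OF N_group] by (simp add: T_simps(2))
  show "h \<in> N \<Longrightarrow> - h \<in> N"
    using subgroup.m_inv_closed[OF N_group, of h] T_uminus[of h] c[of h] by (metis a_inv_def)
qed

lemma N_induct [consumes 1, case_names zero incl uminus add]:
  assumes "h \<in> N" and "P 0" and "\<And>h. h \<in> tensor_relators \<Longrightarrow> P h"
    and "\<And>h. P h \<Longrightarrow> P (- h)" and "\<And>h k. P h \<Longrightarrow> P k \<Longrightarrow> P (h + k)"
  shows "P h"
  using assms(1) unfolding tensor_subgroup_def
proof (induction rule: generate.induct)
  case one
  then show ?case using assms(2) by (simp add: T_simps)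
next
  case (incl h)
  then show ?case using assms(3) by (simp add: tensor_relators_def)
next
  case (inv h)
  then have h: "h \<in> tensor_relators" by (simp add: tensor_relators_def)
  have "inv\<^bsub>add_monoid T\<^esub> h = - h" using T_uminus[OF relators_carrier[OF h]] by (simp add: a_inv_def)
  then show ?case using assms(3,4) h by simp
next
  case (eng h k)
  then show ?case using assms(5) by (simp add: T_simps(2))
qed

text \<open>Multiplying one of the three kinds of tensor relations by a symbol \<open>(b, u)\<close> yields a relation of the same
  kind. This is why no further relations are needed for the subgroup to be an ideal.\<close>

lemma relator_mult_single:
  assumes h: "h \<in> tensor_relators" and u: "u \<in> carrier U"
  shows "h \<otimes>\<^bsub>T\<^esub> elt b u \<in> tensor_relators" "elt b u \<otimes>\<^bsub>T\<^esub> h \<in> tensor_relators"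
  using h
proof (atomize(full), cases rule: tensor_relatorsE)
  case (add_left c c' w)
  show "h \<otimes>\<^bsub>T\<^esub> elt b u \<in> tensor_relators \<and> elt b u \<otimes>\<^bsub>T\<^esub> h \<in> tensor_relators"
    unfolding add_left(2)
    using add_left(1) u tensor_relatorsI(1)[of "w \<otimes>\<^bsub>U\<^esub> u" "c * b" "c' * b"]
      tensor_relatorsI(1)[of "u \<otimes>\<^bsub>U\<^esub> w" "b * c" "b * c'"]
    by (simp add: T_mult_diff T_mult_add T_mult_single distrib_left distrib_right)
next
  case (add_right c w w')
  then show "h \<otimes>\<^bsub>T\<^esub> elt b u \<in> tensor_relators \<and> elt b u \<otimes>\<^bsub>T\<^esub> h \<in> tensor_relators"
    using u tensor_relatorsI(2)[of "w \<otimes>\<^bsub>U\<^esub> u" "w' \<otimes>\<^bsub>U\<^esub> u" "c * b"]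
      tensor_relatorsI(2)[of "u \<otimes>\<^bsub>U\<^esub> w" "u \<otimes>\<^bsub>U\<^esub> w'" "b * c"]
    by (simp add: T_mult_diff T_mult_add T_mult_single U.l_distr U.r_distr)
next
  case (scalar c a w)
  then show "h \<otimes>\<^bsub>T\<^esub> elt b u \<in> tensor_relators \<and> elt b u \<otimes>\<^bsub>T\<^esub> h \<in> tensor_relators"
    using u tensor_relatorsI(3)[of "w \<otimes>\<^bsub>U\<^esub> u" "c * b" a]
      tensor_relatorsI(3)[of "u \<otimes>\<^bsub>U\<^esub> w" "b * c" a]
    by (simp add: T_mult_diff T_mult_add T_mult_single U_smult_left U_smult_right mult_ac)
qed


lemma N_ideal: "ideal N T"
proof -
  have tens: "Poly_Mapping.single (b, u) c \<otimes>\<^bsub>T\<^esub> h \<in> N \<and> h \<otimes>\<^bsub>T\<^esub> Poly_Mapping.single (b, u) c \<in> N"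
    if h: "h \<in> N" and u: "u \<in> carrier U" for h b u and c :: int
  proof (induction c rule: int_induct[where k = 0])
    case base
    then show ?case by (simp add: T_mult_add N_closed)
  next
    case (step1 i)
    have "elt b u \<otimes>\<^bsub>T\<^esub> h \<in> N \<and> h \<otimes>\<^bsub>T\<^esub> elt b u \<in> N"
      using h by (induction rule: N_induct)
        (simp_all add: T_mult_add T_mult_minus N_closed N_incl relator_mult_single u)
    with step1 show ?case by (simp add: single_add T_mult_add N_closed)
  next
    case (step2 i)
    have "elt b u \<otimes>\<^bsub>T\<^esub> h \<in> N \<and> h \<otimes>\<^bsub>T\<^esub> elt b u \<in> N"
      using h by (induction rule: N_induct)
        (simp_all add: T_mult_add T_mult_minus N_closed N_incl relator_mult_single u)
    with step2 show ?case
      using N_closed(2)[OF _ N_closed(3)] by (simp add: single_diff T_mult_diff)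
  qed
  have "x \<otimes>\<^bsub>T\<^esub> h \<in> N \<and> h \<otimes>\<^bsub>T\<^esub> x \<in> N" if h: "h \<in> N" and x: "x \<in> carrier T" for h x
    using x by (induction rule: T_induct) (use h in \<open>simp_all add: T_mult_add N_closed tens\<close>)
  then show ?thesis by (intro idealI T_ring N_group) auto
qed

lemma BC_fields:
  "carrier BC = carrier (T Quot N)" "mult BC = mult (T Quot N)" "one BC = one (T Quot N)"
  "zero BC = zero (T Quot N)" "add BC = add (T Quot N)"
  by (simp_all add: base_change_def Let_def)

definition "tc t = N +>\<^bsub>T\<^esub> t"

lemma BC_ring: "ring BC"
proof -
  have R: "ring (T Quot N)" by (rule ideal.quotient_is_ring[OF N_ideal])
  have "(\<lambda>x. x) \<in> ring_hom (T Quot N) BC"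
    by (rule ring_hom_memI) (simp_all add: BC_fields)
  moreover have "(\<lambda>x. x) ` carrier (T Quot N) = carrier BC"
    by (simp add: BC_fields)
  ultimately have "(\<lambda>x. x) \<in> ring_iso (T Quot N) BC"
    by (simp add: ring_iso_def bij_betw_def)
  from ring.ring_iso_imp_img_ring[OF R this]
  show ?thesis unfolding BC_fields(4)[symmetric] by simp
qed

lemma carrier_BC: "carrier BC = tc ` carrier T"
  by (auto simp: BC_fields FactRing_simps tc_def)

lemma N_subgroup: "abelian_subgroup N T"
  by (rule abelian_subgroupI3)
    (auto intro: ideal.axioms(1)[OF N_ideal] ring.is_abelian_group[OF T_ring])

lemma T_minus: "r \<in> carrier T \<Longrightarrow> p \<ominus>\<^bsub>T\<^esub> r = p - r"
  by (simp add: a_minus_def T_uminus T_simps(2))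

lemma tc_eq_iff:
  assumes "p \<in> carrier T" "r \<in> carrier T"
  shows "tc p = tc r \<longleftrightarrow> p - r \<in> N"
  using ring.quotient_eq_iff_same_a_r_cos[OF T_ring N_ideal assms]
  by (simp add: tc_def T_minus assms)

lemma tc_self: "p \<in> carrier T \<Longrightarrow> p \<in> tc p"
  unfolding tc_def by (rule abelian_subgroup.a_rcos_self[OF N_subgroup])

lemma in_tc: "p \<in> carrier T \<Longrightarrow> r \<in> tc p \<longleftrightarrow> r \<in> carrier T \<and> r - p \<in> N"
  using abelian_subgroup.a_elemrcos_carrier[OF N_subgroup, of p r]
    abelian_subgroup.a_rcos_module_minus[OF N_subgroup T_ring, of p r]
  by (auto simp: tc_def T_minus)

lemma tc_mult:
  "p \<in> carrier T \<Longrightarrow> r \<in> carrier T \<Longrightarrow> tc p \<otimes>\<^bsub>BC\<^esub> tc r = tc (p \<otimes>\<^bsub>T\<^esub> r)"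
  using ideal.rcoset_mult_add[OF N_ideal, of p r]
  by (simp add: BC_fields FactRing_def tc_def)

lemma tc_add:
  "p \<in> carrier T \<Longrightarrow> r \<in> carrier T \<Longrightarrow> tc p \<oplus>\<^bsub>BC\<^esub> tc r = tc (p + r)"
  using ring_hom_add[OF ideal.rcos_ring_hom[OF N_ideal], of p r]
  by (simp add: BC_fields tc_def T_simps(2))

lemma BC_one: "\<one>\<^bsub>BC\<^esub> = pt 1 \<one>\<^bsub>U\<^esub>"
  by (simp add: BC_fields FactRing_def pure_tensor_def T_simps)

lemma BC_zero: "\<zero>\<^bsub>BC\<^esub> = tc 0"
  using ring.a_rcos_zero[OF T_ring N_ideal N_closed(1)]
  by (simp add: BC_fields FactRing_def tc_def)

lemma pt_tc: "pt b u = tc (elt b u)"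
  by (simp add: pure_tensor_def tc_def)

lemma pt_carrier: "u \<in> carrier U \<Longrightarrow> pt b u \<in> carrier BC"
  by (auto simp: carrier_BC pt_tc sym_carrier)

lemma pt_mult:
  "u \<in> carrier U \<Longrightarrow> w \<in> carrier U \<Longrightarrow> pt b u \<otimes>\<^bsub>BC\<^esub> pt c w = pt (b * c) (u \<otimes>\<^bsub>U\<^esub> w)"
  by (simp add: pt_tc tc_mult sym_carrier T_mult_single)

lemma pt_add_left: "u \<in> carrier U \<Longrightarrow> pt b u \<oplus>\<^bsub>BC\<^esub> pt c u = pt (b + c) u"
  unfolding pt_tc
  by (subst tc_add, simp add: sym_carrier, simp add: sym_carrier, rule sym, subst tc_eq_iff)
    (auto intro!: sym_carrier T_carrier N_incl tensor_relatorsI)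

lemma pt_add_right:
  "u \<in> carrier U \<Longrightarrow> w \<in> carrier U \<Longrightarrow> pt b u \<oplus>\<^bsub>BC\<^esub> pt b w = pt b (u \<oplus>\<^bsub>U\<^esub> w)"
  unfolding pt_tc
  by (subst tc_add, simp add: sym_carrier, simp add: sym_carrier, rule sym, subst tc_eq_iff)
    (auto intro!: sym_carrier T_carrier N_incl tensor_relatorsI)

lemma pt_scalar: "u \<in> carrier U \<Longrightarrow> pt (b * \<phi> a) u = pt b (a \<odot>\<^bsub>U\<^esub> u)"
  unfolding pt_tc
  by (subst tc_eq_iff) (auto intro!: sym_carrier N_incl tensor_relatorsI U_smult_closed)

text \<open>The union over all representatives is a single class because the tensor relations form an ideal.\<close>

lemma BC_smult:
  assumes "P \<in> carrier BC"
  shows "c \<odot>\<^bsub>BC\<^esub> P = pt c \<one>\<^bsub>U\<^esub> \<otimes>\<^bsub>BC\<^esub> P"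
proof -
  let ?e = "elt c \<one>\<^bsub>U\<^esub>"
  have e: "?e \<in> carrier T" by (simp add: sym_carrier)
  obtain p where p: "p \<in> carrier T" "P = tc p" using assms by (auto simp: carrier_BC)
  have "tc (?e \<otimes>\<^bsub>T\<^esub> r) = tc (?e \<otimes>\<^bsub>T\<^esub> p)" if "r \<in> tc p" for r
  proof -
    have r: "r \<in> carrier T" "r - p \<in> N" using that in_tc[OF p(1)] by auto
    have "?e \<otimes>\<^bsub>T\<^esub> (r - p) \<in> N" by (rule ideal.I_l_closed[OF N_ideal r(2) e])
    then show ?thesis using r(1) p(1) e by (subst tc_eq_iff) (auto intro!: T_carrier simp: T_mult_diff)
  qed
  moreover have "c \<odot>\<^bsub>BC\<^esub> P = (\<Union>r\<in>tc p. tc (?e \<otimes>\<^bsub>T\<^esub> r))"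
    unfolding base_change_def Let_def p(2) tc_def by (simp only: module.simps)
  ultimately have "c \<odot>\<^bsub>BC\<^esub> P = (\<Union>r\<in>tc p. tc (?e \<otimes>\<^bsub>T\<^esub> p))"
    by (metis (no_types, lifting) SUP_cong)
  also have "\<dots> = tc (?e \<otimes>\<^bsub>T\<^esub> p)" using tc_self[OF p(1)] by (metis SUP_const empty_iff)
  finally show ?thesis by (simp add: pt_tc tc_mult e p)
qed

lemma pt_smult: "u \<in> carrier U \<Longrightarrow> c \<odot>\<^bsub>BC\<^esub> pt b u = pt (c * b) u"
  by (simp add: BC_smult pt_carrier pt_mult)

text \<open>Additive generation by pure tensors: an integer multiple of a symbol is absorbed into its first factor.\<close>

lemma BC_induct [consumes 1, case_names pt add]:
  assumes P: "P \<in> carrier BC"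
    and pt: "\<And>b u. u \<in> carrier U \<Longrightarrow> Q (pt b u)"
    and add: "\<And>P R. P \<in> carrier BC \<Longrightarrow> R \<in> carrier BC \<Longrightarrow> Q P \<Longrightarrow> Q R \<Longrightarrow> Q (P \<oplus>\<^bsub>BC\<^esub> R)"
  shows "Q P"
proof -
  interpret BC: ring BC by (rule BC_ring)
  have pt_zero: "pt 0 u = \<zero>\<^bsub>BC\<^esub>" if "u \<in> carrier U" for u
    using pt_add_left[OF that, of 0 0] pt_carrier[OF that, of 0]
    by (metis BC.add.l_cancel_one' add_0)
  have tc_single: "tc (Poly_Mapping.single (b, u) c) = pt (of_int c * b) u" if u: "u \<in> carrier U" for b u and c :: int
  proof (induction c rule: int_induct[where k = 0])
    case base
    show ?case using pt_zero[OF u] by (simp add: BC_zero)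
  next
    case (step1 i)
    have "tc (Poly_Mapping.single (b, u) (i + 1)) = tc (Poly_Mapping.single (b, u) i) \<oplus>\<^bsub>BC\<^esub> pt b u"
      by (simp add: pt_tc tc_add sym_carrier u single_add)
    then show ?case by (simp add: step1 pt_add_left u distrib_right)
  next
    case (step2 i)
    have "tc (Poly_Mapping.single (b, u) (i - 1)) \<oplus>\<^bsub>BC\<^esub> pt b u = pt (of_int (i - 1) * b) u \<oplus>\<^bsub>BC\<^esub> pt b u"
      by (simp add: pt_add_left u left_diff_distrib step2(2)[symmetric])
        (simp add: pt_tc tc_add sym_carrier u flip: single_add)
    then show ?case
      using u by (subst (asm) BC.add.right_cancel) (auto simp: carrier_BC sym_carrier pt_tc)
  qed
  obtain p where p: "p \<in> carrier T" "P = tc p" using P by (auto simp: carrier_BC)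
  have "p \<in> carrier T \<and> Q (tc p)"
    using p(1)
  proof (induction rule: T_induct)
    case zero
    have "0 \<in> carrier T" by (simp add: T_simps)
    with pt[OF U.zero_closed, of 0] show ?case by (simp add: pt_zero flip: BC_zero)
  next
    case (single b u c)
    then show ?case using pt[of u "of_int c * b"] by (simp add: tc_single[symmetric] sym_carrier)
  next
    case (add r s)
    then show ?case using assms(3)[of "tc r" "tc s"] by (simp add: tc_add T_carrier carrier_BC)
  qed
  with p(2) show ?thesis by simp
qed

text \<open>A semilinear functional \<open>f\<close> on \<open>U\<close> induces \<open>b \<otimes> u \<mapsto> b f(u)\<close> on the extension of scalars, so it detects that
  \<open>1 \<otimes> u\<close> is nonzero.\<close>

lemma functional_vanishes:
  assumes add: "\<And>u w. u \<in> carrier U \<Longrightarrow> w \<in> carrier U \<Longrightarrow> f (u \<oplus>\<^bsub>U\<^esub> w) = f u + f w"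
    and smult: "\<And>a u. u \<in> carrier U \<Longrightarrow> f (a \<odot>\<^bsub>U\<^esub> u) = \<phi> a * (f u :: 'b)"
    and u: "u \<in> carrier U" and zero: "pt 1 u = \<zero>\<^bsub>BC\<^esub>"
  shows "f u = 0"
proof -
  define L :: "(('b \<times> 'u) \<Rightarrow>\<^sub>0 int) \<Rightarrow> 'b" where
    "L t = (\<Sum>k\<in>Poly_Mapping.keys t. of_int (Poly_Mapping.lookup t k) * (fst k * f (snd k)))" for t
  have L: "L t = (\<Sum>k\<in>K. of_int (Poly_Mapping.lookup t k) * (fst k * f (snd k)))"
    if "finite K" "Poly_Mapping.keys t \<subseteq> K" for t K
    unfolding L_def using that
    by (intro sum.mono_neutral_left) (auto simp: not_in_keys_iff_lookup_eq_zero)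
  have L_add: "L (s + t) = L s + L t" for s t
  proof -
    have "Poly_Mapping.keys (s + t) \<subseteq> Poly_Mapping.keys s \<union> Poly_Mapping.keys t" by (rule keys_add)
    then show ?thesis
      by (simp add: L[of "Poly_Mapping.keys s \<union> Poly_Mapping.keys t"] lookup_add distrib_right sum.distrib)
  qed
  have L_0: "L 0 = 0" by (simp add: L_def)
  have L_minus: "L (- t) = - L t" for t
    using L_add[of t "- t"] by (simp add: L_0 eq_neg_iff_add_eq_0 add.commute)
  have L_diff: "L (s - t) = L s - L t" for s t
    using L_add[of s "- t"] by (simp add: L_minus)
  have L_sym: "L (elt b w) = b * f w" for b w
    by (subst L[of "{(b, w)}"]) auto
  have "elt 1 u \<in> N"
    using zero tc_eq_iff[of "elt 1 u" 0] u by (simp add: pt_tc BC_zero sym_carrier T_simps)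
  then have "L (elt 1 u) = 0"
  proof (induction rule: N_induct)
    case (incl h)
    then show ?case
      by (cases rule: tensor_relatorsE) (auto simp: L_diff L_add L_sym add smult distrib_left distrib_right mult.assoc)
  qed (simp_all add: L_0 L_add L_minus)
  then show ?thesis by (simp add: L_sym)
qed

end

section \<open>The integral form\<close>

lemma free_algebra_UNIV [simp]: "p \<in> carrier (free_algebra UNIV)"
  by (auto simp: free_algebra_simps)

interpretation UF: presentation UNIV "Uq_relations qF"
  by unfold_locales simp_all

type_synonym free_F = "gen list \<Rightarrow>\<^sub>0 analytic_fun fract"

definition dF :: "analytic_fun fract" where "dF = qF - inverse qF"
definition xF :: free_F where "xF = scal (inverse dF) * (letter gX - 1)"
definition yF :: free_F where "yF = scal (inverse dF) * (letter gY - 1)"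
definition zF :: free_F where "zF = scal (inverse dF) * letter gZ"

lemma Uq_qF: "Uq qF = UF.PA" by (simp add: Uq_def)

lemma Uq_gens_F:
  "Uq_theta qF = UF.cls (letter gTheta)" "Uq_x qF = UF.cls xF" "Uq_y qF = UF.cls yF"
  "Uq_z qF = UF.cls zF"
  unfolding Uq_theta_def Uq_x_def Uq_y_def Uq_z_def Uq_gen_def Uq_qF xF_def yF_def zF_def dF_def
    UF.presented_gen_cls UF.cls_one
  by (simp_all only: UF.cls_diff UF.cls_smult free_algebra_UNIV)

abbreviation "UFA \<equiv> restrict_scalars to_F (Uq qF)"

lemma UFA_fields:
  "carrier UFA = carrier UF.PA" "mult UFA = mult UF.PA" "one UFA = one UF.PA"
  "zero UFA = zero UF.PA" "add UFA = add UF.PA"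
  "a \<odot>\<^bsub>UFA\<^esub> u = to_F a \<odot>\<^bsub>UF.PA\<^esub> u"
  by (simp_all add: restrict_scalars_def Uq_qF)

lemma UFA_ring: "ring UFA"
proof -
  have "(\<lambda>x. x) \<in> ring_hom UF.PA UFA"
    by (rule ring_hom_memI) (simp_all add: UFA_fields)
  moreover have "(\<lambda>x. x) ` carrier UF.PA = carrier UFA"
    by (simp add: UFA_fields)
  ultimately have "(\<lambda>x. x) \<in> ring_iso UF.PA UFA"
    by (simp add: ring_iso_def bij_betw_def)
  from ring.ring_iso_imp_img_ring[OF UF.PA_ring this]
  show ?thesis unfolding UFA_fields(4)[symmetric] by simp
qed

lemma UFA_uminus: "\<ominus>\<^bsub>UFA\<^esub> u = \<ominus>\<^bsub>UF.PA\<^esub> u"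
  by (simp add: a_inv_def m_inv_def UFA_fields)

abbreviation "gens_F \<equiv> {Uq_theta qF, Uq_x qF, Uq_y qF, Uq_z qF}"

lemma UA_carrier: "carrier UA = generated_subalgebra UFA gens_F"
  by (simp add: UA_def Let_def)

lemma UA_eq: "UA = UFA\<lparr>carrier := carrier UA\<rparr>"
  by (simp add: UA_def Let_def)

lemma UFA_cls_simps:
  "UF.cls p \<otimes>\<^bsub>UFA\<^esub> UF.cls r = UF.cls (p * r)" "UF.cls p \<oplus>\<^bsub>UFA\<^esub> UF.cls r = UF.cls (p + r)"
  "\<one>\<^bsub>UFA\<^esub> = UF.cls 1" "\<zero>\<^bsub>UFA\<^esub> = UF.cls 0" "\<ominus>\<^bsub>UFA\<^esub> UF.cls p = UF.cls (- p)"
  "a \<odot>\<^bsub>UFA\<^esub> UF.cls p = UF.cls (scal (to_F a) * p)"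
  by (simp_all add: UFA_fields UFA_uminus UF.cls_mult UF.cls_add UF.cls_one UF.cls_zero
      UF.cls_uminus UF.cls_smult)

lemma UA_subring: "subring (carrier UA) UFA"
  unfolding UA_carrier generated_subalgebra_def
proof (rule ring.subring_Inter[OF UFA_ring])
  have "carrier UFA \<in> {V. subring V UFA \<and> (\<forall>c. \<forall>v\<in>V. c \<odot>\<^bsub>UFA\<^esub> v \<in> V) \<and> gens_F \<subseteq> V}"
    using ring.carrier_is_subring[OF UFA_ring]
    by (auto simp: UFA_fields(1) UF.carrier_PA UFA_cls_simps Uq_gens_F)
  then show "{V. subring V UFA \<and> (\<forall>c. \<forall>v\<in>V. c \<odot>\<^bsub>UFA\<^esub> v \<in> V) \<and> gens_F \<subseteq> V} \<noteq> {}" by blast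
qed auto

lemma UA_smult_closed: "u \<in> carrier UA \<Longrightarrow> a \<odot>\<^bsub>UFA\<^esub> u \<in> carrier UA"
  unfolding UA_carrier generated_subalgebra_def by blast

lemma UA_gens: "gens_F \<subseteq> carrier UA"
  unfolding UA_carrier generated_subalgebra_def by blast

lemma UA_least:
  assumes "subring V UFA" "\<And>c v. v \<in> V \<Longrightarrow> c \<odot>\<^bsub>UFA\<^esub> v \<in> V" "gens_F \<subseteq> V"
  shows "carrier UA \<subseteq> V"
  unfolding UA_carrier generated_subalgebra_def using assms by blast

lemma UA_fields:
  "mult UA = mult UFA" "one UA = one UFA" "zero UA = zero UFA" "add UA = add UFA" "smult UA = smult UFA"
  by (simp_all add: UA_def Let_def)

text \<open>The preimage of \<open>U\<^sub>\<bbbA>\<close> in the free algebra over \<open>\<bbbF>\<close>. Elements of \<open>U\<^sub>\<bbbA>\<close> are handled through such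
  representatives, which can be added and multiplied without reference to cosets.\<close>

definition integral_elems :: "free_F set" where
  "integral_elems = {p. UF.cls p \<in> carrier UA}"

lemma UA_cls: "u \<in> carrier UA \<Longrightarrow> \<exists>p\<in>integral_elems. u = UF.cls p"
  using subringE(1)[OF UA_subring] by (auto simp: integral_elems_def UFA_fields(1) UF.carrier_PA)

lemma integral_closed:
  "p \<in> integral_elems \<Longrightarrow> r \<in> integral_elems \<Longrightarrow> p + r \<in> integral_elems"
  "p \<in> integral_elems \<Longrightarrow> r \<in> integral_elems \<Longrightarrow> p * r \<in> integral_elems"
  "p \<in> integral_elems \<Longrightarrow> - p \<in> integral_elems"
  "p \<in> integral_elems \<Longrightarrow> scal (to_F a) * p \<in> integral_elems"
  "1 \<in> integral_elems" "0 \<in> integral_elems"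
  using subringE(2,3)[OF UA_subring] subringE(5)[OF UA_subring, of "UF.cls p"]
    subringE(6,7)[OF UA_subring, of "UF.cls p" "UF.cls r"] UA_smult_closed[of "UF.cls p" a]
  by (simp_all add: integral_elems_def UFA_cls_simps)

lemma integral_diff: "p \<in> integral_elems \<Longrightarrow> r \<in> integral_elems \<Longrightarrow> p - r \<in> integral_elems"
  using integral_closed(1)[of p "- r"] integral_closed(3)[of r] by simp

lemma integral_scal: "scal (to_F a) \<in> integral_elems"
  using integral_closed(4)[OF integral_closed(5)] by simp

lemma integral_cong: "p - r \<in> UF.rels \<Longrightarrow> p \<in> integral_elems \<longleftrightarrow> r \<in> integral_elems"
  using UF.cls_eq_iff[of p r] by (simp add: integral_elems_def)

lemma integral_gens:
  "letter gTheta \<in> integral_elems" "xF \<in> integral_elems" "yF \<in> integral_elems" "zF \<in> integral_elems"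
  using UA_gens by (simp_all add: integral_elems_def Uq_gens_F)

text \<open>The minimality of a generated subalgebra, in terms of representatives: besides the closure properties, \<open>Q\<close> has to
  respect the relations of \<open>U\<^sub>\<bbbF>\<close>.\<close>

lemma integral_induct [consumes 1, case_names cong one add mult uminus scal theta x y z]:
  assumes p: "p \<in> integral_elems"
    and cong: "\<And>p r. p - r \<in> UF.rels \<Longrightarrow> Q p \<Longrightarrow> Q r"
    and one: "Q 1" and add: "\<And>p r. Q p \<Longrightarrow> Q r \<Longrightarrow> Q (p + r)"
    and mult: "\<And>p r. Q p \<Longrightarrow> Q r \<Longrightarrow> Q (p * r)"
    and uminus: "\<And>p. Q p \<Longrightarrow> Q (- p)" and scal: "\<And>a p. Q p \<Longrightarrow> Q (scal (to_F a) * p)"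
    and gens: "Q (letter gTheta)" "Q xF" "Q yF" "Q zF"
  shows "Q p"
proof -
  define V where "V = UF.cls ` Collect Q"
  have "subring V UFA"
    unfolding V_def
    by (rule ring.subringI[OF UFA_ring])
      (use one in \<open>auto simp: UFA_fields(1) UF.carrier_PA UFA_cls_simps intro!: imageI add mult uminus\<close>)
  moreover have "c \<odot>\<^bsub>UFA\<^esub> v \<in> V" if "v \<in> V" for c v
    using that unfolding V_def by (auto simp: UFA_cls_simps intro!: imageI scal)
  moreover have "gens_F \<subseteq> V" unfolding V_def Uq_gens_F using gens by auto
  ultimately have "carrier UA \<subseteq> V" by (rule UA_least)
  then have "UF.cls p \<in> V" using p by (auto simp: integral_elems_def)
  then obtain r where "Q r" "UF.cls r = UF.cls p" by (auto simp: V_def)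
  then show ?thesis using cong[of r p] UF.cls_eq_iff[of r p] by simp
qed

section \<open>The specialization map\<close>

locale specialization =
  fixes q :: real
  assumes q_pos: "q > 0"
begin

lemma UA_scalar_extension: "scalar_extension UA"
proof -
  interpret UFA: ring UFA by (rule UFA_ring)
  have ring: "ring UA"
    using UFA.subring_is_ring[OF UA_subring] by (simp flip: UA_eq)
  show ?thesis
  proof (intro scalar_extension.intro ring scalar_extension_axioms.intro)
    fix u w a assume "u \<in> carrier UA" "w \<in> carrier UA"
    then obtain p r where "u = UF.cls p" "w = UF.cls r" using UA_cls by blast
    then show "(a \<odot>\<^bsub>UA\<^esub> u) \<otimes>\<^bsub>UA\<^esub> w = a \<odot>\<^bsub>UA\<^esub> (u \<otimes>\<^bsub>UA\<^esub> w)"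
      "u \<otimes>\<^bsub>UA\<^esub> (a \<odot>\<^bsub>UA\<^esub> w) = a \<odot>\<^bsub>UA\<^esub> (u \<otimes>\<^bsub>UA\<^esub> w)"
      by (simp_all add: UA_fields UFA_cls_simps mult.assoc)
        (simp add: scal_comm[of "to_F a" r] scal_comm[of "to_F a" "p * r"] mult.assoc)
  qed (simp add: UA_fields UA_smult_closed)
qed

sublocale E: scalar_extension "ev q" UA
  by (rule UA_scalar_extension)

abbreviation "spec \<equiv> UA_specialization q"

lemma spec_eq: "spec = E.BC" by (simp add: UA_specialization_def)

definition tau :: "free_F \<Rightarrow> ((complex \<times> UF_elem) \<Rightarrow>\<^sub>0 int) set" where
  "tau p = pure_tensor (ev q) UA 1 (UF.cls p)"

lemma tau_closed: "p \<in> integral_elems \<Longrightarrow> tau p \<in> carrier spec"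
  by (simp add: tau_def spec_eq E.pt_carrier integral_elems_def)

lemma tau_simps:
  "tau 1 = \<one>\<^bsub>spec\<^esub>"
  "p \<in> integral_elems \<Longrightarrow> r \<in> integral_elems \<Longrightarrow> tau (p + r) = tau p \<oplus>\<^bsub>spec\<^esub> tau r"
  "p \<in> integral_elems \<Longrightarrow> r \<in> integral_elems \<Longrightarrow> tau (p * r) = tau p \<otimes>\<^bsub>spec\<^esub> tau r"
  "p \<in> integral_elems \<Longrightarrow> tau (scal (to_F a) * p) = ev q a \<odot>\<^bsub>spec\<^esub> tau p"
proof -
  show "tau 1 = \<one>\<^bsub>spec\<^esub>"
    by (simp add: tau_def spec_eq E.BC_one UA_fields UFA_cls_simps)
  assume "p \<in> integral_elems"
  then have p: "UF.cls p \<in> carrier UA" by (simp add: integral_elems_def)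
  show "tau (scal (to_F a) * p) = ev q a \<odot>\<^bsub>spec\<^esub> tau p"
    using E.pt_scalar[OF p, of 1 a]
    by (simp add: tau_def spec_eq E.pt_smult p UA_fields UFA_cls_simps)
  assume "r \<in> integral_elems"
  then have r: "UF.cls r \<in> carrier UA" by (simp add: integral_elems_def)
  show "tau (p + r) = tau p \<oplus>\<^bsub>spec\<^esub> tau r"
    by (simp add: tau_def spec_eq E.pt_add_right p r UA_fields UFA_cls_simps)
  show "tau (p * r) = tau p \<otimes>\<^bsub>spec\<^esub> tau r"
    by (simp add: tau_def spec_eq E.pt_mult p r UA_fields UFA_cls_simps)
qed

lemma spec_ring: "ring spec"
  unfolding spec_eq by (rule E.BC_ring)

sublocale SP: ring spec by (rule spec_ring)

lemma spec_smult: "P \<in> carrier spec \<Longrightarrow> c \<odot>\<^bsub>spec\<^esub> P = tau (scal (const_F c)) \<otimes>\<^bsub>spec\<^esub> P"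
  using E.pt_scalar[of "UF.cls 1" 1 "const_afun c"] integral_closed(5)
  by (simp add: spec_eq E.BC_smult tau_def UA_fields UFA_cls_simps integral_elems_def ev_simps
      const_F_def q_pos)

lemma integral_const: "scal (const_F c) \<in> integral_elems"
  unfolding const_F_def by (rule integral_scal)

lemma spec_zero_smult: "P \<in> carrier spec \<Longrightarrow> 0 \<odot>\<^bsub>spec\<^esub> P = \<zero>\<^bsub>spec\<^esub>"
proof -
  assume P: "P \<in> carrier spec"
  have "tau 0 \<oplus>\<^bsub>spec\<^esub> tau 0 = tau 0"
    using tau_simps(2)[of 0 0] integral_closed(6) by simp
  then have "tau 0 = \<zero>\<^bsub>spec\<^esub>"
    using SP.add.l_cancel_one' tau_closed[OF integral_closed(6)] by metis
  then show ?thesis using spec_smult[OF P, of 0] P by (simp add: const_F_hom scal_hom)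
qed

text \<open>The representatives of the kernel of \<open>u \<mapsto> 1 \<otimes> u\<close>. Congruence modulo \<open>kills\<close> is equality in the
  specialization, so identities there are verified by ring calculations over \<open>\<bbbF>\<close>.\<close>

definition kills :: "free_F set" where
  "kills = {p \<in> integral_elems. tau p = \<zero>\<^bsub>spec\<^esub>}"

lemma tau_zero: "tau 0 = \<zero>\<^bsub>spec\<^esub>"
  using tau_simps(4)[OF integral_closed(5), of 0] spec_zero_smult[OF tau_closed[OF integral_closed(5)]]
  by (simp add: to_F_hom scal_hom ev_simps q_pos)

lemma kills_rels: "p \<in> UF.rels \<Longrightarrow> p \<in> kills"
  using UF.cls_eq_iff[of p 0] integral_cong[of p 0] integral_closed(6) tau_zero
  by (simp add: kills_def tau_def)

lemma kills_closed:
  "0 \<in> kills" "p \<in> kills \<Longrightarrow> r \<in> kills \<Longrightarrow> p + r \<in> kills"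
  "p \<in> kills \<Longrightarrow> r \<in> integral_elems \<Longrightarrow> p * r \<in> kills"
  "p \<in> kills \<Longrightarrow> r \<in> integral_elems \<Longrightarrow> r * p \<in> kills"
  "ev q a = 0 \<Longrightarrow> r \<in> integral_elems \<Longrightarrow> scal (to_F a) * r \<in> kills"
  by (auto simp: kills_def tau_simps tau_zero integral_closed tau_closed spec_zero_smult)

lemma kills_uminus: "p \<in> kills \<Longrightarrow> - p \<in> kills"
  using kills_closed(3)[of p "- 1"] integral_closed(3,5) by simp

lemma kills_diff: "p \<in> kills \<Longrightarrow> r \<in> kills \<Longrightarrow> p - r \<in> kills"
  using kills_closed(2)[of p "- r"] kills_uminus[of r] by simp

lemma tau_eq_iff:
  assumes "p \<in> integral_elems" "r \<in> integral_elems"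
  shows "tau p = tau r \<longleftrightarrow> p - r \<in> kills"
proof -
  have "tau p = tau ((p - r) + r)" by simp
  also have "\<dots> = tau (p - r) \<oplus>\<^bsub>spec\<^esub> tau r"
    by (rule tau_simps(2)[OF integral_diff[OF assms] assms(2)])
  finally show ?thesis
    using assms by (auto simp: kills_def integral_diff tau_closed)
qed

text \<open>The constants belong to \<open>\<bbbA>\<close>, hence \<open>b \<otimes> u = 1 \<otimes> b u\<close>.\<close>

lemma tau_surj: "P \<in> carrier spec \<Longrightarrow> \<exists>p\<in>integral_elems. P = tau p"
  unfolding spec_eq
proof (induction P rule: E.BC_induct)
  case (pt b u)
  then obtain p where p: "p \<in> integral_elems" "u = UF.cls p" using UA_cls by blast
  have "pure_tensor (ev q) UA b u = tau (scal (const_F b) * p)"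
    using E.pt_scalar[OF pt, of 1 "const_afun b"] p
    by (simp add: tau_def UA_fields UFA_cls_simps ev_simps q_pos const_F_def)
  then show ?case using p integral_closed(2)[OF integral_const] by blast
next
  case (add P R)
  then show ?case using tau_simps(2) integral_closed(1) by (metis spec_eq)
qed

abbreviation "const_subst v \<equiv> subst_hom (\<lambda>c. scal (const_F c)) (v :: 's \<Rightarrow> free_F)"

lemma const_substitution: "substitution (\<lambda>c. scal (const_F c)) (v :: 's \<Rightarrow> free_F)"
  by unfold_locales (simp_all add: const_F_hom scal_hom, rule scal_comm)

lemma const_subst_integral:
  assumes v: "\<And>s. s \<in> S \<Longrightarrow> v s \<in> integral_elems" and p: "p \<in> carrier (free_algebra S)"
  shows "const_subst v p \<in> integral_elems"
proof -
  have prod: "prod_list (map v w) \<in> integral_elems" if "w \<in> lists S" for w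
    using that by (induction w) (auto simp: integral_closed v)
  have "(\<Sum>w\<in>W. scal (const_F (Poly_Mapping.lookup p w)) * prod_list (map v w)) \<in> integral_elems"
    if "W \<subseteq> lists S" for W
    using that by (induction W rule: infinite_finite_induct)
      (auto simp: integral_closed prod integral_const)
  then show ?thesis unfolding subst_hom_def using p by (simp add: free_algebra_simps)
qed

text \<open>Criterion for the specialization to be the algebra presented by \<open>S\<close> and \<open>Rel\<close>. The images \<open>v s\<close> in \<open>U\<^sub>\<bbbA>\<close> of
  the letters define a homomorphism from the free algebra over \<open>\<complex>\<close> by \<open>p \<mapsto> 1 \<otimes> p(v)\<close>. It factors through the
  relations, and it is onto because the image is closed under the operations of \<open>U\<^sub>\<bbbA>\<close>, a coefficient \<open>a \<in> \<bbbA>\<close>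
  acting as the constant \<open>a(q)\<close>. If its kernel contained an element outside the ideal of relations, then reducing
  that element to a combination of words from \<open>W\<close> would give a nonzero combination in the kernel.\<close>

theorem specialization_iso:
  fixes v :: "'s \<Rightarrow> free_F" and Rel :: "(('s list \<Rightarrow>\<^sub>0 complex) \<times> ('s list \<Rightarrow>\<^sub>0 complex)) set"
    and W :: "'s list set"
  assumes pres: "presentation S Rel"
    and v: "\<And>s. s \<in> S \<Longrightarrow> v s \<in> integral_elems"
    and relations: "\<And>l r. (l, r) \<in> Rel \<Longrightarrow> const_subst v (l - r) \<in> kills"
    and surj: "\<And>g. g \<in> {letter gTheta, xF, yF, zF} \<Longrightarrow>
       \<exists>p\<in>carrier (free_algebra S). const_subst v p - g \<in> kills"
    and spanning: "\<And>p. p \<in> carrier (free_algebra S) \<Longrightarrow>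
       \<exists>p'. Poly_Mapping.keys p' \<subseteq> W \<and> p - p' \<in> relation_ideal S Rel"
    and independent: "\<And>p. Poly_Mapping.keys p \<subseteq> W \<Longrightarrow> p \<in> carrier (free_algebra S) \<Longrightarrow>
       const_subst v p \<in> kills \<Longrightarrow> p = 0"
  shows "\<exists>h\<in>algebra_iso spec (presented_algebra S Rel). \<forall>p\<in>carrier (free_algebra S).
    h (tau (const_subst v p)) = relation_ideal S Rel +>\<^bsub>free_algebra S\<^esub> p"
proof -
  interpret P: presentation S Rel by (rule pres)
  interpret V: substitution "\<lambda>c. scal (const_F c)" v by (rule const_substitution)
  define \<Phi> where "\<Phi> p = tau (const_subst v p)" for p
  have int: "const_subst v p \<in> integral_elems" if "p \<in> carrier P.free" for p
    by (rule const_subst_integral[OF v that])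
  have hom: "\<Phi> \<in> ring_hom P.free spec"
    by (rule ring_hom_memI)
      (simp_all add: \<Phi>_def free_algebra_mult free_algebra_simps(2,4) V.subst_simps tau_simps int tau_closed)
  then interpret H: ring_hom_ring P.free spec \<Phi>
    by (intro ring_hom_ringI2 free_algebra_ring spec_ring)
  have ker_iff: "\<Phi> p = \<zero>\<^bsub>spec\<^esub> \<longleftrightarrow> const_subst v p \<in> kills" if "p \<in> carrier P.free" for p
    using int[OF that] by (auto simp: \<Phi>_def kills_def)
  have ker_le: "P.rels \<subseteq> a_kernel P.free spec \<Phi>"
  proof (rule P.rels_least[OF H.kernel_is_ideal])
    fix l r assume lr: "(l, r) \<in> Rel"
    then have "l - r \<in> carrier P.free" using P.Rel_carrier free_algebra_carrier(4) by metis
    with relations[OF lr] show "l - r \<in> a_kernel P.free spec \<Phi>"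
      by (simp only: a_kernel_def' mem_Collect_eq ker_iff simp_thms)
  qed
  have ker: "a_kernel P.free spec \<Phi> = P.rels"
  proof (rule equalityI[OF _ ker_le], rule subsetI)
    fix p assume "p \<in> a_kernel P.free spec \<Phi>"
    then have "p \<in> carrier P.free" "\<Phi> p = \<zero>\<^bsub>spec\<^esub>"
      by (simp_all only: a_kernel_def' mem_Collect_eq)
    then have p: "p \<in> carrier P.free" "const_subst v p \<in> kills" using ker_iff[of p] by blast+
    obtain p' where p': "Poly_Mapping.keys p' \<subseteq> W" "p - p' \<in> P.rels" using spanning[OF p(1)] by blast
    have "p - (p - p') \<in> carrier P.free" by (rule free_algebra_carrier(4)[OF p(1) P.rels_sub[OF p'(2)]])
    then have c: "p' \<in> carrier P.free" by simp
    have "p - p' \<in> a_kernel P.free spec \<Phi>" using ker_le p'(2) by blast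
    then have "\<Phi> (p - p') = \<zero>\<^bsub>spec\<^esub>" by (simp only: a_kernel_def' mem_Collect_eq)
    then have "const_subst v p - const_subst v p' \<in> kills"
      using ker_iff[OF P.rels_sub[OF p'(2)]] by (simp add: V.subst_diff)
    from kills_diff[OF p(2) this] have "p' = 0" using independent[OF p'(1) c] by simp
    with p'(2) show "p \<in> P.rels" by simp
  qed
  have image: "\<exists>p\<in>carrier P.free. const_subst v p - g \<in> kills" if g: "g \<in> integral_elems" for g
  proof -
    have "g \<in> integral_elems \<and> (\<exists>p\<in>carrier P.free. const_subst v p - g \<in> kills)"
      using g
    proof (induction rule: integral_induct)
      case (cong g g')
      then obtain p where p: "p \<in> carrier P.free" "const_subst v p - g \<in> kills" by blast
      have "const_subst v p - g' = (const_subst v p - g) + (g - g')" by simp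
      also have "\<dots> \<in> kills" using p(2) kills_rels[OF cong(1)] by (rule kills_closed(2))
      finally show ?case using p(1) integral_cong[OF cong(1)] cong(2) by blast
    next
      case one
      show ?case
        using integral_closed(5) kills_closed(1) free_algebra_consts(2)[of S]
        by (auto intro!: bexI[of _ 1] simp: V.subst_one)
    next
      case (add g g')
      then obtain p p' where p: "p \<in> carrier P.free" "const_subst v p - g \<in> kills"
        "p' \<in> carrier P.free" "const_subst v p' - g' \<in> kills" by blast
      have "const_subst v (p + p') - (g + g') = (const_subst v p - g) + (const_subst v p' - g')"
        by (simp add: V.subst_add)
      also have "\<dots> \<in> kills" using p by (intro kills_closed(2))
      finally show ?case using p add free_algebra_carrier(1) integral_closed(1) by blast
    next
      case (mult g g')
      then obtain p p' where p: "p \<in> carrier P.free" "const_subst v p - g \<in> kills"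
        "p' \<in> carrier P.free" "const_subst v p' - g' \<in> kills" by blast
      have "const_subst v (p * p') - g * g' =
          (const_subst v p - g) * const_subst v p' + g * (const_subst v p' - g')"
        by (simp add: V.subst_mult algebra_simps)
      also have "\<dots> \<in> kills" using p mult by (intro kills_closed(2-4) int) auto
      finally show ?case using p mult free_algebra_carrier(2) integral_closed(2) by blast
    next
      case (uminus g)
      then obtain p where p: "p \<in> carrier P.free" "const_subst v p - g \<in> kills" by blast
      have "const_subst v (- p) - (- g) = - (const_subst v p - g)"
        by (simp add: V.subst_uminus)
      also have "\<dots> \<in> kills" using p by (intro kills_uminus)
      finally show ?case using p uminus free_algebra_carrier(3) integral_closed(3) by blast
    next
      case (scal a g)
      then obtain p where p: "p \<in> carrier P.free" "const_subst v p - g \<in> kills" by blast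
      have e: "scal (to_F (const_afun (ev q a) - a)) = scal (const_F (ev q a)) - (scal (to_F a) :: free_F)"
        by (simp add: const_F_def to_F_hom scal_hom)
      \<comment> \<open>the coefficient \<open>a(q) - a\<close> vanishes at \<open>q\<close>\<close>
      have "const_subst v (scal (ev q a) * p) - scal (to_F a) * g =
          scal (const_F (ev q a)) * (const_subst v p - g) + scal (to_F (const_afun (ev q a) - a)) * g"
        by (simp add: V.subst_mult V.subst_scal e algebra_simps)
      also have "\<dots> \<in> kills" using p scal
        by (intro kills_closed(2,4,5)) (auto simp: integral_const ev_simps q_pos)
      finally show ?case
        using p scal free_algebra_carrier(2) free_algebra_consts(1) integral_closed(4) by blast
    qed (use integral_gens surj in auto)
    then show ?thesis by blast
  qed
  have "\<Phi> ` carrier P.free = carrier spec"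
  proof (rule equalityI)
    show "carrier spec \<subseteq> \<Phi> ` carrier P.free"
    proof
      fix P assume "P \<in> carrier spec"
      then obtain g where g: "g \<in> integral_elems" "P = tau g" using tau_surj by blast
      obtain p where "p \<in> carrier P.free" "const_subst v p - g \<in> kills" using image[OF g(1)] by blast
      then show "P \<in> \<Phi> ` carrier P.free"
        using tau_eq_iff[of "const_subst v p" g] int g by (auto simp: \<Phi>_def)
    qed
  qed auto
  from H.FactRing_iso_set[OF this]
  have k: "(\<lambda>X. the_elem (\<Phi> ` X)) \<in> ring_iso (P.free Quot P.rels) spec" by (simp add: ker)
  define k where "k X = the_elem (\<Phi> ` X)" for X
  have k_cls: "k (P.cls p) = \<Phi> p" if "p \<in> carrier P.free" for p
    using H.the_elem_simp[OF that] by (simp add: k_def ker P.cls_def)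
  define h where "h = inv_into (carrier P.PA) k"
  have k_iso: "k \<in> ring_iso P.PA spec"
    using k unfolding k_def[symmetric] by (simp add: ring_iso_def ring_hom_def P.PA_fields)
  have h_iso: "h \<in> ring_iso spec P.PA"
    unfolding h_def by (rule ring_iso_set_sym[OF P.PA_ring k_iso])
  have h_\<Phi>: "h (\<Phi> p) = P.cls p" if "p \<in> carrier P.free" for p
    unfolding h_def
  proof (rule inv_into_f_eq)
    show "k (P.cls p) = \<Phi> p" by (rule k_cls[OF that])
    show "inj_on k (carrier P.PA)" using k_iso by (simp add: ring_iso_def bij_betw_def)
    show "P.cls p \<in> carrier P.PA" using that by (simp add: P.carrier_PA)
  qed
  have "h (c \<odot>\<^bsub>spec\<^esub> P) = c \<odot>\<^bsub>P.PA\<^esub> h P" if P: "P \<in> carrier spec" for c P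
  proof -
    obtain p where p: "p \<in> carrier P.free" "P = \<Phi> p"
      using P \<open>\<Phi> ` carrier P.free = carrier spec\<close> by auto
    have "c \<odot>\<^bsub>spec\<^esub> P = \<Phi> (scal c * p)"
      using spec_smult[OF P] tau_simps(3)[OF integral_const int[OF p(1)]] p
      by (simp add: \<Phi>_def V.subst_mult V.subst_scal)
    then show ?thesis
      using p by (simp add: h_\<Phi> P.cls_smult free_algebra_carrier free_algebra_consts)
  qed
  then have "h \<in> algebra_iso spec P.PA" using h_iso by (simp add: algebra_iso_def)
  then show ?thesis using h_\<Phi> by (auto simp: \<Phi>_def P.cls_def)
qed

end

section \<open>Difference operators\<close>

text \<open>Linear operators on functions of a pair \<open>(j, m)\<close>. The index \<open>m \<in> \<int>\<close> is the weight. The index \<open>j\<close> stands for the powers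
  of a central parameter \<open>\<lambda>\<close>, which acts as the shift \<open>j \<mapsto> j + 1\<close>, the transpose of multiplication by \<open>\<lambda>\<close>. A function
  concentrated at \<open>j = J\<close> then picks out the coefficient of \<open>\<lambda>\<^sup>J\<close> of an operator as its value at \<open>j = 0\<close>.\<close>

typedef (overloaded) 'k diff_op = "{T :: (nat \<Rightarrow> int \<Rightarrow> 'k::comm_ring_1) \<Rightarrow> nat \<Rightarrow> int \<Rightarrow> 'k.
    \<forall>a f g. T (\<lambda>j m. a * f j m + g j m) = (\<lambda>j m. a * T f j m + T g j m)}"
  morphisms app Abs_diff_op
  by (rule exI[of _ "\<lambda>f. f"]) simp

setup_lifting type_definition_diff_op

lemma app_linear: "app T (\<lambda>j m. a * f j m + g j m) = (\<lambda>j m. a * app T f j m + app T g j m)"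
  using app[of T] by blast

lemma app_add: "app T (\<lambda>j m. f j m + g j m) = (\<lambda>j m. app T f j m + app T g j m)"
  using app_linear[of T 1 f g] by simp

lemma app_zero: "app T (\<lambda>j m. 0) = (\<lambda>j m. 0)"
  using app_linear[of T "-1" "\<lambda>j m. 0" "\<lambda>j m. 0"] by simp

lemma app_scale: "app T (\<lambda>j m. a * f j m) = (\<lambda>j m. a * app T f j m)"
  using app_linear[of T a f "\<lambda>j m. 0"] by (simp add: app_zero)

instantiation diff_op :: (comm_ring_1) ring_1
begin

lift_definition zero_diff_op :: "'a diff_op" is "\<lambda>f j m. 0" by simp
lift_definition one_diff_op :: "'a diff_op" is "\<lambda>f. f" by simp
lift_definition plus_diff_op :: "'a diff_op \<Rightarrow> 'a diff_op \<Rightarrow> 'a diff_op"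
  is "\<lambda>S T f j m. S f j m + T f j m" by (simp add: algebra_simps)
lift_definition minus_diff_op :: "'a diff_op \<Rightarrow> 'a diff_op \<Rightarrow> 'a diff_op"
  is "\<lambda>S T f j m. S f j m - T f j m" by (simp add: algebra_simps)
lift_definition uminus_diff_op :: "'a diff_op \<Rightarrow> 'a diff_op"
  is "\<lambda>T f j m. - T f j m" by simp
lift_definition times_diff_op :: "'a diff_op \<Rightarrow> 'a diff_op \<Rightarrow> 'a diff_op"
  is "\<lambda>S T f. S (T f)" by simp

instance
proof
  show "(0::'a diff_op) \<noteq> 1"
    by transfer (auto simp: fun_eq_iff intro!: exI[of _ "\<lambda>_ _. 1"])
  fix S T U :: "'a diff_op"
  show "S * (T + U) = S * T + S * U"
    by (simp add: app_inject[symmetric] fun_eq_iff times_diff_op.rep_eq plus_diff_op.rep_eq app_add)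
qed (transfer; simp add: fun_eq_iff algebra_simps)+

end

lemma app_simps:
  "app 0 f j m = 0" "app 1 f = f" "app (S + T) f j m = app S f j m + app T f j m"
  "app (S - T) f j m = app S f j m - app T f j m" "app (- T) f j m = - app T f j m"
  "app (S * T) f = app S (app T f)"
  by (transfer; simp)+

lemma diff_op_eqI: "(\<And>f j m. app S f j m = app T f j m) \<Longrightarrow> S = T"
  by (simp add: app_inject[symmetric] fun_eq_iff)

lift_definition diag :: "(int \<Rightarrow> 'k::comm_ring_1) \<Rightarrow> 'k diff_op" is "\<lambda>c f j m. c m * f j m"
  by (simp add: algebra_simps)

lift_definition shift :: "int \<Rightarrow> 'k::comm_ring_1 diff_op" is "\<lambda>s f j m. f j (m + s)"
  by simp

lift_definition casimir_shift :: "'k::comm_ring_1 diff_op" is "\<lambda>f j m. f (Suc j) m"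
  by simp

lemmas op_simps = app_simps diag.rep_eq shift.rep_eq casimir_shift.rep_eq

abbreviation scalar_op :: "'k::comm_ring_1 \<Rightarrow> 'k diff_op" where "scalar_op c \<equiv> diag (\<lambda>_. c)"

lemma scalar_op_comm: "scalar_op c * T = T * scalar_op c"
  by (rule diff_op_eqI) (simp add: op_simps app_scale)

abbreviation "op_rep o' \<equiv> subst_hom scalar_op (o' :: 's \<Rightarrow> 'k::comm_ring_1 diff_op)"

lemma op_substitution: "substitution scalar_op (o' :: 's \<Rightarrow> 'k::comm_ring_1 diff_op)"
proof
  show "scalar_op a * o' s = o' s * scalar_op a" for a s by (rule scalar_op_comm)
qed (rule diff_op_eqI, simp add: op_simps algebra_simps)+

section \<open>The universal weight module\<close>

text \<open>The operators below are the action of the generators on formal sums \<open>\<Sum> f(m) z\<^sup>m\<close>. Let \<open>d = q - q\<^sup>-\<^sup>1\<close>. From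
  \<open>X z\<^sup>m = q\<^sup>2\<^sup>m z\<^sup>m\<close>, \<open>Z = d z\<close> the relation \<open>XY + q\<^sup>2Z\<^sup>2 = 1\<close> forces \<open>Y = X\<^sup>-\<^sup>1(1 - q\<^sup>2Z\<^sup>2)\<close>. The element
  \<open>\<theta>Z + (q X + q\<^sup>-\<^sup>1 Y)/d\<close> is central; \<open>\<theta>\<close> is found by requiring it to act by the scalar \<open>d \<lambda> + (q + q\<^sup>-\<^sup>1)/d\<close>,
  a normalization for which the resulting coefficients have no pole at \<open>q = 1\<close>.\<close>

definition qpow :: "'k::field \<Rightarrow> int \<Rightarrow> 'k" where "qpow q m = q powi (2 * m)"

text \<open>This is \<open>q\<^sup>m [m]\<close> for the quantum integer \<open>[m]\<close>, and its limit at \<open>q = 1\<close>.\<close>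

definition qnum :: "'k::field \<Rightarrow> int \<Rightarrow> 'k" where
  "qnum q m = (if q = 1 then of_int m else (qpow q m - 1) / (q - inverse q))"

definition op_x :: "'k::field \<Rightarrow> 'k diff_op" where "op_x q = diag (qnum q)"
definition op_y :: "'k::field \<Rightarrow> 'k diff_op" where
  "op_y q = diag (\<lambda>m. qnum q (- m)) - diag (\<lambda>m. (q - inverse q) * qpow q (1 - m)) * shift (- 2)"
definition op_z :: "'k::field diff_op" where "op_z = shift (- 1)"
definition op_theta :: "'k::field \<Rightarrow> 'k diff_op" where
  "op_theta q = casimir_shift * shift 1
     - diag (\<lambda>m. inverse q * qpow q (- m) * qnum q (m + 1) * qnum q m) * shift 1
     + diag (\<lambda>m. q * qpow q (- m)) * shift (- 1)"
definition op_X :: "'k::field \<Rightarrow> 'k diff_op" where "op_X q = 1 + scalar_op (q - inverse q) * op_x q"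
definition op_Y :: "'k::field \<Rightarrow> 'k diff_op" where "op_Y q = 1 + scalar_op (q - inverse q) * op_y q"
definition op_Z :: "'k::field \<Rightarrow> 'k diff_op" where "op_Z q = scalar_op (q - inverse q) * op_z"

lemma qpow_simps:
  assumes "q \<noteq> 0"
  shows "qpow q (m + k) = qpow q m * qpow q k" "qpow q (m - k) = qpow q m / qpow q k"
    "qpow q (- m) = 1 / qpow q m" "qpow q m \<noteq> 0"
    "qpow q 0 = 1" "qpow q 1 = q^2" "qpow q 2 = q^4" "qpow q 3 = q^6"
  using assms by (simp_all add: qpow_def power_int_add power_int_diff power_int_minus distrib_left
      right_diff_distrib divide_inverse)

text \<open>The recursion has no denominator. It therefore shows that these numbers lie in \<open>\<bbbA>\<close> over \<open>\<bbbF>\<close>, and that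
  evaluating at \<open>q\<close>, also at \<open>q = 1\<close>, gives the numbers over \<open>\<complex>\<close>.\<close>

lemma qnum_rec:
  assumes "q \<noteq> 0" "q = 1 \<or> q - inverse q \<noteq> 0"
  shows "qnum q 0 = 0" "qnum q (m + 1) = q^2 * qnum q m + q"
proof -
  show "qnum q 0 = 0" using assms(1) by (simp add: qnum_def qpow_simps)
  show "qnum q (m + 1) = q^2 * qnum q m + q"
  proof (cases "q = 1")
    case False
    with assms have "q - inverse q \<noteq> 0" by simp
    then show ?thesis using False assms(1)
      by (simp add: qnum_def qpow_simps divide_simps) (simp add: algebra_simps power2_eq_square)
  qed (simp add: qnum_def)
qed

context
  fixes q d :: "'k::field"
  assumes q: "q \<noteq> 0" and d_def: "d = q - inverse q" and d: "d \<noteq> 0"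
begin

lemma q_not_1: "q \<noteq> 1"
  using d d_def by auto

lemma d_qnum: "d * (qnum q m * y) = qpow q m * y - y"
  using d q_not_1 by (simp add: qnum_def left_diff_distrib flip: d_def)

lemma app_X: "app (op_X q) f j m = qpow q m * f j m"
  by (simp add: op_X_def op_x_def op_simps d_qnum flip: d_def)

lemma app_Z: "app (op_Z q) f j m = d * f j (m - 1)"
  by (simp add: op_Z_def op_z_def op_simps d_def)

lemma app_Y: "app (op_Y q) f j m = qpow q (- m) * f j m - d^2 * qpow q (1 - m) * f j (m - 2)"
  by (simp add: op_Y_def op_y_def op_simps right_diff_distrib d_qnum power2_eq_square mult.assoc flip: d_def)

lemma app_theta: "app (op_theta q) f j m =
   f (Suc j) (m + 1) - inverse q * qpow q (- m) * (qpow q (m + 1) - 1) * (qpow q m - 1) / d^2 * f j (m + 1)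
    + q * qpow q (- m) * f j (m - 1)"
  using d q_not_1 by (simp add: op_theta_def op_simps qnum_def power2_eq_square flip: d_def)

lemma op_relations:
  "op_X q * op_Z q = scalar_op (q^2) * (op_Z q * op_X q)"
  "op_Z q * op_Y q = scalar_op (q^2) * (op_Y q * op_Z q)"
  "op_X q * op_Y q + scalar_op (q^2) * (op_Z q * op_Z q) = 1"
  "op_Y q * op_X q + scalar_op ((inverse q)^2) * (op_Z q * op_Z q) = 1"
  "scalar_op q * (op_X q * op_theta q) - scalar_op (inverse q) * (op_theta q * op_X q) =
     scalar_op (q + inverse q) * op_Z q"
  "scalar_op q * (op_theta q * op_Y q) - scalar_op (inverse q) * (op_Y q * op_theta q) =
     scalar_op (q + inverse q) * op_Z q"
  "op_theta q * op_Z q - op_Z q * op_theta q = op_Y q - op_X q"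
proof -
  note s = op_simps app_X app_Y app_Z app_theta
  note P = qpow_simps[OF q]
  have pw: "q ^ 4 = q * q * q * q" "q ^ 6 = q * q * q * q * q * q" "q ^ 2 = q * q"
    by (simp_all add: eval_nat_numeral)
  show "op_X q * op_Z q = scalar_op (q^2) * (op_Z q * op_X q)"
    by (rule diff_op_eqI) (simp add: s P q)
  show "op_Z q * op_Y q = scalar_op (q^2) * (op_Y q * op_Z q)"
    by (rule diff_op_eqI) (simp add: s P q field_simps)
  show "op_X q * op_Y q + scalar_op (q^2) * (op_Z q * op_Z q) = 1"
    by (rule diff_op_eqI) (simp add: s P q field_simps pw power2_eq_square)
  show "op_Y q * op_X q + scalar_op ((inverse q)^2) * (op_Z q * op_Z q) = 1"
    by (rule diff_op_eqI) (simp add: s P q field_simps pw power2_eq_square)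
  show "scalar_op q * (op_X q * op_theta q) - scalar_op (inverse q) * (op_theta q * op_X q) =
     scalar_op (q + inverse q) * op_Z q"
    using q d by (intro diff_op_eqI) (simp add: s P divide_simps, simp add: d_def field_simps, simp add: eval_nat_numeral)
  show "scalar_op q * (op_theta q * op_Y q) - scalar_op (inverse q) * (op_Y q * op_theta q) =
     scalar_op (q + inverse q) * op_Z q"
    using q d by (intro diff_op_eqI) (simp add: s P divide_simps, simp add: d_def field_simps, simp add: eval_nat_numeral algebra_simps)
  show "op_theta q * op_Z q - op_Z q * op_theta q = op_Y q - op_X q"
    using q d by (intro diff_op_eqI) (simp add: s P divide_simps, simp add: d_def field_simps, simp add: eval_nat_numeral algebra_simps)
qed

end

fun gen_op :: "'k::field \<Rightarrow> gen \<Rightarrow> 'k diff_op" where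
  "gen_op q gX = op_X q" | "gen_op q gY = op_Y q" | "gen_op q gZ = op_Z q"
| "gen_op q gTheta = op_theta q"

text \<open>Hence the operator of an element of the free algebra depends only on its class in \<open>U\<^sub>q(\<gg>)\<close>.\<close>

lemma op_rep_relations:
  fixes q :: "'k::field"
  assumes q: "q \<noteq> 0" "q - inverse q \<noteq> 0" and p: "p \<in> relation_ideal UNIV (Uq_relations q)"
  shows "op_rep (gen_op q) p = 0"
proof -
  interpret S: substitution scalar_op "gen_op q" by (rule op_substitution)
  interpret P: presentation UNIV "Uq_relations q" by unfold_locales simp_all
  let ?J = "{p. op_rep (gen_op q) p = 0}"
  have "ideal ?J P.free"
  proof (rule idealI[OF free_algebra_ring])
    interpret F: ring P.free by (rule free_algebra_ring)
    show "subgroup ?J (add_monoid P.free)"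
    proof (rule F.add.subgroupI)
      fix a assume "a \<in> ?J"
      then show "\<ominus>\<^bsub>P.free\<^esub> a \<in> ?J"
        using free_algebra_minus[of a UNIV 0] by (simp add: a_minus_def free_algebra_simps S.subst_simps)
    qed (auto simp: free_algebra_simps S.subst_simps intro: exI[of _ 0])
  qed (auto simp: free_algebra_mult S.subst_simps)
  moreover have "l - r \<in> ?J" if "(l, r) \<in> Uq_relations q" for l r
    using that op_relations[OF q(1) refl q(2)]
    by (auto simp: Uq_relations_def Let_def free_algebra_simps(2-5) free_algebra_mult free_algebra_minus
        S.subst_simps)
  ultimately show ?thesis using P.rels_least p by blast
qed

section \<open>Specializing operators\<close>

context specialization
begin

text \<open>An element of \<open>\<bbbF>\<close> that comes from \<open>\<bbbA>\<close>, together with its value at \<open>q\<close>.\<close>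

definition lifts_to :: "analytic_fun fract \<Rightarrow> complex \<Rightarrow> bool" where
  "lifts_to f c \<longleftrightarrow> (\<exists>a. f = to_F a \<and> ev q a = c)"

lemma lifts_to_simps:
  "lifts_to 0 0" "lifts_to 1 1" "lifts_to (const_F b) b"
  "lifts_to qF (complex_of_real q)" "lifts_to (inverse qF) (inverse (complex_of_real q))"
  "lifts_to f c \<Longrightarrow> lifts_to g b \<Longrightarrow> lifts_to (f + g) (c + b)"
  "lifts_to f c \<Longrightarrow> lifts_to g b \<Longrightarrow> lifts_to (f - g) (c - b)"
  "lifts_to f c \<Longrightarrow> lifts_to g b \<Longrightarrow> lifts_to (f * g) (c * b)"
  "lifts_to (to_F a) (ev q a)"
proof -
  show "lifts_to (const_F b) b" "lifts_to (to_F a) (ev q a)"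
    using q_pos by (auto simp: lifts_to_def const_F_def ev_simps)
  show "lifts_to 0 0" "lifts_to 1 1" "lifts_to qF (complex_of_real q)"
    "lifts_to (inverse qF) (inverse (complex_of_real q))"
    using q_pos unfolding lifts_to_def
    by (metis to_F_hom(1) ev_simps(1), metis to_F_hom(2) ev_simps(2), metis qF_def ev_simps(8),
        metis inverse_qF ev_simps(9))
  show "lifts_to f c \<Longrightarrow> lifts_to g b \<Longrightarrow> lifts_to (f + g) (c + b)"
    "lifts_to f c \<Longrightarrow> lifts_to g b \<Longrightarrow> lifts_to (f - g) (c - b)"
    "lifts_to f c \<Longrightarrow> lifts_to g b \<Longrightarrow> lifts_to (f * g) (c * b)"
    using q_pos unfolding lifts_to_def
    by (metis to_F_hom(3) ev_simps(3), metis to_F_hom(4) ev_simps(4), metis to_F_hom(6) ev_simps(6))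
qed

lemma lifts_to_power: "lifts_to f c \<Longrightarrow> lifts_to (f ^ n) (c ^ n)"
  by (induction n) (auto intro: lifts_to_simps)

abbreviation "qC \<equiv> complex_of_real q"

lemma qC: "qC \<noteq> 0" "qC = 1 \<or> qC - inverse qC \<noteq> 0"
proof -
  show "qC \<noteq> 0" using q_pos by simp
  show "qC = 1 \<or> qC - inverse qC \<noteq> 0"
  proof (rule disjCI)
    assume "\<not> qC - inverse qC \<noteq> 0"
    then have "qC * qC = 1" using q_pos by (simp add: field_simps)
    then have "(qC - 1) * (qC + 1) = 0" by (simp add: algebra_simps)
    moreover have "Re (qC + 1) \<noteq> 0" using q_pos by simp
    then have "qC + 1 \<noteq> 0" by (metis zero_complex.simps(1))
    ultimately show "qC = 1" by simp
  qed
qed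

lemma lifts_qpow: "lifts_to (qpow qF m) (qpow qC m)"
  unfolding qpow_def power_int_def by (auto intro: lifts_to_power lifts_to_simps)

lemma lifts_qnum: "lifts_to (qnum qF m) (qnum qC m)"
proof (induction m rule: int_induct[where k = 0])
  case base
  then show ?case using qnum_rec(1)[OF qF_nonzero] qnum_rec(1)[OF qC] qF_generic
    by (simp add: lifts_to_simps)
next
  case (step1 i)
  then show ?case
    using qnum_rec(2)[OF qF_nonzero, of i] qnum_rec(2)[OF qC, of i] qF_generic
    by (simp add: power2_eq_square lifts_to_simps)
next
  case (step2 i)
  have "qnum qF (i - 1) = inverse qF * inverse qF * (qnum qF i - qF)"
    using qnum_rec(2)[OF qF_nonzero, of "i - 1"] qF_generic qF_nonzero
    by (simp add: power2_eq_square field_simps)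
  moreover have "qnum qC (i - 1) = inverse qC * inverse qC * (qnum qC i - qC)"
    using qnum_rec(2)[OF qC, of "i - 1"] qC(1) by (simp add: power2_eq_square field_simps)
  ultimately show ?case using step2 by (simp add: lifts_to_simps)
qed

text \<open>An operator over \<open>\<bbbF>\<close> that preserves \<open>\<bbbA>\<close>-valued functions and induces the given operator over \<open>\<complex>\<close> on values at
  \<open>q\<close>. Stated for functions instead of matrix entries, this is visibly stable under composition.\<close>

definition specializes_to :: "analytic_fun fract diff_op \<Rightarrow> complex diff_op \<Rightarrow> bool" where
  "specializes_to S T \<longleftrightarrow> (\<forall>\<phi>. \<exists>\<psi>. app S (\<lambda>j m. to_F (\<phi> j m)) = (\<lambda>j m. to_F (\<psi> j m)) \<and>
     (\<lambda>j m. ev q (\<psi> j m)) = app T (\<lambda>j m. ev q (\<phi> j m)))"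

lemma specializes_toI:
  assumes "\<And>\<phi> j m. lifts_to (app S (\<lambda>j m. to_F (\<phi> j m)) j m) (app T (\<lambda>j m. ev q (\<phi> j m)) j m)"
  shows "specializes_to S T"
  unfolding specializes_to_def
proof
  fix \<phi>
  have "\<forall>j m. \<exists>a. app S (\<lambda>j m. to_F (\<phi> j m)) j m = to_F a \<and> ev q a = app T (\<lambda>j m. ev q (\<phi> j m)) j m"
    using assms[of \<phi>] unfolding lifts_to_def by blast
  then obtain \<psi> where "\<forall>j m. app S (\<lambda>j m. to_F (\<phi> j m)) j m = to_F (\<psi> j m) \<and>
      ev q (\<psi> j m) = app T (\<lambda>j m. ev q (\<phi> j m)) j m"
    by metis
  then show "\<exists>\<psi>. app S (\<lambda>j m. to_F (\<phi> j m)) = (\<lambda>j m. to_F (\<psi> j m)) \<and>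
     (\<lambda>j m. ev q (\<psi> j m)) = app T (\<lambda>j m. ev q (\<phi> j m))"
    by (intro exI[of _ \<psi>]) (simp add: fun_eq_iff)
qed

lemma specializes_toD:
  assumes "specializes_to S T"
  shows "lifts_to (app S (\<lambda>j m. to_F (\<phi> j m)) j m) (app T (\<lambda>j m. ev q (\<phi> j m)) j m)"
proof -
  obtain \<psi> where "app S (\<lambda>j m. to_F (\<phi> j m)) = (\<lambda>j m. to_F (\<psi> j m))"
     "(\<lambda>j m. ev q (\<psi> j m)) = app T (\<lambda>j m. ev q (\<phi> j m))"
    using assms unfolding specializes_to_def by blast
  then show ?thesis unfolding lifts_to_def by (metis (mono_tags))
qed

lemma specializes_to_simps:
  "specializes_to 0 0" "specializes_to 1 1"
  "specializes_to S T \<Longrightarrow> specializes_to S' T' \<Longrightarrow> specializes_to (S + S') (T + T')"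
  "specializes_to S T \<Longrightarrow> specializes_to S' T' \<Longrightarrow> specializes_to (S - S') (T - T')"
  "specializes_to S T \<Longrightarrow> specializes_to S' T' \<Longrightarrow> specializes_to (S * S') (T * T')"
  "(\<And>m. lifts_to (c m) (c' m)) \<Longrightarrow> specializes_to (diag c) (diag c')"
  "specializes_to (shift s) (shift s)" "specializes_to casimir_shift casimir_shift"
proof -
  assume a: "specializes_to S T" "specializes_to S' T'"
  show "specializes_to (S * S') (T * T')"
    unfolding specializes_to_def app_simps
  proof
    fix \<phi>
    obtain \<psi> where \<psi>: "app S' (\<lambda>j m. to_F (\<phi> j m)) = (\<lambda>j m. to_F (\<psi> j m))"
       "(\<lambda>j m. ev q (\<psi> j m)) = app T' (\<lambda>j m. ev q (\<phi> j m))"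
      using a(2) unfolding specializes_to_def by blast
    show "\<exists>\<psi>. app S (app S' (\<lambda>j m. to_F (\<phi> j m))) = (\<lambda>j m. to_F (\<psi> j m)) \<and>
       (\<lambda>j m. ev q (\<psi> j m)) = app T (app T' (\<lambda>j m. ev q (\<phi> j m)))"
      using a(1) unfolding specializes_to_def \<psi>(1) \<psi>(2)[symmetric] by blast
  qed
next
  show "specializes_to 1 1" by (rule specializes_toI) (simp add: app_simps lifts_to_simps)
qed (rule specializes_toI, simp add: op_simps lifts_to_simps specializes_toD)+

lemma specializes_to_uminus: "specializes_to S T \<Longrightarrow> specializes_to (- S) (- T)"
  using specializes_to_simps(4)[OF specializes_to_simps(1), of S T] by simp

lemma specializes_to_gens:
  "specializes_to (op_x qF) (op_x qC)" "specializes_to (op_y qF) (op_y qC)"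
  "specializes_to op_z op_z" "specializes_to (op_theta qF) (op_theta qC)"
  "specializes_to (op_X qF) (op_X qC)" "specializes_to (op_Y qF) (op_Y qC)"
  "specializes_to (op_Z qF) (op_Z qC)"
  unfolding op_X_def op_Y_def op_Z_def op_x_def op_y_def op_z_def op_theta_def
  by (intro specializes_to_simps lifts_to_simps lifts_qpow lifts_qnum)+

abbreviation "\<rho>F \<equiv> op_rep (gen_op qF)"

interpretation RF: substitution scalar_op "gen_op qF" by (rule op_substitution)

lemma rhoF_gens: "\<rho>F xF = op_x qF" "\<rho>F yF = op_y qF" "\<rho>F zF = op_z" "\<rho>F (letter gTheta) = op_theta qF"
proof -
  have "scalar_op (inverse dF) * (scalar_op dF * T) = T" for T
    using qF_generic by (intro diff_op_eqI) (simp add: op_simps dF_def)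
  then show "\<rho>F xF = op_x qF" "\<rho>F yF = op_y qF" "\<rho>F zF = op_z" "\<rho>F (letter gTheta) = op_theta qF"
    by (simp_all add: xF_def yF_def zF_def RF.subst_simps op_X_def op_Y_def op_Z_def flip: dF_def)
qed

lemma rhoF_cong: "p - r \<in> UF.rels \<Longrightarrow> \<rho>F p = \<rho>F r"
  using op_rep_relations[OF qF_nonzero qF_generic, of "p - r"] by (simp add: RF.subst_simps)

lemma integral_specializes: "p \<in> integral_elems \<Longrightarrow> \<exists>T. specializes_to (\<rho>F p) T"
proof (induction rule: integral_induct)
  case (cong p r)
  then show ?case using rhoF_cong by metis
next
  case (scal a p)
  then obtain T where "specializes_to (\<rho>F p) T" by blast
  then have "specializes_to (\<rho>F (scal (to_F a) * p)) (scalar_op (ev q a) * T)"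
    unfolding RF.subst_simps by (intro specializes_to_simps lifts_to_simps)
  then show ?case by blast
qed (use specializes_to_gens in \<open>auto simp: RF.subst_simps rhoF_gens
  intro: specializes_to_simps specializes_to_uminus lifts_to_simps\<close>)

text \<open>A matrix coefficient of an element of \<open>U\<^sub>\<bbbA>\<close>, evaluated at \<open>q\<close>, is a semilinear functional on \<open>U\<^sub>\<bbbA>\<close>, so it
  vanishes on elements \<open>u\<close> with \<open>1 \<otimes> u = 0\<close>. Every complex-valued function is the value at \<open>q\<close> of an \<open>\<bbbA>\<close>-valued
  one, namely of the constants, hence the whole operator vanishes at \<open>q\<close>.\<close>

lemma kills_imp_zero:
  assumes r: "r \<in> kills" and T: "specializes_to (\<rho>F r) T"
  shows "T = 0"
proof (rule diff_op_eqI)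
  fix f :: "nat \<Rightarrow> int \<Rightarrow> complex" and j m
  define \<phi> where "\<phi> j m = const_afun (f j m)" for j m
  define coef where "coef p = app (\<rho>F p) (\<lambda>j m. to_F (\<phi> j m)) j m" for p
  have coef_add: "coef (p + p') = coef p + coef p'" for p p'
    by (simp add: coef_def RF.subst_simps op_simps)
  have coef_scal: "coef (scal a * p) = a * coef p" for a p
    by (simp add: coef_def RF.subst_simps op_simps)
  have coef_lift: "\<exists>c. lifts_to (coef p) c" if "p \<in> integral_elems" for p
    using integral_specializes[OF that] specializes_toD unfolding coef_def by blast
  \<comment> \<open>the matrix coefficient depends only on the class of \<open>p\<close> because the relations act by zero\<close>
  define F where "F u = (THE c. \<exists>p. u = UF.cls p \<and> lifts_to (coef p) c)" for u
  have F: "F (UF.cls p) = c" if "lifts_to (coef p) c" for p c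
    unfolding F_def
  proof (rule the_equality)
    show "\<exists>p'. UF.cls p = UF.cls p' \<and> lifts_to (coef p') c" using that by blast
    fix c' assume "\<exists>p'. UF.cls p = UF.cls p' \<and> lifts_to (coef p') c'"
    then obtain p' where p': "UF.cls p = UF.cls p'" "lifts_to (coef p') c'" by blast
    then have "coef p' = coef p"
      using UF.cls_eq_iff[of p p'] rhoF_cong[of p p'] by (simp add: coef_def)
    then show "c' = c" using p'(2) that by (auto simp: lifts_to_def)
  qed
  have "F (UF.cls r) = 0"
  proof (rule E.functional_vanishes)
    fix u w a assume "u \<in> carrier UA" "w \<in> carrier UA"
    then obtain p p' where p: "p \<in> integral_elems" "u = UF.cls p" "p' \<in> integral_elems" "w = UF.cls p'"
      using UA_cls by blast
    obtain c c' where "lifts_to (coef p) c" "lifts_to (coef p') c'"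
      using coef_lift p by metis
    then show "F (u \<oplus>\<^bsub>UA\<^esub> w) = F u + F w"
      using F[of p c] F[of p' c'] F[of "p + p'" "c + c'"] p
      by (simp add: UA_fields UFA_cls_simps coef_add lifts_to_simps)
  next
    fix u a assume "u \<in> carrier UA"
    then obtain p where p: "p \<in> integral_elems" "u = UF.cls p"
      using UA_cls by blast
    obtain c where "lifts_to (coef p) c"
      using coef_lift p by metis
    then show "F (a \<odot>\<^bsub>UA\<^esub> u) = ev q a * F u"
      using F[of p c] F[of "scal (to_F a) * p" "ev q a * c"] p
      by (simp add: UA_fields UFA_cls_simps coef_scal lifts_to_simps)
  qed (use r in \<open>auto simp: kills_def integral_elems_def tau_def spec_eq\<close>)
  moreover have "lifts_to (coef r) (app T f j m)"
    using specializes_toD[OF T, of \<phi> j m] q_pos by (simp add: coef_def \<phi>_def ev_simps)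
  ultimately show "app T f j m = app 0 f j m" using F by (simp add: app_simps)
qed

lemma const_subst_specializes:
  assumes "\<And>s. s \<in> S \<Longrightarrow> specializes_to (\<rho>F (v s)) (o' s)" "p \<in> carrier (free_algebra S)"
  shows "specializes_to (\<rho>F (const_subst v p)) (op_rep o' p)"
proof -
  have prod: "specializes_to (\<rho>F (prod_list (map v w))) (prod_list (map o' w))" if "w \<in> lists S" for w
    using that by (induction w) (auto simp: RF.subst_simps assms(1) intro: specializes_to_simps)
  have "specializes_to (\<Sum>w\<in>W. \<rho>F (scal (const_F (Poly_Mapping.lookup p w)) * prod_list (map v w)))
     (\<Sum>w\<in>W. scalar_op (Poly_Mapping.lookup p w) * prod_list (map o' w))" if "W \<subseteq> lists S" for W
    using that
  proof (induction W rule: infinite_finite_induct)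
    case (insert w W)
    then have "specializes_to (\<rho>F (scal (const_F (Poly_Mapping.lookup p w)) * prod_list (map v w)))
       (scalar_op (Poly_Mapping.lookup p w) * prod_list (map o' w))"
      unfolding RF.subst_simps by (intro specializes_to_simps lifts_to_simps prod) auto
    with insert show ?case by (simp add: specializes_to_simps)
  qed (simp_all add: specializes_to_simps)
  moreover have "Poly_Mapping.keys p \<subseteq> lists S" using assms(2) by (simp add: free_algebra_simps)
  ultimately have "specializes_to (\<Sum>w\<in>Poly_Mapping.keys p. \<rho>F (scal (const_F (Poly_Mapping.lookup p w)) * prod_list (map v w)))
     (\<Sum>w\<in>Poly_Mapping.keys p. scalar_op (Poly_Mapping.lookup p w) * prod_list (map o' w))" by blast
  then show ?thesis by (simp only: subst_hom_def[of _ v] subst_hom_def[of scalar_op o'] RF.subst_sum)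
qed

end

section \<open>Independence of normal words\<close>

lemma monom_functions_independent:
  fixes x :: "'b \<Rightarrow> 'k::field"
  assumes B: "finite B" and f: "inj_on f B" and x: "infinite (range x)"
    and 0: "\<And>n. (\<Sum>a\<in>B. c a * x n ^ f a) = 0" and a: "a \<in> B"
  shows "c a = 0"
proof -
  define p where "p = (\<Sum>a\<in>B. Polynomial.monom (c a) (f a))"
  have "poly p (x n) = 0" for n using 0[of n] by (simp add: p_def poly_sum poly_monom)
  then have "range x \<subseteq> {y. poly p y = 0}" by auto
  then have "p = 0" using x poly_roots_finite[of p] finite_subset by blast
  moreover have "Polynomial.coeff p (f a) = (\<Sum>b\<in>B. if b = a then c b else 0)"
    unfolding p_def Polynomial.coeff_sum by (intro sum.cong) (use f a in \<open>auto simp: inj_on_def\<close>)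
  ultimately show ?thesis using B a by simp
qed

text \<open>The word \<open>W a i k\<close> acts as \<open>A\<^sub>a Z\<^sup>i T\<^sup>k\<close>. Here \<open>T\<close> contains the shift of \<open>j\<close> exactly once, \<open>Z\<close> raises the weight by
  one, and \<open>A\<^sub>a\<close> is triangular for the weight, with the diagonal entries \<open>ch a n\<close>.\<close>

locale normal_words =
  fixes W :: "'a \<Rightarrow> nat \<Rightarrow> nat \<Rightarrow> 's list" and act :: "'s \<Rightarrow> 'k::field diff_op"
    and A :: "'a \<Rightarrow> 'k diff_op" and Z T :: "'k diff_op"
    and ch :: "'a \<Rightarrow> int \<Rightarrow> 'k" and \<kappa> :: 'k and \<alpha> \<beta> :: "int \<Rightarrow> 'k"
  assumes W_inj: "W a i k = W b j l \<Longrightarrow> a = b \<and> i = j \<and> k = l"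
    and W_act: "prod_list (map act (W a i k)) = A a * Z ^ i * T ^ k"
    and A_low: "(\<And>m. m < n \<Longrightarrow> g j m = 0) \<Longrightarrow> m < n \<Longrightarrow> app (A a) g j m = 0"
    and A_lead: "(\<And>m. m < n \<Longrightarrow> g j m = 0) \<Longrightarrow> app (A a) g j n = ch a n * g j n"
    and Z_act: "app Z g j m = \<kappa> * g j (m - 1)" and \<kappa>: "\<kappa> \<noteq> 0"
    and T_act: "app T g j m = g (Suc j) (m + 1) + \<alpha> m * g j (m + 1) + \<beta> m * g j (m - 1)"
    and ch_independent: "finite B \<Longrightarrow> (\<And>n. (\<Sum>a\<in>B. c a * ch a n) = 0) \<Longrightarrow> a \<in> B \<Longrightarrow> c a = 0"
begin

lemma Z_power: "app (Z ^ i) g j m = \<kappa> ^ i * g j (m - int i)"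
  by (induction i arbitrary: m) (simp_all add: app_simps Z_act algebra_simps)

text \<open>On a function supported in \<open>j \<ge> J\<close>, the power \<open>T\<^sup>k\<close> reaches \<open>j = 0\<close> only if \<open>k \<ge> J\<close>, and for \<open>k = J\<close> only
  through the pure shift.\<close>

lemma T_power:
  assumes "\<And>j m. j < J \<Longrightarrow> g j m = 0"
  shows "j + k \<le> J \<Longrightarrow> app (T ^ k) g j m = (if j + k = J then g J (m + int k) else 0)"
proof (induction k arbitrary: j m)
  case 0
  then show ?case using assms by (auto simp: app_simps)
next
  case (Suc k)
  then show ?case by (auto simp: app_simps T_act algebra_simps)
qed

lemma A_slice_zero: "(\<And>m. g j m = 0) \<Longrightarrow> app (A a) g j m = 0"
  by (rule A_low[where n = "m + 1"]) auto

text \<open>Let \<open>K\<close> be the largest exponent of \<open>T\<close> that occurs, and \<open>i0\<close> the smallest exponent of \<open>Z\<close> that occurs together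
  with it. Apply the operator to a delta function at \<open>j = K\<close> and read off the value at \<open>j = 0\<close> and at the
  lowest weight that \<open>Z\<^sup>i\<^sup>0\<close> can produce: only words with \<open>k = K\<close> and \<open>i = i0\<close> contribute, each by its diagonal
  entry. Varying the weight gives a linear relation between the functions \<open>ch a\<close>.\<close>

theorem independent:
  assumes p: "Poly_Mapping.keys p \<subseteq> {W a i k | a i k. True}" and 0: "op_rep act p = 0"
  shows "p = 0"
proof (rule ccontr)
  interpret R: substitution scalar_op act by (rule op_substitution)
  assume "p \<noteq> 0"
  define I where "I = {(a, i, k). W a i k \<in> Poly_Mapping.keys p}"
  let ?W = "\<lambda>(a, i, k). W a i k"
  have inj: "inj ?W" by (rule injI) (auto dest: W_inj)
  have img: "?W ` I = Poly_Mapping.keys p" using p by (force simp: I_def)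
  have fin: "finite I"
    using finite_imageD[of ?W I] inj img by (metis finite_keys inj_on_subset subset_UNIV)
  have ne: "I \<noteq> {}" using img \<open>p \<noteq> 0\<close> by (metis image_empty keys_eq_empty)
  define K where "K = Max ((\<lambda>(a, i, k). k) ` I)"
  have K: "k \<le> K" if "(a, i, k) \<in> I" for a i k
    unfolding K_def using fin that by (intro Max_ge) force+
  have "K \<in> (\<lambda>(a, i, k). k) ` I" unfolding K_def using fin ne by (intro Max_in) auto
  then have K_in: "\<exists>a i. (a, i, K) \<in> I" by force
  define i0 where "i0 = (LEAST i. \<exists>a. (a, i, K) \<in> I)"
  have "\<exists>a. (a, i0, K) \<in> I" unfolding i0_def by (rule LeastI_ex) (use K_in in blast)
  then obtain a0 where a0: "(a0, i0, K) \<in> I" by blast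
  have i0: "i0 \<le> i" if "(a, i, K) \<in> I" for a i
    unfolding i0_def by (rule Least_le) (use that in blast)
  define B where "B = {a. (a, i0, K) \<in> I}"
  define c where "c a i k = Poly_Mapping.lookup p (W a i k)" for a i k
  have finB: "finite B"
    by (rule finite_subset[OF _ finite_imageI[OF fin, of fst]]) (force simp: B_def)
  have "(\<Sum>a\<in>B. c a i0 K * ch a n) = 0" for n
  proof -
    define g :: "nat \<Rightarrow> int \<Rightarrow> 'k" where
      "g j m = (if j = K \<and> m = n - int i0 + int K then 1 else 0)" for j m
    have TK: "app (T ^ k) g 0 m = (if k = K \<and> m = n - int i0 then 1 else 0)" if "k \<le> K" for k m
      using T_power[of K g 0 k m] that by (auto simp: g_def)
    have word: "app (A a * Z ^ i * T ^ k) g 0 n = (if k = K \<and> i = i0 then ch a n * \<kappa> ^ i0 else 0)"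
      if ik: "(a, i, k) \<in> I" for a i k
    proof -
      define f where "f = app (Z ^ i) (app (T ^ k) g)"
      have f: "f 0 m = (if k = K \<and> m = n - int i0 + int i then \<kappa> ^ i else 0)" for m
        using TK[OF K[OF ik]] by (auto simp: f_def Z_power)
      have "app (A a) f 0 n = (if k = K \<and> i = i0 then ch a n * \<kappa> ^ i0 else 0)"
      proof (cases "k = K")
        case False
        then show ?thesis using A_slice_zero[of f 0 a n] f by simp
      next
        case True
        with i0 ik have "i0 \<le> i" by blast
        show ?thesis
        proof (cases "i = i0")
          case True
          then show ?thesis using A_lead[of n f 0 a] f \<open>k = K\<close> by auto
        next
          case False
          then have "n < n - int i0 + int i" using \<open>i0 \<le> i\<close> by simp
          then show ?thesis using A_low[of "n - int i0 + int i" f 0 n a] f False by auto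
        qed
      qed
      then show ?thesis by (simp add: app_simps f_def)
    qed
    have sum: "app (\<Sum>x\<in>X. F x) g 0 n = (\<Sum>x\<in>X. app (F x) g 0 n)" for X and F :: "'x \<Rightarrow> 'k diff_op"
      by (induction X rule: infinite_finite_induct) (simp_all add: app_simps)
    have "0 = app (op_rep act p) g 0 n" by (simp add: 0 app_simps)
    also have "op_rep act p = (\<Sum>w\<in>?W ` I. scalar_op (Poly_Mapping.lookup p w) * prod_list (map act w))"
      by (simp add: subst_hom_def img)
    also have "\<dots> = (\<Sum>x\<in>I. scalar_op (Poly_Mapping.lookup p (?W x)) * prod_list (map act (?W x)))"
      by (rule sum.reindex_cong[where l = ?W]) (use inj in \<open>auto intro: inj_on_subset\<close>)
    also have "\<dots> = (\<Sum>(a, i, k)\<in>I. scalar_op (c a i k) * (A a * Z ^ i * T ^ k))"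
      by (intro sum.cong) (auto simp: W_act c_def)
    also have "app \<dots> g 0 n = (\<Sum>x\<in>I. case x of (a, i, k) \<Rightarrow>
        (if k = K \<and> i = i0 then c a i0 K * ch a n * \<kappa> ^ i0 else 0))"
      unfolding sum by (intro sum.cong refl) (auto simp: op_simps word[unfolded app_simps] split: prod.splits)
    also have "\<dots> = (\<Sum>x\<in>(\<lambda>a. (a, i0, K)) ` B. case x of (a, i, k) \<Rightarrow> c a i0 K * ch a n * \<kappa> ^ i0)"
      by (rule sum.mono_neutral_cong_right) (use fin in \<open>auto simp: B_def split: if_splits\<close>)
    also have "\<dots> = (\<Sum>a\<in>B. c a i0 K * ch a n) * \<kappa> ^ i0"
      by (subst sum.reindex) (auto simp: inj_on_def sum_distrib_right)
    finally show ?thesis using \<kappa> by simp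
  qed
  from ch_independent[OF finB this, of a0] a0 have "c a0 i0 K = 0" by (simp add: B_def)
  with a0 show False by (simp add: I_def c_def in_keys_iff)
qed

end

section \<open>Spanning by normal words\<close>

abbreviation word :: "'s list \<Rightarrow> ('s list \<Rightarrow>\<^sub>0 'k::comm_ring_1)" where
  "word w \<equiv> Poly_Mapping.single w 1"

lemma word_mult: "word v * word w = word (v @ w)"
  by (simp add: mult_single plus_list_def)

lemma word_Nil: "word [] = 1"
  by (simp flip: single_one zero_list_def)

lemma letter_mult_word: "letter s * word w = word (s # w)"
  by (simp add: letter_def word_mult)

lemma word_Cons: "word (s # w) = letter s * word w"
  by (simp add: letter_mult_word)

lemma single_scal: "Poly_Mapping.single w c = scal c * word w"
  by (simp add: scal_def mult_single plus_list_def)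

context presentation
begin

definition span_words :: "'s list set \<Rightarrow> ('s list \<Rightarrow>\<^sub>0 'k) set" where
  "span_words Ws = {p. \<exists>r. Poly_Mapping.keys r \<subseteq> Ws \<and> p - r \<in> rels}"

lemma span_rels: "p \<in> rels \<Longrightarrow> p \<in> span_words Ws"
  unfolding span_words_def by (intro CollectI exI[of _ 0]) auto

lemma span_add: "p \<in> span_words Ws \<Longrightarrow> r \<in> span_words Ws \<Longrightarrow> p + r \<in> span_words Ws"
proof -
  assume "p \<in> span_words Ws" "r \<in> span_words Ws"
  then obtain p' r' where a: "Poly_Mapping.keys p' \<subseteq> Ws" "p - p' \<in> rels"
    "Poly_Mapping.keys r' \<subseteq> Ws" "r - r' \<in> rels" unfolding span_words_def by blast
  have "p + r - (p' + r') = (p - p') + (r - r')" by simp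
  also have "\<dots> \<in> rels" using a by (intro rels_add)
  finally show ?thesis unfolding span_words_def using a keys_add[of p' r'] by blast
qed

lemma span_scal: "p \<in> span_words Ws \<Longrightarrow> scal c * p \<in> span_words Ws"
proof -
  assume "p \<in> span_words Ws"
  then obtain p' where a: "Poly_Mapping.keys p' \<subseteq> Ws" "p - p' \<in> rels" unfolding span_words_def by blast
  have "scal c * p - scal c * p' = scal c * (p - p')" by (simp add: right_diff_distrib)
  also have "\<dots> \<in> rels" using a by (intro rels_mult free_algebra_consts)
  finally have b: "scal c * p - scal c * p' \<in> rels" .
  have "Poly_Mapping.keys (scal c * p') \<subseteq> Poly_Mapping.keys p'"
  proof -
    have "scal c * p' = (\<Sum>k\<in>Poly_Mapping.keys p'. Poly_Mapping.single k (c * Poly_Mapping.lookup p' k))"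
      by (subst poly_mapping_sum_singles[of p'])
        (simp add: sum_distrib_left scal_def mult_single plus_list_def)
    then show ?thesis
      using Poly_Mapping.keys_sum[of "\<lambda>k. Poly_Mapping.single k (c * Poly_Mapping.lookup p' k)" "Poly_Mapping.keys p'"]
      by (auto split: if_splits)
  qed
  with a b show ?thesis unfolding span_words_def by blast
qed

lemma span_uminus: "p \<in> span_words Ws \<Longrightarrow> - p \<in> span_words Ws"
  using span_scal[of p Ws "- 1"] by (simp add: scal_hom)

lemma span_diff: "p \<in> span_words Ws \<Longrightarrow> r \<in> span_words Ws \<Longrightarrow> p - r \<in> span_words Ws"
  using span_add[of p Ws "- r"] span_uminus[of r Ws] by simp

lemma span_word: "w \<in> Ws \<Longrightarrow> word w \<in> span_words Ws"
  unfolding span_words_def by (intro CollectI exI[of _ "word w"]) (auto simp: rels_zero)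

lemma span_induct [consumes 1, case_names rels word add scal]:
  assumes "p \<in> span_words Ws" and "\<And>p. p \<in> rels \<Longrightarrow> Q p" and "\<And>w. w \<in> Ws \<Longrightarrow> Q (word w)"
    and add: "\<And>p r. Q p \<Longrightarrow> Q r \<Longrightarrow> Q (p + r)" and scal: "\<And>p c. Q p \<Longrightarrow> Q (scal c * p)"
  shows "Q p"
proof -
  obtain r where r: "Poly_Mapping.keys r \<subseteq> Ws" "p - r \<in> rels" using assms(1) unfolding span_words_def by blast
  have "Q (\<Sum>k\<in>K. Poly_Mapping.single k (Poly_Mapping.lookup r k))" if "K \<subseteq> Ws" for K
    using that
  proof (induction K rule: infinite_finite_induct)
    case (insert k K)
    then show ?case using add scal assms(3) single_scal[of k "Poly_Mapping.lookup r k"] by simp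
  qed (use assms(2) rels_zero in auto)
  from this[OF r(1)] have "Q r" by (simp flip: poly_mapping_sum_singles)
  from add[OF assms(2)[OF r(2)] this] show ?thesis by simp
qed

lemma span_map_left:
  assumes p: "p \<in> span_words Ws" and r: "r \<in> carrier free" and w: "\<And>w. w \<in> Ws \<Longrightarrow> r * word w \<in> span_words Ws'"
  shows "r * p \<in> span_words Ws'"
  using p
proof (induction rule: span_induct)
  case (scal p c)
  have "r * (scal c * p) = scal c * (r * p)" by (simp add: scal_comm[of c r] flip: mult.assoc)
  then show ?case using span_scal[OF scal] by simp
qed (simp_all add: span_rels rels_mult r w span_add distrib_left)

lemma span_map_right:
  assumes p: "p \<in> span_words Ws" and r: "r \<in> carrier free" and w: "\<And>w. w \<in> Ws \<Longrightarrow> word w * r \<in> span_words Ws'"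
  shows "p * r \<in> span_words Ws'"
  using p
  by (induction rule: span_induct)
    (simp_all add: span_rels rels_mult r w span_add distrib_right mult.assoc span_scal)

text \<open>Normal forms as in an Ore extension. The words \<open>Wb\<close> in the letters \<open>G\<close> span a subspace \<open>P\<close> stable under \<open>G\<close>, and
  the relations \<open>t g = \<sigma>(g) t + \<delta>(g)\<close> move \<open>t\<close> past the letters of \<open>G\<close>. Induction on words gives
  \<open>t P \<subseteq> P t + P\<close>, hence the sum of the \<open>P t\<^sup>k\<close> is a left ideal containing \<open>1\<close>.\<close>

theorem ore_spanning:
  assumes t: "t \<in> S" and G: "G \<subseteq> S" and Nil: "[] \<in> Wb" and Wb: "Wb \<subseteq> lists G"
    and stable: "\<And>g w. g \<in> G \<Longrightarrow> w \<in> Wb \<Longrightarrow> letter g * word w \<in> span_words Wb"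
    and move: "\<And>g. g \<in> G \<Longrightarrow> letter t * letter g - (\<sigma> g * letter t + \<delta> g) \<in> rels"
    and \<sigma>: "\<And>g. g \<in> G \<Longrightarrow> \<sigma> g \<in> carrier free"
      "\<And>g w. g \<in> G \<Longrightarrow> w \<in> Wb \<Longrightarrow> \<sigma> g * word w \<in> span_words Wb"
    and \<delta>: "\<And>g. g \<in> G \<Longrightarrow> \<delta> g \<in> carrier free"
      "\<And>g w. g \<in> G \<Longrightarrow> w \<in> Wb \<Longrightarrow> \<delta> g * word w \<in> span_words Wb"
    and letters: "\<And>s. s \<in> S \<Longrightarrow> letter s \<in> span_words ((\<lambda>g. [g]) ` insert t G)"
    and p: "p \<in> carrier free"
  shows "p \<in> span_words {w @ replicate k t | w k. w \<in> Wb}"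
proof -
  let ?Wf = "{w @ replicate k t | w k. w \<in> Wb}"
  have word_carrier: "word w \<in> carrier free" if "w \<in> lists S" for w
    using that by (auto simp: free_algebra_simps)
  have t_carrier: "letter t \<in> carrier free" by (rule letter_carrier[OF t])
  have base: "word w \<in> span_words Wb" if "w \<in> lists G" for w
    using that
  proof (induction w)
    case Nil
    then show ?case using span_word[OF assms(3)] by simp
  next
    case (Cons g w)
    then have g: "g \<in> G" and w: "w \<in> lists G" by auto
    have "letter g * word w \<in> span_words Wb"
      using span_map_left[OF Cons.IH letter_carrier stable[OF g]] g G by blast
    then show ?case by (simp add: letter_mult_word)
  qed
  have commute: "\<exists>u\<in>span_words Wb. \<exists>v\<in>span_words Wb. letter t * word w - (u * letter t + v) \<in> rels"
    if "w \<in> lists G" for w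
    using that
  proof (induction w)
    case Nil
    show ?case
      by (intro bexI[of _ "word []"] bexI[of _ 0])
        (use span_word[OF assms(3)] in \<open>auto simp: word_Nil rels_zero span_rels\<close>)
  next
    case (Cons g w)
    then have g: "g \<in> G" and w: "w \<in> lists G" by auto
    obtain u v where uv: "u \<in> span_words Wb" "v \<in> span_words Wb"
      "letter t * word w - (u * letter t + v) \<in> rels" using Cons.IH by blast
    have wc: "word w \<in> carrier free" using w G by (intro word_carrier) auto
    show ?case
    proof (intro bexI)
      have "letter t * word (g # w) - ((\<sigma> g * u) * letter t + (\<sigma> g * v + \<delta> g * word w)) =
        (letter t * letter g - (\<sigma> g * letter t + \<delta> g)) * word w
        + \<sigma> g * (letter t * word w - (u * letter t + v))"
        by (simp add: word_Cons algebra_simps)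
      also have "\<dots> \<in> rels"
        by (intro rels_add rels_mult move g uv wc \<sigma>)
      finally show "letter t * word (g # w) - ((\<sigma> g * u) * letter t + (\<sigma> g * v + \<delta> g * word w)) \<in> rels" .
      show "\<sigma> g * u \<in> span_words Wb"
        by (rule span_map_left[OF uv(1) \<sigma>(1)[OF g]]) (rule \<sigma>(2)[OF g])
      have "\<sigma> g * v \<in> span_words Wb"
        by (rule span_map_left[OF uv(2) \<sigma>(1)[OF g]]) (rule \<sigma>(2)[OF g])
      moreover have "\<delta> g * word w \<in> span_words Wb"
        by (rule span_map_left[OF base[OF w] \<delta>(1)[OF g]]) (rule \<delta>(2)[OF g])
      ultimately show "\<sigma> g * v + \<delta> g * word w \<in> span_words Wb" by (rule span_add)
    qed
  qed
  have lift: "u * word (replicate k t) \<in> span_words ?Wf" if "u \<in> span_words Wb" for u k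
  proof (rule span_map_right[OF that])
    show "word (replicate k t) \<in> carrier free" by (rule word_carrier) (use t in auto)
    show "word w * word (replicate k t) \<in> span_words ?Wf" if "w \<in> Wb" for w
      using that by (auto simp: word_mult intro!: span_word)
  qed
  have t_full: "letter t * word (w @ replicate k t) \<in> span_words ?Wf" if w: "w \<in> Wb" for w k
  proof -
    obtain u v where uv: "u \<in> span_words Wb" "v \<in> span_words Wb"
      "letter t * word w - (u * letter t + v) \<in> rels" using commute w Wb by blast
    have "letter t * word (w @ replicate k t) =
      (letter t * word w - (u * letter t + v)) * word (replicate k t)
      + (u * word (replicate (Suc k) t) + v * word (replicate k t))"
      by (simp add: algebra_simps word_Cons flip: word_mult)
    also have "\<dots> \<in> span_words ?Wf"
    proof (rule span_add)
      have "word (replicate k t) \<in> carrier free" by (rule word_carrier) (use t in auto)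
      then show "(letter t * word w - (u * letter t + v)) * word (replicate k t) \<in> span_words ?Wf"
        by (intro span_rels rels_mult uv)
      show "u * word (replicate (Suc k) t) + v * word (replicate k t) \<in> span_words ?Wf"
        by (rule span_add[OF lift[OF uv(1)] lift[OF uv(2)]])
    qed
    finally show ?thesis .
  qed
  have g_full: "letter g * word (w @ replicate k t) \<in> span_words ?Wf" if "g \<in> G" "w \<in> Wb" for g w k
    using lift[OF stable[OF that], of k] by (simp add: mult.assoc word_mult)
  have Wf_S: "v \<in> lists S" if "v \<in> ?Wf" for v
  proof -
    obtain w k where w: "v = w @ replicate k t" "w \<in> Wb" using \<open>v \<in> ?Wf\<close> by blast
    then have "w \<in> lists S" using Wb lists_mono[OF G] by blast
    then show ?thesis using w t by auto
  qed
  have letter_full: "letter s * word v \<in> span_words ?Wf" if s: "s \<in> S" and v: "v \<in> ?Wf" for s v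
  proof (rule span_map_right[OF letters[OF s] word_carrier[OF Wf_S[OF v]]])
    fix w assume "w \<in> (\<lambda>g. [g]) ` insert t G"
    then obtain g where "w = [g]" "g = t \<or> g \<in> G" by auto
    with v t_full g_full show "word w * word v \<in> span_words ?Wf"
      by (auto simp: letter_def[symmetric])
  qed
  have word_full: "word w \<in> span_words ?Wf" if "w \<in> lists S" for w
    using that
  proof (induction w)
    case Nil
    have "[] \<in> ?Wf" using assms(3) by (intro CollectI exI[of _ "[]"] exI[of _ 0]) simp
    then show ?case by (rule span_word)
  next
    case (Cons s w)
    then have s: "s \<in> S" and w: "w \<in> lists S" by auto
    have "letter s * word w \<in> span_words ?Wf"
      by (rule span_map_left[OF Cons.IH letter_carrier[OF s] letter_full[OF s]])
    then show ?case by (simp add: letter_mult_word)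
  qed
  have "(\<Sum>k\<in>K. Poly_Mapping.single k (Poly_Mapping.lookup p k)) \<in> span_words ?Wf" if "K \<subseteq> lists S" for K
    using that
  proof (induction K rule: infinite_finite_induct)
    case (insert k K)
    then have "k \<in> lists S" "(\<Sum>k\<in>K. Poly_Mapping.single k (Poly_Mapping.lookup p k)) \<in> span_words ?Wf"
      by blast+
    then show ?case
      unfolding sum.insert[OF insert(1,2)] single_scal[of k "Poly_Mapping.lookup p k"]
      by (intro span_add span_scal word_full)
  qed (auto intro: span_rels rels_zero)
  moreover have "Poly_Mapping.keys p \<subseteq> lists S" using p by (simp add: free_algebra_simps)
  ultimately have "(\<Sum>k\<in>Poly_Mapping.keys p. Poly_Mapping.single k (Poly_Mapping.lookup p k)) \<in> span_words ?Wf"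
    by blast
  then show ?thesis unfolding poly_mapping_sum_singles[symmetric] .
qed

end

section \<open>Normal words in \<open>U\<^sub>q(\<gg>)\<close>\<close>

lemma scal_left: "p * (scal c * r) = scal c * (p * (r :: 's list \<Rightarrow>\<^sub>0 'k::comm_ring_1))"
  by (metis mult.assoc scal_comm)

lemma scal_scal: "scal c * (scal d * p) = scal (c * d) * (p :: 's list \<Rightarrow>\<^sub>0 'k::comm_ring_1)"
  by (simp add: scal_hom mult.assoc)

lemmas scal_normalize = scal_left[of "letter s" for s] scal_left[of "word w" for w] scal_scal mult.assoc distrib_left distrib_right
  left_diff_distrib right_diff_distrib

text \<open>\<open>X\<^sup>a Z\<^sup>i\<close> for \<open>a \<ge> 0\<close> and \<open>Y\<^sup>-\<^sup>a Z\<^sup>i\<close> for \<open>a \<le> 0\<close>; since \<open>Y\<close> acts as \<open>X\<^sup>-\<^sup>1\<close> up to higher weights, a single integer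
  exponent is natural.\<close>

definition Uq_base :: "int \<Rightarrow> nat \<Rightarrow> gen list" where
  "Uq_base a i = (if a \<ge> 0 then replicate (nat a) gX else replicate (nat (- a)) gY) @ replicate i gZ"

definition base_words :: "gen list set" where "base_words = {Uq_base a i | a i. True}"

context
  fixes q :: "'k::field"
  assumes q: "q \<noteq> 0"
begin

interpretation P: presentation UNIV "Uq_relations q"
  by unfold_locales simp_all

abbreviation "X \<equiv> letter gX :: gen list \<Rightarrow>\<^sub>0 'k"
abbreviation "Y \<equiv> letter gY :: gen list \<Rightarrow>\<^sub>0 'k"
abbreviation "Z \<equiv> letter gZ :: gen list \<Rightarrow>\<^sub>0 'k"
abbreviation "\<Theta> \<equiv> letter gTheta :: gen list \<Rightarrow>\<^sub>0 'k"

lemma Uq_rels: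
  "X * Z - scal (q^2) * (Z * X) \<in> P.rels"
  "Z * Y - scal (q^2) * (Y * Z) \<in> P.rels"
  "X * Y + scal (q^2) * (Z * Z) - 1 \<in> P.rels"
  "Y * X + scal ((inverse q)^2) * (Z * Z) - 1 \<in> P.rels"
  "scal q * (X * \<Theta>) - scal (inverse q) * (\<Theta> * X) - scal (q + inverse q) * Z \<in> P.rels"
  "scal q * (\<Theta> * Y) - scal (inverse q) * (Y * \<Theta>) - scal (q + inverse q) * Z \<in> P.rels"
  "\<Theta> * Z - Z * \<Theta> - (Y - X) \<in> P.rels"
  by (rule P.rels_incl, simp add: Uq_relations_def Let_def free_algebra_mult free_algebra_simps(2-5)
      free_algebra_minus)+

lemma Z_past_power:
  assumes "Z * letter s - scal c * (letter s * Z) \<in> P.rels"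
  shows "\<exists>c. Z * word (replicate n s @ w) - scal c * word (replicate n s @ gZ # w) \<in> P.rels"
proof (induction n)
  case 0
  show ?case by (rule exI[of _ 1]) (simp add: letter_mult_word scal_hom P.rels_zero)
next
  case (Suc n)
  then obtain b where b: "Z * word (replicate n s @ w) - scal b * word (replicate n s @ gZ # w) \<in> P.rels"
    by blast
  have "Z * word (replicate (Suc n) s @ w) - scal (c * b) * word (replicate (Suc n) s @ gZ # w) =
    (Z * letter s - scal c * (letter s * Z)) * word (replicate n s @ w)
    + scal c * letter s * (Z * word (replicate n s @ w) - scal b * word (replicate n s @ gZ # w))"
    by (simp add: word_Cons scal_normalize)
  also have "\<dots> \<in> P.rels"
    by (intro P.rels_add P.rels_mult assms b) simp_all
  finally show ?case by blast
qed

lemma Z_past: "\<exists>c. Z * word (Uq_base a i) - scal c * word (Uq_base a (Suc i)) \<in> P.rels"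
proof -
  have "Z * X - scal (1 / q^2) * (X * Z) = scal (- (1 / q^2)) * (X * Z - scal (q^2) * (Z * X))"
    using q by (simp add: scal_normalize scal_hom)
  also have "\<dots> \<in> P.rels" by (intro P.rels_mult Uq_rels) simp
  finally show ?thesis
    using Z_past_power[of gX _ "nat a" "replicate i gZ"] Uq_rels(2)
      Z_past_power[of gY _ "nat (- a)" "replicate i gZ"]
    by (cases "a \<ge> 0") (auto simp: Uq_base_def)
qed

lemma base_span: "word (Uq_base a i) \<in> P.span_words base_words"
  by (rule P.span_word) (auto simp: base_words_def)

lemma Z_stable: "Z * word (Uq_base a i) \<in> P.span_words base_words"
proof -
  obtain c where "Z * word (Uq_base a i) - scal c * word (Uq_base a (Suc i)) \<in> P.rels" using Z_past by blast
  from P.span_add[OF P.span_rels[OF this] P.span_scal[OF base_span, of c a "Suc i"]] show ?thesis by simp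
qed

lemma Z_stable': "p \<in> P.span_words base_words \<Longrightarrow> Z * p \<in> P.span_words base_words"
  by (erule P.span_map_left) (auto simp: Z_stable base_words_def[THEN eqset_imp_iff])

text \<open>If the word begins with \<open>Y\<close>, then \<open>XY = 1 - q\<^sup>2Z\<^sup>2\<close> shortens it, at the cost of factors \<open>Z\<close> which commute past the
  other letters up to scalars.\<close>

lemma X_stable: "X * word (Uq_base a i) \<in> P.span_words base_words"
proof (cases "a \<ge> 0")
  case True
  then have "X * word (Uq_base a i) = word (Uq_base (a + 1) i)"
    by (simp add: Uq_base_def letter_mult_word nat_add_distrib)
  then show ?thesis using base_span by simp
next
  case False
  then have "nat (- a) = Suc (nat (- (a + 1)))" by simp
  then have b: "Uq_base a i = gY # Uq_base (a + 1) i" using False by (auto simp: Uq_base_def)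
  let ?w = "word (Uq_base (a + 1) i) :: gen list \<Rightarrow>\<^sub>0 'k"
  have "X * word (Uq_base a i) = (X * Y + scal (q^2) * (Z * Z) - 1) * ?w - scal (q^2) * (Z * (Z * ?w)) + ?w"
    by (simp add: b word_Cons scal_normalize)
  also have "\<dots> \<in> P.span_words base_words"
    by (intro P.span_add P.span_diff P.span_rels P.rels_mult Uq_rels P.span_scal Z_stable' base_span) simp
  finally show ?thesis .
qed

lemma Y_stable: "Y * word (Uq_base a i) \<in> P.span_words base_words"
proof (cases "a > 0")
  case False
  then have "nat (- (a - 1)) = Suc (nat (- a))" by simp
  then have "Uq_base (a - 1) i = gY # Uq_base a i" using False by (auto simp: Uq_base_def)
  then have "Y * word (Uq_base a i) = word (Uq_base (a - 1) i)" by (simp add: letter_mult_word)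
  then show ?thesis using base_span by simp
next
  case True
  then have "nat a = Suc (nat (a - 1))" by simp
  then have b: "Uq_base a i = gX # Uq_base (a - 1) i" using True by (auto simp: Uq_base_def)
  let ?w = "word (Uq_base (a - 1) i) :: gen list \<Rightarrow>\<^sub>0 'k"
  have "Y * word (Uq_base a i) =
     (Y * X + scal ((inverse q)^2) * (Z * Z) - 1) * ?w - scal ((inverse q)^2) * (Z * (Z * ?w)) + ?w"
    by (simp add: b word_Cons scal_normalize)
  also have "\<dots> \<in> P.span_words base_words"
    by (intro P.span_add P.span_diff P.span_rels P.rels_mult Uq_rels P.span_scal Z_stable' base_span) simp
  finally show ?thesis .
qed

lemma Theta_moves:
  "\<Theta> * X - (scal (q^2) * X * \<Theta> + scal (- (q * (q + inverse q))) * Z) \<in> P.rels"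
  "\<Theta> * Y - (scal ((inverse q)^2) * Y * \<Theta> + scal (inverse q * (q + inverse q)) * Z) \<in> P.rels"
  "\<Theta> * Z - (Z * \<Theta> + (Y - X)) \<in> P.rels"
proof -
  have "\<Theta> * X - (scal (q^2) * X * \<Theta> + scal (- (q * (q + inverse q))) * Z) =
    scal (- q) * (scal q * (X * \<Theta>) - scal (inverse q) * (\<Theta> * X) - scal (q + inverse q) * Z)"
    using q by (simp add: scal_normalize scal_hom(1-5) power2_eq_square)
  also have "\<dots> \<in> P.rels" by (intro P.rels_mult Uq_rels) simp
  finally show "\<Theta> * X - (scal (q^2) * X * \<Theta> + scal (- (q * (q + inverse q))) * Z) \<in> P.rels" .
  have "\<Theta> * Y - (scal ((inverse q)^2) * Y * \<Theta> + scal (inverse q * (q + inverse q)) * Z) =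
    scal (inverse q) * (scal q * (\<Theta> * Y) - scal (inverse q) * (Y * \<Theta>) - scal (q + inverse q) * Z)"
    using q by (simp add: scal_normalize scal_hom(1-5) power2_eq_square)
  also have "\<dots> \<in> P.rels" by (intro P.rels_mult Uq_rels) simp
  finally show "\<Theta> * Y - (scal ((inverse q)^2) * Y * \<Theta> + scal (inverse q * (q + inverse q)) * Z) \<in> P.rels" .
  show "\<Theta> * Z - (Z * \<Theta> + (Y - X)) \<in> P.rels" using Uq_rels(7) by (simp add: diff_diff_eq)
qed

theorem Uq_spanning: "p \<in> P.span_words {Uq_base a i @ replicate k gTheta | a i k. True}"
proof -
  define \<sigma> :: "gen \<Rightarrow> gen list \<Rightarrow>\<^sub>0 'k" where
    "\<sigma> g = (case g of gX \<Rightarrow> scal (q^2) * X | gY \<Rightarrow> scal ((inverse q)^2) * Y | _ \<Rightarrow> Z)" for g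
  define \<delta> :: "gen \<Rightarrow> gen list \<Rightarrow>\<^sub>0 'k" where
    "\<delta> g = (case g of gX \<Rightarrow> scal (- (q * (q + inverse q))) * Z
       | gY \<Rightarrow> scal (inverse q * (q + inverse q)) * Z | _ \<Rightarrow> Y - X)" for g
  have "p \<in> P.span_words {w @ replicate k gTheta | w k. w \<in> base_words}"
  proof (rule P.ore_spanning[where G = "{gX, gY, gZ}" and \<sigma> = \<sigma> and \<delta> = \<delta>])
    show "[] \<in> base_words" by (auto simp: base_words_def Uq_base_def intro!: exI[of _ 0])
    show "base_words \<subseteq> lists {gX, gY, gZ}" by (auto simp: base_words_def Uq_base_def split: if_splits)
    show "letter g * word w \<in> P.span_words base_words" if "g \<in> {gX, gY, gZ}" "w \<in> base_words" for g w
      using that by (auto simp: base_words_def[THEN eqset_imp_iff] X_stable Y_stable Z_stable)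
    show "\<Theta> * letter g - (\<sigma> g * \<Theta> + \<delta> g) \<in> P.rels" if "g \<in> {gX, gY, gZ}" for g
      using that Theta_moves by (auto simp: \<sigma>_def \<delta>_def)
    show "\<sigma> g * word w \<in> P.span_words base_words" if "g \<in> {gX, gY, gZ}" "w \<in> base_words" for g w
      using that by (auto simp: base_words_def[THEN eqset_imp_iff] \<sigma>_def X_stable Y_stable Z_stable mult.assoc P.span_scal)
    show "\<delta> g * word w \<in> P.span_words base_words" if "g \<in> {gX, gY, gZ}" "w \<in> base_words" for g w
      using that
      by (auto simp: base_words_def[THEN eqset_imp_iff] \<delta>_def X_stable Y_stable Z_stable mult.assoc left_diff_distrib P.span_scal P.span_diff)
    show "letter s \<in> P.span_words ((\<lambda>g. [g]) ` insert gTheta {gX, gY, gZ})" for s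
      unfolding letter_def by (rule P.span_word) (cases s; simp)
  qed simp_all
  moreover have "{w @ replicate k gTheta | w k. w \<in> base_words} = {Uq_base a i @ replicate k gTheta | a i k. True}"
    by (auto simp: base_words_def)
  ultimately show ?thesis by simp
qed

end

section \<open>Specialization away from 1\<close>

lemma count_list_replicate: "count_list (replicate n x) y = (if x = y then n else 0)"
  by (induction n) auto

lemma qpow_power: "q \<noteq> 0 \<Longrightarrow> qpow q (int n * m) = qpow q m ^ n"
  by (induction n) (simp_all add: qpow_simps distrib_right)

text \<open>Multiplied by \<open>q\<^sup>2\<^sup>N\<^sup>n\<close> for large \<open>N\<close>, a relation between the functions \<open>n \<mapsto> q\<^sup>2\<^sup>a\<^sup>n\<close> is a polynomial with
  infinitely many zeros.\<close>

lemma qpow_independent: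
  assumes q: "q \<noteq> (0::'k::field)" and inf: "infinite (range (qpow q))" and B: "finite B"
    and 0: "\<And>n. (\<Sum>a\<in>B. c a * qpow q (a * n)) = 0" and a: "a \<in> B"
  shows "c a = 0"
proof -
  obtain N :: nat where N: "\<And>a. a \<in> B \<Longrightarrow> - int N \<le> a"
  proof -
    have "\<forall>a\<in>B. - int (nat (\<bar>Min (insert 0 B)\<bar>)) \<le> a"
    proof
      fix a assume "a \<in> B"
      then have "Min (insert 0 B) \<le> a" using B by simp
      then show "- int (nat (\<bar>Min (insert 0 B)\<bar>)) \<le> a" by simp
    qed
    with that show ?thesis by blast
  qed
  show ?thesis
  proof (rule monom_functions_independent[OF B _ inf _ a])
    show "inj_on (\<lambda>a. nat (a + int N)) B"
    proof (rule inj_onI)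
      fix a b assume "a \<in> B" "b \<in> B" "nat (a + int N) = nat (b + int N)"
      with N[of a] N[of b] show "a = b" by linarith
    qed
    show "(\<Sum>a\<in>B. c a * qpow q n ^ nat (a + int N)) = 0" for n
    proof -
      have "(\<Sum>a\<in>B. c a * qpow q n ^ nat (a + int N)) = (\<Sum>a\<in>B. c a * qpow q (a * n)) * qpow q (int N * n)"
        unfolding sum_distrib_right
      proof (intro sum.cong refl)
        fix a assume "a \<in> B"
        then have "qpow q n ^ nat (a + int N) = qpow q ((a + int N) * n)"
          using N[of a] qpow_power[OF q, of "nat (a + int N)" n] by simp
        also have "\<dots> = qpow q (a * n) * qpow q (int N * n)"
          by (simp add: distrib_right qpow_simps(1)[OF q])
        finally show "c a * qpow q n ^ nat (a + int N) = c a * qpow q (a * n) * qpow q (int N * n)" by simp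
      qed
      then show ?thesis by (simp add: 0)
    qed
  qed
qed

definition power_op :: "'k::field \<Rightarrow> int \<Rightarrow> 'k diff_op" where
  "power_op q a = (if a \<ge> 0 then op_X q ^ nat a else op_Y q ^ nat (- a))"

context
  fixes q d :: "'k::field"
  assumes q: "q \<noteq> 0" and d_def: "d = q - inverse q" and d: "d \<noteq> 0"
    and inf: "infinite (range (qpow q))"
begin

lemma X_power: "app (op_X q ^ k) g j m = qpow q m ^ k * g j m"
  by (induction k) (simp_all add: app_simps app_X[OF q d_def d])

lemma Y_power_low: "(\<And>m. m < n \<Longrightarrow> g j m = 0) \<Longrightarrow> m < n \<Longrightarrow> app (op_Y q ^ k) g j m = 0"
  by (induction k arbitrary: m) (simp_all add: app_simps app_Y[OF q d_def d])

lemma Y_power_lead: "(\<And>m. m < n \<Longrightarrow> g j m = 0) \<Longrightarrow> app (op_Y q ^ k) g j n = qpow q (- n) ^ k * g j n"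
  by (induction k) (simp_all add: app_simps app_Y[OF q d_def d] Y_power_low[of n])

lemma Uq_normal_words:
  "normal_words (\<lambda>a i k. Uq_base a i @ replicate k gTheta) (gen_op q) (power_op q) (op_Z q) (op_theta q)
     (\<lambda>a n. qpow q (a * n)) d
     (\<lambda>m. - (inverse q * qpow q (- m) * (qpow q (m + 1) - 1) * (qpow q m - 1) / d^2))
     (\<lambda>m. q * qpow q (- m))"
proof
  fix a b :: int and i k j l :: nat
  assume eq: "Uq_base a i @ replicate k gTheta = Uq_base b j @ replicate l gTheta"
  have "count_list (Uq_base a i @ replicate k gTheta) g = count_list (Uq_base b j @ replicate l gTheta) g" for g
    by (simp only: eq)
  from this[of gX] this[of gY] this[of gZ] this[of gTheta]
  show "a = b \<and> i = j \<and> k = l"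
    by (auto simp: Uq_base_def count_list_append count_list_replicate split: if_splits)
next
  show "prod_list (map (gen_op q) (Uq_base a i @ replicate k gTheta)) = power_op q a * op_Z q ^ i * op_theta q ^ k"
    for a i k
    by (simp add: Uq_base_def power_op_def map_replicate prod_list_replicate mult.assoc)
  show "app (power_op q a) g j m = 0" if "\<And>m. m < n \<Longrightarrow> g j m = 0" "m < n" for n g j m a
    using that by (auto simp: power_op_def X_power Y_power_low[of n])
  show "app (power_op q a) g j n = qpow q (a * n) * g j n" if "\<And>m. m < n \<Longrightarrow> g j m = 0" for n g j a
    using Y_power_lead[of n g j "nat (- a)"] that qpow_power[OF q, of "nat a" n] qpow_power[OF q, of "nat (- a)" "- n"]
    by (auto simp: power_op_def X_power)
  show "app (op_theta q) g j m = g (Suc j) (m + 1) +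
       - (inverse q * qpow q (- m) * (qpow q (m + 1) - 1) * (qpow q m - 1) / d^2) * g j (m + 1) +
       q * qpow q (- m) * g j (m - 1)" for g j m
    by (simp add: app_theta[OF q d_def d])
  show "finite B \<Longrightarrow> (\<And>n. (\<Sum>a\<in>B. c a * qpow q (a * n)) = 0) \<Longrightarrow> a \<in> B \<Longrightarrow> c a = 0" for B c a
    by (rule qpow_independent[OF q inf])
qed (use d in \<open>simp_all add: app_Z[OF q d_def d]\<close>)

end

context specialization
begin

lemma integral_lift: "lifts_to f c \<Longrightarrow> p \<in> integral_elems \<Longrightarrow> scal f * p \<in> integral_elems"
  using integral_closed(4) by (auto simp: lifts_to_def)

lemma kills_lift: "lifts_to f 0 \<Longrightarrow> p \<in> integral_elems \<Longrightarrow> scal f * p \<in> kills"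
  using kills_closed(5) by (auto simp: lifts_to_def)

text \<open>Replacing a coefficient by the constant function with the same value at \<open>q\<close> does not change
  the specialization.\<close>

lemma kills_coeff:
  assumes "lifts_to f c" "p \<in> integral_elems"
  shows "scal f * p - scal (const_F c) * p \<in> kills"
  using kills_lift[of "f - const_F c" p] lifts_to_simps(7)[OF assms(1) lifts_to_simps(3)[of c]] assms(2)
  by (simp add: scal_hom left_diff_distrib)

lemma lifts_dF: "lifts_to dF (qC - inverse qC)"
  unfolding dF_def by (intro lifts_to_simps)

lemma XYZ_eq:
  "letter gX = 1 + scal dF * xF" "letter gY = 1 + scal dF * yF" "letter gZ = scal dF * zF"
proof -
  have "scal dF * (scal (inverse dF) * p) = p" for p :: free_F
    using qF_generic by (simp add: scal_scal scal_hom(2) dF_def)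
  then show "letter gX = 1 + scal dF * xF" "letter gY = 1 + scal dF * yF" "letter gZ = scal dF * zF"
    by (simp_all add: xF_def yF_def zF_def)
qed

lemma integral_letters: "(letter g :: free_F) \<in> integral_elems"
proof (cases g)
  case gX
  show ?thesis unfolding gX XYZ_eq
    by (rule integral_closed(1)[OF integral_closed(5) integral_lift[OF lifts_dF integral_gens(2)]])
next
  case gY
  show ?thesis unfolding gY XYZ_eq
    by (rule integral_closed(1)[OF integral_closed(5) integral_lift[OF lifts_dF integral_gens(3)]])
next
  case gZ
  show ?thesis unfolding gZ XYZ_eq by (rule integral_lift[OF lifts_dF integral_gens(4)])
qed (simp add: integral_gens)

lemma infinite_qpow: "q \<noteq> 1 \<Longrightarrow> infinite (range (qpow qC))"
proof -
  assume q1: "q \<noteq> 1"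
  have "inj (qpow qC)"
  proof (rule linorder_injI)
    fix m n :: int assume "m < n"
    then obtain k where k: "n = m + int (Suc k)" by (metis zless_iff_Suc_zadd)
    have "qpow qC (int (Suc k) * 1) \<noteq> 1"
    proof
      assume "qpow qC (int (Suc k) * 1) = 1"
      then have "(qC ^ 2) ^ Suc k = 1"
        using qpow_power[OF qC(1), of "Suc k" 1] qpow_simps(6)[OF qC(1)] by simp
      then have "complex_of_real (q ^ (2 * Suc k)) = of_real 1"
        by (simp only: power_mult of_real_power of_real_1)
      then have "q ^ (2 * Suc k) = 1" by (simp only: of_real_eq_iff)
      then show False using q_pos q1 power_eq_1_iff[of q "2 * Suc k"] by simp
    qed
    then show "qpow qC m \<noteq> qpow qC n"
      using k qpow_simps(1)[OF qC(1), of m "int (Suc k)"] qpow_simps(4)[OF qC(1), of m] by auto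
  qed
  then show ?thesis using infinite_UNIV_int finite_imageD by blast
qed

text \<open>For \<open>q \<noteq> 1\<close> the number \<open>q - q\<^sup>-\<^sup>1\<close> is invertible in \<open>\<complex>\<close>, so that \<open>X\<close>, \<open>Y\<close>, \<open>Z\<close>, \<open>\<theta>\<close> themselves generate the
  specialization. Their relations over \<open>\<bbbF>\<close> become those over \<open>\<complex>\<close> after replacing \<open>\<^bold>q\<close> by its value.\<close>

theorem specialization_generic:
  assumes q1: "q \<noteq> 1"
  shows "\<exists>h\<in>algebra_iso spec (Uq qC).
    h (pure_tensor (ev q) UA 1 (Uq_x qF)) = Uq_x qC \<and>
    h (pure_tensor (ev q) UA 1 (Uq_y qF)) = Uq_y qC \<and>
    h (pure_tensor (ev q) UA 1 (Uq_z qF)) = Uq_z qC \<and>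
    h (pure_tensor (ev q) UA 1 (Uq_theta qF)) = Uq_theta qC"
proof -
  define dC where "dC = qC - inverse qC"
  have dC: "dC \<noteq> 0" using qC(2) q1 by (auto simp: dC_def)
  interpret PC: presentation UNIV "Uq_relations qC" by unfold_locales simp_all
  interpret NW: normal_words "\<lambda>a i k. Uq_base a i @ replicate k gTheta" "gen_op qC" "power_op qC"
     "op_Z qC" "op_theta qC" "\<lambda>a n. qpow qC (a * n)" dC
     "\<lambda>m. - (inverse qC * qpow qC (- m) * (qpow qC (m + 1) - 1) * (qpow qC m - 1) / dC^2)"
     "\<lambda>m. qC * qpow qC (- m)"
    by (rule Uq_normal_words[OF qC(1) dC_def dC infinite_qpow[OF q1]])
  interpret V: substitution "\<lambda>c. scal (const_F c)" "letter :: gen \<Rightarrow> free_F" by (rule const_substitution)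
  let ?W = "{Uq_base a i @ replicate k gTheta | a i k. True}"
  \<comment> \<open>dividing by the value of \<open>q - q\<^sup>-\<^sup>1\<close> instead of the function does not change the specialization\<close>
  have dinv: "scal (const_F (inverse dC) * dF - 1) * p \<in> kills" if "p \<in> integral_elems" for p
  proof (rule kills_lift[OF _ that])
    have "lifts_to (const_F (inverse dC) * dF - 1) (inverse dC * dC - 1)"
      unfolding dC_def by (intro lifts_to_simps lifts_dF)
    then show "lifts_to (const_F (inverse dC) * dF - 1) 0" using dC by simp
  qed
  have gt: "const_subst letter (letter gTheta) - letter gTheta \<in> kills"
    by (simp add: V.subst_simps kills_closed)
  have gx: "const_subst letter (scal (inverse dC) * (letter gX - 1)) - xF \<in> kills"
    using dinv[OF integral_gens(2)]
    by (simp add: V.subst_simps XYZ_eq scal_scal scal_hom(2,4) left_diff_distrib)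
  have gy: "const_subst letter (scal (inverse dC) * (letter gY - 1)) - yF \<in> kills"
    using dinv[OF integral_gens(3)]
    by (simp add: V.subst_simps XYZ_eq scal_scal scal_hom(2,4) left_diff_distrib)
  have gz: "const_subst letter (scal (inverse dC) * letter gZ) - zF \<in> kills"
    using dinv[OF integral_gens(4)]
    by (simp add: V.subst_simps XYZ_eq scal_scal scal_hom(2,4) left_diff_distrib)
  have "\<exists>h\<in>algebra_iso spec (presented_algebra UNIV (Uq_relations qC)).
    \<forall>p\<in>carrier (free_algebra UNIV). h (tau (const_subst letter p)) =
      relation_ideal UNIV (Uq_relations qC) +>\<^bsub>free_algebra UNIV\<^esub> p"
  proof (rule specialization_iso[OF PC.presentation_axioms])
    show "letter s \<in> integral_elems" for s by (rule integral_letters)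
    note L = lifts_to_simps lifts_to_power
    have c: "scal f * p - scal (const_F c) * p \<in> kills" if "lifts_to f c" "p \<in> integral_elems" for f c p
      by (rule kills_coeff[OF that])
    note int = integral_letters integral_closed
    show "const_subst letter (l - r) \<in> kills" if "(l, r) \<in> Uq_relations qC" for l r
    proof -
      note R = Uq_rels[OF qF_nonzero]
      let ?X = "letter gX :: free_F" and ?Y = "letter gY :: free_F" and ?Z = "letter gZ :: free_F"
        and ?t = "letter gTheta :: free_F"
      have mm: "letter a * letter b \<in> integral_elems" for a b :: gen by (intro int)
      have l: "lifts_to (qF^2) (qC^2)" "lifts_to ((inverse qF)^2) ((inverse qC)^2)"
        "lifts_to qF qC" "lifts_to (inverse qF) (inverse qC)" "lifts_to (qF + inverse qF) (qC + inverse qC)"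
        by (intro L)+
      have 1: "?X * ?Z - scal (const_F (qC^2)) * (?Z * ?X) \<in> kills"
        using kills_closed(2)[OF kills_rels[OF R(1)] c[OF l(1) mm[of gZ gX]]] by simp
      have 2: "?Z * ?Y - scal (const_F (qC^2)) * (?Y * ?Z) \<in> kills"
        using kills_closed(2)[OF kills_rels[OF R(2)] c[OF l(1) mm[of gY gZ]]] by simp
      have 3: "?X * ?Y + scal (const_F (qC^2)) * (?Z * ?Z) - 1 \<in> kills"
      proof -
        have "?X * ?Y + scal (const_F (qC^2)) * (?Z * ?Z) - 1 = (?X * ?Y + scal (qF^2) * (?Z * ?Z) - 1)
          - (scal (qF^2) * (?Z * ?Z) - scal (const_F (qC^2)) * (?Z * ?Z))" by simp
        also have "\<dots> \<in> kills" by (rule kills_diff[OF kills_rels[OF R(3)] c[OF l(1) mm]])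
        finally show ?thesis .
      qed
      have 4: "?Y * ?X + scal (const_F ((inverse qC)^2)) * (?Z * ?Z) - 1 \<in> kills"
      proof -
        have "?Y * ?X + scal (const_F ((inverse qC)^2)) * (?Z * ?Z) - 1 =
          (?Y * ?X + scal ((inverse qF)^2) * (?Z * ?Z) - 1)
          - (scal ((inverse qF)^2) * (?Z * ?Z) - scal (const_F ((inverse qC)^2)) * (?Z * ?Z))" by simp
        also have "\<dots> \<in> kills" by (rule kills_diff[OF kills_rels[OF R(4)] c[OF l(2) mm]])
        finally show ?thesis .
      qed
      have 56: "scal (const_F qC) * (letter a * letter b) - scal (const_F (inverse qC)) * (letter b * letter a)
          - scal (const_F (qC + inverse qC)) * ?Z \<in> kills"
        if "scal qF * (letter a * letter b) - scal (inverse qF) * (letter b * letter a)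
          - scal (qF + inverse qF) * ?Z \<in> UF.rels" for a b
      proof -
        have eq: "u' - v' - w' = (u - v - w) - (u - u') + (v - v') + (w - w')" for u v w u' v' w' :: free_F
          by simp
        show ?thesis
          by (subst eq[of _ _ _ "scal qF * (letter a * letter b)" "scal (inverse qF) * (letter b * letter a)"
              "scal (qF + inverse qF) * ?Z"])
            (intro kills_closed(2) kills_diff[OF kills_rels[OF that] c[OF l(3) mm]] c[OF l(4) mm]
              c[OF l(5) integral_letters])
      qed
      note 5 = 56[OF R(5)] and 6 = 56[OF R(6)]
      have 7: "?t * ?Z - ?Z * ?t - (?Y - ?X) \<in> kills" by (rule kills_rels[OF R(7)])
      have "(l, r) \<in> {(X * Z, scal (qC^2) * (Z * X)), (Z * Y, scal (qC^2) * (Y * Z)),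
          (X * Y + scal (qC^2) * (Z * Z), 1), (Y * X + scal ((inverse qC)^2) * (Z * Z), 1),
          (scal qC * (X * \<Theta>) - scal (inverse qC) * (\<Theta> * X), scal (qC + inverse qC) * Z),
          (scal qC * (\<Theta> * Y) - scal (inverse qC) * (Y * \<Theta>), scal (qC + inverse qC) * Z),
          (\<Theta> * Z - Z * \<Theta>, Y - X)}"
        using that by (simp add: Uq_relations_def Let_def free_algebra_simps(2-5) free_algebra_mult
            free_algebra_minus)
      then have "const_subst letter l - const_subst letter r \<in> kills"
        using 1 2 3 4 5 6 7
        by (elim insertE emptyE) (simp_all only: prod.inject V.subst_simps)
      then show ?thesis by (simp only: V.subst_diff)
    qed
    show "\<exists>p\<in>carrier (free_algebra UNIV). const_subst letter p - g \<in> kills"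
      if g: "g \<in> {letter gTheta, xF, yF, zF}" for g
      using g gt gx gy gz free_algebra_UNIV by blast
    show "\<exists>p'. Poly_Mapping.keys p' \<subseteq> ?W \<and> p - p' \<in> PC.rels" for p
      using Uq_spanning[OF qC(1), of p] unfolding PC.span_words_def by blast
    show "p = 0" if p: "Poly_Mapping.keys p \<subseteq> ?W" and k: "const_subst letter p \<in> kills" for p
    proof (rule NW.independent[OF p])
      have "specializes_to (\<rho>F (letter g)) (gen_op qC g)" for g
        using specializes_to_gens substitution.subst_letter[OF op_substitution, of "gen_op qF" g] by (cases g) auto
      then have "specializes_to (\<rho>F (const_subst letter p)) (op_rep (gen_op qC) p)"
        by (intro const_subst_specializes[where S = UNIV]) auto
      then show "op_rep (gen_op qC) p = 0" by (rule kills_imp_zero[OF k])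
    qed
  qed
  then obtain h where h: "h \<in> algebra_iso spec (Uq qC)" "\<And>p. h (tau (const_subst letter p)) = PC.cls p"
    unfolding Uq_def[symmetric] PC.cls_def using free_algebra_UNIV by blast
  have h_tau: "h (tau g) = PC.cls p" if "const_subst letter p - g \<in> kills" "g \<in> integral_elems" for p g
  proof -
    have "const_subst letter p \<in> integral_elems"
      by (rule const_subst_integral[where S = UNIV]) (simp_all add: integral_letters)
    then have "tau (const_subst letter p) = tau g" using tau_eq_iff that by blast
    then show ?thesis using h(2)[of p] by simp
  qed
  have gens_C: "Uq_theta qC = PC.cls (letter gTheta)" "Uq_x qC = PC.cls (scal (inverse dC) * (letter gX - 1))"
    "Uq_y qC = PC.cls (scal (inverse dC) * (letter gY - 1))" "Uq_z qC = PC.cls (scal (inverse dC) * letter gZ)"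
    unfolding Uq_theta_def Uq_x_def Uq_y_def Uq_z_def Uq_gen_def Uq_def dC_def PC.presented_gen_cls PC.cls_one
    by (simp_all only: PC.cls_diff PC.cls_smult free_algebra_UNIV)
  show ?thesis
    using h(1) h_tau[OF gt integral_gens(1)] h_tau[OF gx integral_gens(2)] h_tau[OF gy integral_gens(3)]
      h_tau[OF gz integral_gens(4)]
    unfolding gens_C Uq_gens_F tau_def by blast
qed

end

section \<open>Normal words in \<open>U(\<ss>\<ll>\<^sub>2)\<close>\<close>

definition sl2_mat :: "complex \<Rightarrow> complex \<Rightarrow> complex \<Rightarrow> complex^2^2" where
  "sl2_mat a b c = (\<chi> i j. if i = 1 then (if j = 1 then a else b) else (if j = 1 then c else - a))"

abbreviation "scale_mat \<equiv> (\<lambda>c M. \<chi> i j. c * vec_nth (vec_nth M i) j) :: complex \<Rightarrow> complex^2^2 \<Rightarrow> complex^2^2"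

lemma sl2_mat_entries [simp]:
  "sl2_mat a b c $ 1 $ 1 = a" "sl2_mat a b c $ 1 $ 2 = b" "sl2_mat a b c $ 2 $ 1 = c"
  "sl2_mat a b c $ 2 $ 2 = - a"
  by (simp_all add: sl2_mat_def)

lemma mat2_eqI:
  fixes M N :: "complex^2^2"
  assumes "M $ 1 $ 1 = N $ 1 $ 1" "M $ 1 $ 2 = N $ 1 $ 2" "M $ 2 $ 1 = N $ 2 $ 1" "M $ 2 $ 2 = N $ 2 $ 2"
  shows "M = N"
  using assms by (simp add: vec_eq_iff forall_2)

lemma sl2_mat_in: "sl2_mat a b c \<in> sl2"
  by (simp add: sl2_def trace_def sum_2)

lemma sl2_mat_surj: "M \<in> sl2 \<Longrightarrow> M = sl2_mat (M $ 1 $ 1) (M $ 1 $ 2) (M $ 2 $ 1)"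
  by (rule mat2_eqI) (auto simp: sl2_def trace_def sum_2 eq_neg_iff_add_eq_0 add.commute)

lemma sl2_mat_add: "sl2_mat a b c + sl2_mat a' b' c' = sl2_mat (a + a') (b + b') (c + c')"
  by (rule mat2_eqI) simp_all

lemma sl2_mat_scale: "scale_mat k (sl2_mat a b c) = sl2_mat (k * a) (k * b) (k * c)"
  by (rule mat2_eqI) simp_all

lemma sl2_mat_bracket:
  "sl2_mat a b c ** sl2_mat a' b' c' - sl2_mat a' b' c' ** sl2_mat a b c =
     sl2_mat (b * c' - b' * c) (2 * (a * b' - a' * b)) (2 * (c * a' - c' * a))"
  by (rule mat2_eqI) (simp_all add: matrix_matrix_mult_def sum_2 algebra_simps)

lemma sl2_closed:
  assumes "u \<in> sl2" "v \<in> sl2"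
  shows "u + v \<in> sl2" "scale_mat k u \<in> sl2" "u ** v - v ** u \<in> sl2"
  using sl2_mat_surj[OF assms(1)] sl2_mat_surj[OF assms(2)]
  by (metis sl2_mat_in sl2_mat_add, metis sl2_mat_in sl2_mat_scale, metis sl2_mat_in sl2_mat_bracket)

definition sl2_rels :: "(((complex^2^2) list \<Rightarrow>\<^sub>0 complex) \<times> ((complex^2^2) list \<Rightarrow>\<^sub>0 complex)) set" where
  "sl2_rels = {(letter (u + v), letter u + letter v) | u v. u \<in> sl2 \<and> v \<in> sl2} \<union>
     {(letter (scale_mat c u), scal c * letter u) | c u. u \<in> sl2} \<union>
     {(letter u * letter v - letter v * letter u, letter (u ** v - v ** u)) | u v. u \<in> sl2 \<and> v \<in> sl2}"

lemma U_sl2_eq: "U_sl2 = presented_algebra sl2 sl2_rels"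
proof -
  have "letter u \<otimes>\<^bsub>free_algebra sl2\<^esub> letter v \<ominus>\<^bsub>free_algebra sl2\<^esub> letter v \<otimes>\<^bsub>free_algebra sl2\<^esub> letter u =
      letter u * letter v - (letter v * letter u :: (complex^2^2) list \<Rightarrow>\<^sub>0 complex)"
    if "u \<in> sl2" "v \<in> sl2" for u v
    using that by (simp add: free_algebra_mult free_algebra_minus free_algebra_carrier letter_carrier)
  then have eq: "{(letter u \<otimes>\<^bsub>free_algebra sl2\<^esub> letter v \<ominus>\<^bsub>free_algebra sl2\<^esub> letter v \<otimes>\<^bsub>free_algebra sl2\<^esub> letter u,
        letter (u ** v - v ** u)) | u v. u \<in> sl2 \<and> v \<in> sl2} =
     {(letter u * letter v - letter v * letter u :: (complex^2^2) list \<Rightarrow>\<^sub>0 complex, letter (u ** v - v ** u))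
        | u v. u \<in> sl2 \<and> v \<in> sl2}"
    by (intro Collect_cong) (metis (no_types, lifting))
  show ?thesis
    unfolding U_sl2_def enveloping_algebra_def Let_def sl2_rels_def free_algebra_simps(2,5)
    by (simp only: eq)
qed

interpretation PS: presentation sl2 sl2_rels
  by unfold_locales
    (auto simp: sl2_rels_def intro!: free_algebra_carrier free_algebra_consts letter_carrier sl2_closed)

abbreviation "mH \<equiv> sl2_mat 1 0 0"
abbreviation "mE \<equiv> sl2_mat 0 1 0"
abbreviation "mF \<equiv> sl2_mat 0 0 1"

type_synonym free_sl2 = "(complex^2^2) list \<Rightarrow>\<^sub>0 complex"

lemma sl2_letter_expand:
  "(letter (sl2_mat a b c) :: free_sl2)
     - (scal a * letter mH + scal b * letter mE + scal c * letter mF) \<in> PS.rels"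
proof -
  have add: "(letter (u + v) :: free_sl2) - (letter u + letter v) \<in> PS.rels" if "u \<in> sl2" "v \<in> sl2" for u v
    by (rule PS.rels_incl) (use that in \<open>auto simp: sl2_rels_def\<close>)
  have scale: "(letter (scale_mat k u) :: free_sl2) - scal k * letter u \<in> PS.rels" if "u \<in> sl2" for k u
    by (rule PS.rels_incl) (use that in \<open>auto simp: sl2_rels_def\<close>)
  let ?h = "sl2_mat a 0 0" and ?e = "sl2_mat 0 b 0" and ?f = "sl2_mat 0 0 c"
  have "(letter (sl2_mat a b c) :: free_sl2) - (scal a * letter mH + scal b * letter mE + scal c * letter mF) =
    (letter (sl2_mat a b 0 + ?f) - (letter (sl2_mat a b 0) + letter ?f))
    + (letter (?h + ?e) - (letter ?h + letter ?e))
    + (letter (scale_mat a mH) - scal a * letter mH)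
    + (letter (scale_mat b mE) - scal b * letter mE)
    + (letter (scale_mat c mF) - scal c * letter mF)"
    by (simp add: sl2_mat_add sl2_mat_scale)
  also have "\<dots> \<in> PS.rels"
    by (intro PS.rels_add add scale sl2_mat_in)
  finally show ?thesis .
qed

lemma sl2_brackets:
  "letter mH * letter mE - letter mE * letter mH - scal 2 * (letter mE :: free_sl2) \<in> PS.rels"
  "letter mH * letter mF - letter mF * letter mH + scal 2 * (letter mF :: free_sl2) \<in> PS.rels"
  "letter mE * letter mF - letter mF * letter mE - (letter mH :: free_sl2) \<in> PS.rels"
proof -
  have br: "letter (sl2_mat a b c) * letter (sl2_mat a' b' c') - letter (sl2_mat a' b' c') * letter (sl2_mat a b c)
    - (scal (b * c' - b' * c) * letter mH + scal (2 * (a * b' - a' * b)) * letter mE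
      + scal (2 * (c * a' - c' * a)) * (letter mF :: free_sl2)) \<in> PS.rels" (is "?l - ?r \<in> _") for a b c a' b' c'
  proof -
    let ?br = "sl2_mat (b * c' - b' * c) (2 * (a * b' - a' * b)) (2 * (c * a' - c' * a))"
    have rel: "(?l, letter ?br) \<in> sl2_rels"
      unfolding sl2_rels_def sl2_mat_bracket[symmetric] using sl2_mat_in by blast
    have "?l - ?r = (?l - letter ?br) + (letter ?br - ?r)" by simp
    also have "\<dots> \<in> PS.rels" by (rule PS.rels_add[OF PS.rels_incl[OF rel] sl2_letter_expand])
    finally show ?thesis .
  qed
  show "letter mH * letter mE - letter mE * letter mH - scal 2 * (letter mE :: free_sl2) \<in> PS.rels"
    using br[of 1 0 0 0 1 0] by (simp add: scal_hom(1))
  show "letter mH * letter mF - letter mF * letter mH + scal 2 * (letter mF :: free_sl2) \<in> PS.rels"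
    using br[of 1 0 0 0 0 1] by (simp add: scal_hom(1,5))
  show "letter mE * letter mF - letter mF * letter mE - (letter mH :: free_sl2) \<in> PS.rels"
    using br[of 0 1 0 0 0 1] by (simp add: scal_hom(1,2))
qed

text \<open>The words \<open>H\<^sup>j E\<^sup>i\<close>; placing \<open>H\<close> first makes its powers act last, by the eigenvalues \<open>(2n)\<^sup>j\<close> at the final weight.\<close>

definition sl2_base :: "(complex^2^2) list set" where
  "sl2_base = {replicate j mH @ replicate i mE | j i. True}"

lemma sl2_base_word: "(word (replicate j mH @ replicate i mE) :: free_sl2) \<in> PS.span_words sl2_base"
  by (rule PS.span_word) (auto simp: sl2_base_def)

lemma H_stable_word: "(letter mH :: free_sl2) * word (replicate j mH @ replicate i mE) \<in> PS.span_words sl2_base"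
  using sl2_base_word[of "Suc j" i] by (simp add: letter_mult_word)

lemma H_stable: "p \<in> PS.span_words sl2_base \<Longrightarrow> (letter mH :: free_sl2) * p \<in> PS.span_words sl2_base"
  by (erule PS.span_map_left)
    (auto simp: sl2_base_def[THEN eqset_imp_iff] H_stable_word letter_carrier sl2_mat_in)

lemma sl2_word_carrier: "(word (replicate j mH @ replicate i mE) :: free_sl2) \<in> carrier PS.free"
  by (auto simp: free_algebra_simps sl2_mat_in)

lemma E_stable_word: "(letter mE :: free_sl2) * word (replicate j mH @ replicate i mE) \<in> PS.span_words sl2_base"
proof (induction j)
  case 0
  show ?case using sl2_base_word[of 0 "Suc i"] by (simp add: letter_mult_word)
next
  case (Suc j)
  let ?w = "word (replicate j mH @ replicate i mE) :: free_sl2"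
  have "letter mE * word (replicate (Suc j) mH @ replicate i mE) =
    letter mH * (letter mE * ?w) - scal 2 * (letter mE * ?w)
    - (letter mH * letter mE - letter mE * letter mH - scal 2 * letter mE) * ?w"
    by (simp add: word_Cons algebra_simps)
  also have "\<dots> \<in> PS.span_words sl2_base"
    by (intro PS.span_diff H_stable PS.span_scal Suc PS.span_rels PS.rels_mult sl2_brackets sl2_word_carrier)
  finally show ?case .
qed

theorem sl2_spanning:
  assumes p: "p \<in> carrier PS.free"
  shows "p \<in> PS.span_words {replicate j mH @ replicate i mE @ replicate k mF | j i k. True}"
proof -
  define \<sigma> :: "complex^2^2 \<Rightarrow> free_sl2" where
    "\<sigma> g = (if g = mH then letter mH + scal 2 else letter mE)" for g
  define \<delta> :: "complex^2^2 \<Rightarrow> free_sl2" where "\<delta> g = (if g = mH then 0 else - letter mH)" for g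
  have neq: "mE \<noteq> mH" by (metis sl2_mat_entries(1) zero_neq_one)
  have "p \<in> PS.span_words {w @ replicate k mF | w k. w \<in> sl2_base}"
  proof (rule PS.ore_spanning[where G = "{mH, mE}" and \<sigma> = \<sigma> and \<delta> = \<delta>])
    show "mF \<in> sl2" "{mH, mE} \<subseteq> sl2" by (simp_all add: sl2_mat_in)
    show "[] \<in> sl2_base" by (auto simp: sl2_base_def)
    show "sl2_base \<subseteq> lists {mH, mE}" by (auto simp: sl2_base_def)
    show "letter g * word w \<in> PS.span_words sl2_base" if "g \<in> {mH, mE}" "w \<in> sl2_base" for g w
      using that by (auto simp: sl2_base_def[THEN eqset_imp_iff] H_stable_word E_stable_word)
    have "letter mF * letter mH - ((letter mH + scal 2) * letter mF + (0 :: free_sl2)) =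
       - (letter mH * letter mF - letter mF * letter mH + scal 2 * letter mF)" by (simp add: algebra_simps)
    also have "\<dots> \<in> PS.rels" by (rule PS.rels_uminus[OF sl2_brackets(2)])
    finally have m1: "letter mF * letter mH - ((letter mH + scal 2) * letter mF + (0 :: free_sl2)) \<in> PS.rels" .
    have "letter mF * letter mE - (letter mE * letter mF + - (letter mH :: free_sl2)) =
       - (letter mE * letter mF - letter mF * letter mE - letter mH)" by (simp add: algebra_simps)
    also have "\<dots> \<in> PS.rels" by (rule PS.rels_uminus[OF sl2_brackets(3)])
    finally have m2: "letter mF * letter mE - (letter mE * letter mF + - (letter mH :: free_sl2)) \<in> PS.rels" .
    show "letter mF * letter g - (\<sigma> g * letter mF + \<delta> g) \<in> PS.rels" if "g \<in> {mH, mE}" for g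
    proof (cases "g = mH")
      case True
      show ?thesis using m1 by (simp only: \<sigma>_def \<delta>_def True simp_thms if_True)
    next
      case False
      then have "g = mE" using that by blast
      then show ?thesis using m2 neq by (simp only: \<sigma>_def \<delta>_def simp_thms if_False)
    qed
    show "\<sigma> g \<in> carrier PS.free" "\<delta> g \<in> carrier PS.free" if "g \<in> {mH, mE}" for g
      by (auto simp: \<sigma>_def \<delta>_def intro!: free_algebra_carrier free_algebra_consts letter_carrier sl2_mat_in)
    show "\<sigma> g * word w \<in> PS.span_words sl2_base" "\<delta> g * word w \<in> PS.span_words sl2_base"
      if "g \<in> {mH, mE}" "w \<in> sl2_base" for g w
      using that neq
      by (auto simp: sl2_base_def[THEN eqset_imp_iff] \<sigma>_def \<delta>_def H_stable_word E_stable_word distrib_right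
          PS.span_rels PS.rels_zero intro!: PS.span_add PS.span_scal PS.span_uminus sl2_base_word)
    show "letter s \<in> PS.span_words ((\<lambda>g. [g]) ` insert mF {mH, mE})" if s: "s \<in> sl2" for s
    proof -
      have l: "(letter g :: free_sl2) \<in> PS.span_words ((\<lambda>g. [g]) ` insert mF {mH, mE})"
        if "g \<in> insert mF {mH, mE}" for g
        unfolding letter_def by (rule PS.span_word) (use that in blast)
      obtain a b c where "s = sl2_mat a b c" using sl2_mat_surj[OF s] by blast
      then have "letter s = (letter (sl2_mat a b c) - (scal a * letter mH + scal b * letter mE + scal c * letter mF))
        + (scal a * letter mH + scal b * letter mE + scal c * (letter mF :: free_sl2))" by simp
      also have "\<dots> \<in> PS.span_words ((\<lambda>g. [g]) ` insert mF {mH, mE})"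
        by (intro PS.span_add PS.span_scal l PS.span_rels sl2_letter_expand) simp_all
      finally show ?thesis .
    qed
  qed (rule p)
  moreover have "{w @ replicate k mF | w k. w \<in> sl2_base} =
      {replicate j mH @ replicate i mE @ replicate k mF | j i k. True}"
    by (auto simp: sl2_base_def) (metis append.assoc)+
  ultimately show ?thesis by simp
qed

text \<open>At \<open>q = 1\<close> the term of \<open>\<theta>\<close> that raises the weight is \<open>z\<close>, so that \<open>\<theta> - z\<close> is a pure lowering operator.\<close>

definition sl2_op :: "complex^2^2 \<Rightarrow> complex diff_op" where
  "sl2_op M = scalar_op (2 * M $ 1 $ 1) * op_x 1 + scalar_op (M $ 1 $ 2) * op_z
     + scalar_op (M $ 2 $ 1) * (op_theta 1 - op_z)"

lemma sl2_op_simps: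
  "app (sl2_op mH) g j m = 2 * of_int m * g j m"
  "app (sl2_op mE) g j m = g j (m - 1)"
  "app (sl2_op mF) g j m = g (Suc j) (m + 1) - of_int (m + 1) * of_int m * g j (m + 1)"
  by (simp_all add: sl2_op_def op_simps op_x_def op_z_def op_theta_def qnum_def qpow_def)

lemma sl2_normal_words:
  "normal_words (\<lambda>j i k. replicate j mH @ replicate i mE @ replicate k mF) sl2_op
     (\<lambda>j. sl2_op mH ^ j) (sl2_op mE) (sl2_op mF) (\<lambda>j n. (2 * of_int n) ^ j) 1
     (\<lambda>m. - (of_int (m + 1) * of_int m)) (\<lambda>m. 0)"
proof
  have neq: "mE \<noteq> mH" "mF \<noteq> mH" "mF \<noteq> mE" "mH \<noteq> mE" "mH \<noteq> mF" "mE \<noteq> mF"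
    by (metis sl2_mat_entries zero_neq_one)+
  fix a b i k j l :: nat
  assume eq: "replicate a mH @ replicate i mE @ replicate k mF = replicate b mH @ replicate j mE @ replicate l mF"
  have "count_list (replicate a mH @ replicate i mE @ replicate k mF) g =
      count_list (replicate b mH @ replicate j mE @ replicate l mF) g" for g
    by (simp only: eq)
  from this[of mH] this[of mE] this[of mF] neq show "a = b \<and> i = j \<and> k = l"
    by (simp add: count_list_append count_list_replicate)
next
  show "prod_list (map sl2_op (replicate a mH @ replicate i mE @ replicate k mF)) =
      sl2_op mH ^ a * sl2_op mE ^ i * sl2_op mF ^ k" for a i k
    by (simp add: map_replicate prod_list_replicate mult.assoc)
  have pow: "app (sl2_op mH ^ a) g j m = (2 * of_int m) ^ a * g j m" for a g j m
    by (induction a) (simp_all add: app_simps sl2_op_simps)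
  show "app (sl2_op mH ^ a) g j m = 0" if "\<And>m. m < n \<Longrightarrow> g j m = 0" "m < n" for n g j m a
    using that by (simp add: pow)
  show "app (sl2_op mH ^ a) g j n = (2 * of_int n) ^ a * g j n" for n g j a
    by (simp add: pow)
  have "inj (\<lambda>n :: int. 2 * of_int n :: complex)" by (rule injI) simp
  then have inf: "infinite (range (\<lambda>n :: int. 2 * of_int n :: complex))"
    using infinite_UNIV_int finite_imageD by blast
  show "c a = 0" if "finite B" "\<And>n. (\<Sum>a\<in>B. c a * (2 * of_int n :: complex) ^ a) = 0" "a \<in> B"
    for B :: "nat set" and c a
    using monom_functions_independent[OF that(1) _ inf that(2) that(3)] by simp
qed (simp_all add: sl2_op_simps)

section \<open>Specialization at 1\<close>

lemma scal_two: "scal 2 * p = p + (p :: 's list \<Rightarrow>\<^sub>0 'k::comm_ring_1)"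
proof -
  have "scal (1 + 1) * p = p + p" by (simp only: scal_hom(2,3) distrib_right mult_1_left)
  then show ?thesis by (simp only: one_add_one)
qed

text \<open>The commutator of two linear combinations of \<open>h\<close>, \<open>e\<close>, \<open>f\<close> with central coefficients differs from the bracket of
  \<open>\<ss>\<ll>\<^sub>2\<close> by multiples of the defects of the three basic brackets.\<close>

lemma scal_times_sum_commutator:
  fixes h e f :: "'s list \<Rightarrow>\<^sub>0 'k::comm_ring_1" and a b c a' b' c' :: 'k
  defines "u \<equiv> scal a * h + scal b * e + scal c * f" and "v \<equiv> scal a' * h + scal b' * e + scal c' * f"
  shows "u * v - v * u - (scal (b * c' - b' * c) * h + scal (2 * (a * b' - a' * b)) * e
       + scal (2 * (c * a' - c' * a)) * f) =
     scal (a * b' - a' * b) * (h * e - e * h - scal 2 * e)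
     + scal (a * c' - a' * c) * (h * f - f * h + scal 2 * f)
     + scal (b * c' - b' * c) * (e * f - f * e - h)"
proof -
  note sl = scal_left[of h] scal_left[of e] scal_left[of f]
  show ?thesis
    unfolding u_def v_def
    by (simp add: sl scal_scal distrib_left distrib_right left_diff_distrib right_diff_distrib mult.assoc
        scal_hom(3-5) mult.commute[where 'a = 'k] mult.left_commute[where 'a = 'k])
qed

context specialization
begin

text \<open>The elements \<open>2x\<close>, \<open>z\<close> and \<open>\<theta> - z\<close> of \<open>U\<^sub>\<bbbA>\<close> specialize to the standard basis \<open>H\<close>, \<open>E\<close>, \<open>F\<close> at \<open>q = 1\<close>.\<close>

definition sl2_lift :: "complex^2^2 \<Rightarrow> free_F" where
  "sl2_lift M = scal (const_F (M $ 1 $ 1)) * (scal 2 * xF) + scal (const_F (M $ 1 $ 2)) * zF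
     + scal (const_F (M $ 2 $ 1)) * (letter gTheta - zF)"

lemma const_F_2: "const_F 2 = 2"
  using const_F_hom(3)[of 1 1] by (simp add: const_F_hom)

text \<open>The relations of \<open>U\<^sub>\<bbbF>\<close> rewritten for \<open>X = 1 + d x\<close>, \<open>Y = 1 + d y\<close>, \<open>Z = d z\<close> with \<open>d = q - q\<^sup>-\<^sup>1\<close>, after cancelling the
  common power of \<open>d\<close>. They have coefficients in \<open>\<bbbA>\<close> and survive at \<open>q = 1\<close>.\<close>

lemma integral_relations:
  "xF * zF - scal (qF^2) * (zF * xF) - scal qF * zF \<in> UF.rels"
  "xF + yF + scal dF * (xF * yF + scal (qF^2) * (zF * zF)) \<in> UF.rels"
  "letter gTheta + scal qF * (xF * letter gTheta) - scal (inverse qF) * (letter gTheta * xF)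
     - scal (qF + inverse qF) * zF \<in> UF.rels"
  "letter gTheta * zF - zF * letter gTheta - (yF - xF) \<in> UF.rels"
proof -
  note R = Uq_rels[OF qF_nonzero]
  note sl = scal_left[of xF] scal_left[of zF] scal_left[of yF] scal_left[of "letter gTheta"]
    scal_scal distrib_left distrib_right left_diff_distrib right_diff_distrib mult.assoc
  have d: "dF \<noteq> 0" using qF_generic by (simp add: dF_def)
  have m: "scal c * p \<in> UF.rels" if "p \<in> UF.rels" for c p
    by (rule UF.rels_mult(2)[OF that]) simp
  let ?t = "letter gTheta :: free_F"
  have c1: "qF^2 * inverse dF - inverse dF = qF"
  proof -
    have "qF^2 - 1 = qF * dF" using qF_nonzero by (simp add: dF_def power2_eq_square right_diff_distrib)
    then have "(qF^2 - 1) * inverse dF = qF" using d by simp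
    then show ?thesis by (simp add: left_diff_distrib)
  qed
  have "scal (inverse (dF * dF)) * (X * Z - scal (qF^2) * (Z * X)) =
    xF * zF - scal (qF^2) * (zF * xF) - (scal (qF^2 * inverse dF) - scal (inverse dF)) * zF"
    unfolding XYZ_eq using d by (simp add: sl scal_hom(2) field_simps)
  also have "scal (qF^2 * inverse dF) - scal (inverse dF) = (scal qF :: free_F)"
    by (simp only: c1 flip: scal_hom(4))
  finally show "xF * zF - scal (qF^2) * (zF * xF) - scal qF * zF \<in> UF.rels"
    using m[OF R(1), of "inverse (dF * dF)"] by simp
  have "scal (inverse dF) * (X * Y + scal (qF^2) * (Z * Z) - 1) =
    xF + yF + scal dF * (xF * yF + scal (qF^2) * (zF * zF))"
    unfolding XYZ_eq using d by (simp add: sl scal_hom(2) field_simps)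
  then show "xF + yF + scal dF * (xF * yF + scal (qF^2) * (zF * zF)) \<in> UF.rels"
    using m[OF R(3), of "inverse dF"] by simp
  have e: "inverse dF * (c * dF) = c" for c using d by (simp add: field_simps)
  have c2: "inverse dF * qF - inverse dF * inverse qF = 1"
    using d unfolding right_diff_distrib[symmetric] by (simp flip: dF_def)
  have "scal (inverse dF) * (scal qF * (X * \<Theta>) - scal (inverse qF) * (\<Theta> * X) - scal (qF + inverse qF) * Z) =
    (scal (inverse dF * qF) - scal (inverse dF * inverse qF)) * ?t
      + scal qF * (xF * ?t) - scal (inverse qF) * (?t * xF) - scal (qF + inverse qF) * zF"
    unfolding XYZ_eq by (simp add: sl e)
  also have "scal (inverse dF * qF) - scal (inverse dF * inverse qF) = (1 :: free_F)"
    by (simp only: c2 scal_hom(2) flip: scal_hom(4))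
  finally show "?t + scal qF * (xF * ?t) - scal (inverse qF) * (?t * xF) - scal (qF + inverse qF) * zF \<in> UF.rels"
    using m[OF R(5), of "inverse dF"] by simp
  have "scal (inverse dF) * (\<Theta> * Z - Z * \<Theta> - (Y - X)) = ?t * zF - zF * ?t - (yF - xF)"
    unfolding XYZ_eq using d by (simp add: sl scal_hom(2))
  then show "?t * zF - zF * ?t - (yF - xF) \<in> UF.rels"
    using m[OF R(7), of "inverse dF"] by simp
qed

lemma integral_sl2_lift: "sl2_lift M \<in> integral_elems"
proof -
  have "scal 2 * xF \<in> integral_elems"
    using integral_closed(2)[OF integral_const[of 2] integral_gens(2)] by (simp add: const_F_2)
  then show ?thesis
    unfolding sl2_lift_def
    by (intro integral_closed(1) integral_closed(2)[OF integral_const] integral_diff integral_gens)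
qed

context
  assumes q1: "q = 1"
begin

text \<open>Each relation differs from an integral one by terms whose coefficients vanish at \<open>q = 1\<close>; for the last one, \<open>y\<close> is
  also eliminated by the first.\<close>

lemma limit_relations:
  "xF + yF \<in> kills"
  "xF * zF - zF * xF - zF \<in> kills"
  "xF * letter gTheta - letter gTheta * xF + letter gTheta - scal 2 * zF \<in> kills"
  "letter gTheta * zF - zF * letter gTheta + scal 2 * xF \<in> kills"
proof -
  let ?t = "letter gTheta :: free_F"
  have l2: "lifts_to (qF^2 - 1) 0"
    using lifts_to_simps(7)[OF lifts_to_power[OF lifts_to_simps(4), of 2] lifts_to_simps(2)] by (simp add: q1)
  have l1: "lifts_to (qF - 1) 0"
    using lifts_to_simps(7)[OF lifts_to_simps(4) lifts_to_simps(2)] by (simp add: q1)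
  have li: "lifts_to (inverse qF - 1) 0"
    using lifts_to_simps(7)[OF lifts_to_simps(5) lifts_to_simps(2)] by (simp add: q1)
  have ld: "lifts_to dF 0" using lifts_dF by (simp add: q1)
  have ls: "lifts_to (qF + inverse qF - 2) 0"
    using lifts_to_simps(6)[OF l1 li] by (simp add: algebra_simps)
  note int = integral_closed(1,2) integral_gens integral_lift[OF lifts_to_power[OF lifts_to_simps(4)]]
  have "xF + yF = (xF + yF + scal dF * (xF * yF + scal (qF^2) * (zF * zF)))
      - scal dF * (xF * yF + scal (qF^2) * (zF * zF))" by simp
  also have "\<dots> \<in> kills"
    by (intro kills_diff[OF kills_rels[OF integral_relations(2)]] kills_lift[OF ld] int)
  finally show xy: "xF + yF \<in> kills" .
  have "xF * zF - zF * xF - zF = (xF * zF - scal (qF^2) * (zF * xF) - scal qF * zF)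
      + scal (qF^2 - 1) * (zF * xF) + scal (qF - 1) * zF"
    by (simp add: scal_hom(2,4) left_diff_distrib)
  also have "\<dots> \<in> kills"
    by (intro kills_closed(2) kills_rels[OF integral_relations(1)] kills_lift[OF l2] kills_lift[OF l1] int)
  finally show "xF * zF - zF * xF - zF \<in> kills" .
  have "xF * ?t - ?t * xF + ?t - scal 2 * zF =
      (?t + scal qF * (xF * ?t) - scal (inverse qF) * (?t * xF) - scal (qF + inverse qF) * zF)
      - scal (qF - 1) * (xF * ?t) + scal (inverse qF - 1) * (?t * xF) + scal (qF + inverse qF - 2) * zF"
    by (simp add: scal_hom(2-4) left_diff_distrib distrib_right)
  also have "\<dots> \<in> kills"
    by (intro kills_closed(2) kills_diff[OF kills_rels[OF integral_relations(3)]]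
        kills_lift[OF l1] kills_lift[OF li] kills_lift[OF ls] int)
  finally show "xF * ?t - ?t * xF + ?t - scal 2 * zF \<in> kills" .
  have "?t * zF - zF * ?t + scal 2 * xF = (?t * zF - zF * ?t - (yF - xF)) + (xF + yF)"
    by (simp add: scal_two)
  also have "\<dots> \<in> kills" by (intro kills_closed(2) kills_rels[OF integral_relations(4)] xy)
  finally show "?t * zF - zF * ?t + scal 2 * xF \<in> kills" .
qed

lemma limit_sl2_triple:
  defines "h \<equiv> scal 2 * xF" and "f \<equiv> letter gTheta - zF"
  shows "h * zF - zF * h - scal 2 * zF \<in> kills" "h * f - f * h + scal 2 * f \<in> kills"
    "zF * f - f * zF - h \<in> kills"
proof -
  let ?t = "letter gTheta :: free_F"
  note sl = scal_left[of xF] scal_left[of zF] scal_left[of "letter gTheta"]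
    scal_scal distrib_left distrib_right left_diff_distrib right_diff_distrib mult.assoc
  have m: "scal 2 * p \<in> kills" if "p \<in> kills" for p
    using kills_closed(4)[OF that integral_const[of 2]] by (simp add: const_F_2)
  have "h * zF - zF * h - scal 2 * zF = scal 2 * (xF * zF - zF * xF - zF)"
    by (simp add: h_def sl)
  also have "\<dots> \<in> kills" by (intro m limit_relations)
  finally show "h * zF - zF * h - scal 2 * zF \<in> kills" .
  have "h * f - f * h + scal 2 * f =
     scal 2 * ((xF * ?t - ?t * xF + ?t - scal 2 * zF) - (xF * zF - zF * xF - zF))"
    by (simp add: h_def f_def scal_two algebra_simps)
  also have "\<dots> \<in> kills" by (intro m kills_diff limit_relations)
  finally show "h * f - f * h + scal 2 * f \<in> kills" .
  have "zF * f - f * zF - h = - (?t * zF - zF * ?t + scal 2 * xF)"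
    by (simp add: h_def f_def algebra_simps)
  also have "\<dots> \<in> kills" by (intro kills_uminus limit_relations)
  finally show "zF * f - f * zF - h \<in> kills" .
qed

lemma sl2_lift_bracket:
  assumes "M \<in> sl2" "N \<in> sl2"
  shows "sl2_lift M * sl2_lift N - sl2_lift N * sl2_lift M - sl2_lift (M ** N - N ** M) \<in> kills"
proof -
  obtain a b c where M: "M = sl2_mat a b c" using sl2_mat_surj[OF assms(1)] by blast
  obtain a' b' c' where N: "N = sl2_mat a' b' c'" using sl2_mat_surj[OF assms(2)] by blast
  let ?k = "const_F"
  have "sl2_lift M * sl2_lift N - sl2_lift N * sl2_lift M - sl2_lift (M ** N - N ** M) =
    scal (?k (a * b' - a' * b)) * ((scal 2 * xF) * zF - zF * (scal 2 * xF) - scal 2 * zF)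
     + scal (?k (a * c' - a' * c)) * ((scal 2 * xF) * (letter gTheta - zF) - (letter gTheta - zF) * (scal 2 * xF)
          + scal 2 * (letter gTheta - zF))
     + scal (?k (b * c' - b' * c)) * (zF * (letter gTheta - zF) - (letter gTheta - zF) * zF - scal 2 * xF)"
    unfolding M N sl2_mat_bracket sl2_lift_def sl2_mat_entries const_F_hom(3-6) const_F_2
    by (rule scal_times_sum_commutator)
  also have "\<dots> \<in> kills"
    by (intro kills_closed(2) kills_closed(4)[OF _ integral_const] limit_sl2_triple)
  finally show ?thesis .
qed

text \<open>A letter of the enveloping algebra is a matrix \<open>M = a H + b E + c F\<close>, which is sent to the same combination of \<open>2x\<close>, \<open>z\<close>,
  \<open>\<theta> - z\<close>. These elements generate the specialization because \<open>y = - x\<close> there.\<close>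

theorem specialization_one: "\<exists>h. h \<in> algebra_iso spec U_sl2"
proof -
  have qC1: "qC = 1" by (simp add: q1)
  interpret V: substitution "\<lambda>c. scal (const_F c)" sl2_lift by (rule const_substitution)
  interpret RF: substitution scalar_op "gen_op qF" by (rule op_substitution)
  interpret NW: normal_words "\<lambda>j i k. replicate j mH @ replicate i mE @ replicate k mF" sl2_op
     "\<lambda>j. sl2_op mH ^ j" "sl2_op mE" "sl2_op mF" "\<lambda>j n. (2 * of_int n) ^ j" 1
     "\<lambda>m. - (of_int (m + 1) * of_int m)" "\<lambda>m. 0"
    by (rule sl2_normal_words)
  let ?W = "{replicate j mH @ replicate i mE @ replicate k mF | j i k. True}"
  have lift_mats: "sl2_lift mH = scal 2 * xF" "sl2_lift mE = zF" "sl2_lift mF = letter gTheta - zF"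
    by (simp_all add: sl2_lift_def const_F_hom scal_hom)
  have half: "scal (const_F (1 / 2)) * (scal 2 * p) = p" for p :: free_F
    using const_F_hom(6)[of "1/2" 2] by (simp add: scal_scal const_F_2 const_F_hom(2) scal_hom(2))
  have "\<exists>h\<in>algebra_iso spec (presented_algebra sl2 sl2_rels).
    \<forall>p\<in>carrier (free_algebra sl2). h (tau (const_subst sl2_lift p)) =
      relation_ideal sl2 sl2_rels +>\<^bsub>free_algebra sl2\<^esub> p"
  proof (rule specialization_iso[OF PS.presentation_axioms])
    show "sl2_lift s \<in> integral_elems" for s by (rule integral_sl2_lift)
    show "const_subst sl2_lift (l - r) \<in> kills" if lr: "(l, r) \<in> sl2_rels" for l r
    proof -
      consider u v where "u \<in> sl2" "v \<in> sl2" "l = letter (u + v)" "r = letter u + letter v"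
        | c u where "u \<in> sl2" "l = letter (scale_mat c u)" "r = scal c * letter u"
        | u v where "u \<in> sl2" "v \<in> sl2" "l = letter u * letter v - letter v * letter u"
            "r = letter (u ** v - v ** u)"
        using lr unfolding sl2_rels_def by auto
      then show ?thesis
      proof cases
        case 1
        have "sl2_lift (u + v) = sl2_lift u + sl2_lift v"
          by (simp add: sl2_lift_def const_F_hom(3) scal_hom(3) distrib_right)
        then show ?thesis unfolding 1 by (simp add: V.subst_simps kills_closed(1))
      next
        case 2
        have "sl2_lift (scale_mat c u) = scal (const_F c) * sl2_lift u"
          by (simp add: sl2_lift_def const_F_hom(6) scal_hom(6) distrib_left mult.assoc)
        then show ?thesis unfolding 2 by (simp add: V.subst_simps kills_closed(1))
      next
        case 3
        show ?thesis unfolding 3(3,4) V.subst_simps by (rule sl2_lift_bracket[OF 3(1,2)])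
      qed
    qed
    show "\<exists>p\<in>carrier (free_algebra sl2). const_subst sl2_lift p - g \<in> kills"
      if g: "g \<in> {letter gTheta, xF, yF, zF}" for g
    proof -
      note carr = free_algebra_carrier free_algebra_consts letter_carrier[OF sl2_mat_in]
      have x: "const_subst sl2_lift (scal (1 / 2) * letter mH) = xF"
        by (simp only: V.subst_simps lift_mats half)
      have "const_subst sl2_lift (letter mF + letter mE) - letter gTheta \<in> kills"
        by (simp add: V.subst_simps lift_mats kills_closed(1))
      moreover have "letter mF + letter mE \<in> carrier (free_algebra sl2)" by (intro carr)
      moreover have "const_subst sl2_lift (scal (1 / 2) * letter mH) - xF \<in> kills"
        by (simp only: x diff_self kills_closed(1))
      moreover have half_H: "scal (1 / 2) * letter mH \<in> carrier (free_algebra sl2)" by (intro carr)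
      moreover have "const_subst sl2_lift (- (scal (1 / 2) * letter mH)) - yF \<in> kills"
      proof -
        have "const_subst sl2_lift (- (scal (1 / 2) * letter mH)) - yF = - (xF + yF)"
          by (simp only: V.subst_uminus x) simp
        then show ?thesis using kills_uminus[OF limit_relations(1)] by simp
      qed
      moreover have "- (scal (1 / 2) * letter mH) \<in> carrier (free_algebra sl2)"
        by (rule free_algebra_carrier(3)[OF half_H half_H])
      moreover have "const_subst sl2_lift (letter mE) - zF \<in> kills"
        by (simp add: V.subst_simps lift_mats kills_closed(1))
      moreover have "letter mE \<in> carrier (free_algebra sl2)" by (intro carr)
      ultimately show ?thesis using g by blast
    qed
    show "\<exists>p'. Poly_Mapping.keys p' \<subseteq> ?W \<and> p - p' \<in> PS.rels" if "p \<in> carrier (free_algebra sl2)" for p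
      using sl2_spanning[OF that] unfolding PS.span_words_def by blast
    show "p = 0" if p: "Poly_Mapping.keys p \<subseteq> ?W" and c: "p \<in> carrier (free_algebra sl2)"
      and k: "const_subst sl2_lift p \<in> kills" for p
    proof (rule NW.independent[OF p])
      have "specializes_to (\<rho>F (sl2_lift M)) (sl2_op M)" for M
      proof -
        have "specializes_to (op_x qF) (op_x 1)" "specializes_to (op_theta qF) (op_theta 1)"
          using specializes_to_gens(1,4) by (simp_all add: qC1)
        moreover have "\<rho>F (sl2_lift M) = scalar_op (const_F (2 * M $ 1 $ 1)) * op_x qF
            + scalar_op (const_F (M $ 1 $ 2)) * op_z + scalar_op (const_F (M $ 2 $ 1)) * (op_theta qF - op_z)"
          unfolding sl2_lift_def RF.subst_simps(1-4,7) rhoF_gens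
          by (rule diff_op_eqI) (simp add: op_simps const_F_hom(6) const_F_2 mult.commute mult.left_commute)
        ultimately show ?thesis
          unfolding sl2_op_def
          by (auto intro!: specializes_to_simps specializes_to_gens(3) lifts_to_simps(3))
      qed
      then have "specializes_to (\<rho>F (const_subst sl2_lift p)) (op_rep sl2_op p)"
        by (intro const_subst_specializes[OF _ c])
      then show "op_rep sl2_op p = 0" by (rule kills_imp_zero[OF k])
    qed
  qed
  then show ?thesis unfolding U_sl2_eq by blast
qed

end
end

theorem proposition4p6:
  fixes q :: real
  assumes "q > 0"
  shows "(q = 1 \<longrightarrow> algebra_iso (UA_specialization q) U_sl2 \<noteq> {}) \<and>
    (q \<noteq> 1 \<longrightarrow>
      (\<exists>h \<in> algebra_iso (UA_specialization q) (Uq (complex_of_real q)).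
         h (pure_tensor (ev q) UA 1 (Uq_x qF)) = Uq_x (complex_of_real q) \<and>
         h (pure_tensor (ev q) UA 1 (Uq_y qF)) = Uq_y (complex_of_real q) \<and>
         h (pure_tensor (ev q) UA 1 (Uq_z qF)) = Uq_z (complex_of_real q) \<and>
         h (pure_tensor (ev q) UA 1 (Uq_theta qF)) = Uq_theta (complex_of_real q)))"
proof -
  interpret specialization q by unfold_locales (rule assms)
  show ?thesis
  proof (intro conjI impI)
    assume "q = 1"
    from specialization_one[OF this] show "algebra_iso spec U_sl2 \<noteq> {}" by blast
  qed (rule specialization_generic)
qed

end
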